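(* Assume (in the setting and notation of the context) that the unitary $U$ and the unit vector $\Omega$ satisfy Assumptions (i)–(v), and that the self-adjoint operators $T_\pm\in\mathcal A_{S_\pm}$ appearing in Assumption (ii) are chosen such that $$e^{2\pi \mathrm{i}(Q+T_-)}=1+\mathcal O(L^{-\infty}),\qquad \|T_\pm\|\le C|\Lambda|$$ for some $C$ independent of $L$. Then $$\langle\Omega,T_-\Omega\rangle\in\mathbb Z_{(\mathcal O(L^{-\infty}))},$$ i.e. $\mathrm{dist}(\langle\Omega,T_-\Omega\rangle,\mathbb Z)=\mathcal O(L^{-\infty})$.
   Context: Setup. Fix $d,n\ge 1$; $L$ ranges over even positive integers. $\Lambda=\Lambda_L=\mathbb Z_L^d$ with $\mathbb Z_L=\mathbb Z/L\mathbb Z$ identified with $\{-L/2+1,\dots,L/2\}$; $\mathrm{dist}$ is the graph distance on $\Lambda$ and, for $X\subset\Lambda$ and $r\in\mathbb N$, $X^r=\{x\in\Lambda:\mathrm{dist}(x,X)\le r\}$. The quantum system is either (spins) $\mathcal H=\bigotimes_{x\in\Lambda}\mathbb C^n$, $\mathcal A=\mathcal L(\mathcal H)$, with $\mathcal A_X$ the operators of the form $O_X\otimes 1_{\Lambda\setminus X}$; or (fermions) $\mathcal H$ the antisymmetric Fock space over $\ell^2(\Lambda,\mathbb C^n)$ with CAR operators $c_{x,\sigma}$, and $\mathcal A_X$ the algebra of even elements (those commuting with the fermion parity) of the algebra generated by $c_{x,\sigma},c^*_{x,\sigma}$, $x\in X$; $\mathcal A=\mathcal A_\Lambda$. An operator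 in $\mathcal A_X$ is said to be supported in $X$. Sets: $\Gamma=\{x:0\le x_1<L/2\}$, $\partial_-=\{x:x_1=0\}$, $\partial_+=\{x:x_1=L/2-1\}$, $S_-=\{-L/8\le x_1\le L/8\}$, $S_m=\{L/8<x_1<L/2-L/8\}$, $S_+=\{-L/8\le x_1-L/2\le L/8\}$ (with $x_1$ taken mod $L$). For $X,X'\subset\Lambda$, $d_1(X,X')=\min\{|x_1-x_1'|:x\in X,x'\in X'\}$. Asymptotic conventions: all operators and states are sequences indexed by $L$; constants $C,c$ are independent of $L$. A quantity is $\mathcal O(L^{-\infty})$ if for every $k$ it is bounded by $C_kL^{-k}$ for all $L$ (for operators: in operator norm). $\mathbb Z_{(\epsilon)}=\{z\in\mathbb R:\mathrm{dist}(z,\mathbb Z)\le\epsilon\}$. For a unit vector $\psi$, $\mathrm{Var}_\psi(A)=\|(A-\langle\psi,A\psi\rangle)\psi\|^2$. A unit vector $\psi$ is clustering in the $x_1$-direction if there are $0<c,C<\infty$ (independent of $L$) with $|\langle\psi,AB\psi\rangle-\langle\psi,A\psi\rangle\langle\psi,B\psi\rangle|\le C\|A\|\|B\||X||X'|e^{-c\,d_1(X,X')}$ for all $X,X'$, $A\in\mathcal A_X$, $B\in\mathcal A_{X'}$. Charges: self-adjoint $Q_x\in\mathcal A_{\{x\}}$ with $\mathrm{Spec}(Q_x)\subset\mathbb Z$; $Q_X=\sum_{x\in X}Q_x$; $Q=Q_\Gamma$. Assumptions on a unitary $U\in\mathcal A$ and unit vector $\Omega\in\mathcal H$: (i) (almost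 locality) for every $k$ there is $C_k$ such that for all $X$, all $A\in\mathcal A_X$ and all $n\in\mathbb N$ there is $R_n\in\mathcal A_{X^n}$ with $\|U^*AU-R_n\|\le C_k\|A\||X|n^{-k}$; (ii) there are self-adjoint $T_\pm\in\mathcal A_{S_\pm}$ with $\|(U^*QU-Q)-T_--T_+\|=\mathcal O(L^{-\infty})$; (iii) $\mathrm{Var}_\Omega(U)=\mathcal O(L^{-\infty})$; (iv) (local charge fluctuations) there are self-adjoint $K_\pm\in\mathcal A_{\partial_\pm^{L/16}}$ with $\|K_\pm\|\le C|\Lambda|$ and $\mathrm{Var}_\Omega(Q-K_--K_+)=\mathcal O(L^{-\infty})$; (v) $\Omega$ is clustering in the $x_1$-direction. *)

theory Defs
  imports "HOL-Analysis.Analysis" "HOL-Library.List_Lexorder"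
begin

text \<open>Basis configurations: functions on modes (site, internal index) with values in nat.
  Spins use only internal index 0 (value = local basis state in 0..n-1);
  fermions use occupation numbers in 0..1 for every mode (x,s), s < n.
  Operators are matrices indexed by basis configurations, vectors are coefficient functions.\<close>

type_synonym cfg = "int list \<times> nat \<Rightarrow> nat"
type_synonym op = "cfg \<Rightarrow> cfg \<Rightarrow> complex"
type_synonym vec = "cfg \<Rightarrow> complex"

definition ops :: "cfg set \<Rightarrow> op set" where
  "ops B = {A. \<forall>i j. (i \<notin> B \<or> j \<notin> B) \<longrightarrow> A i j = 0}"

definition vecs :: "cfg set \<Rightarrow> vec set" where
  "vecs B = {v. \<forall>i. i \<notin> B \<longrightarrow> v i = 0}"

definition oid :: "cfg set \<Rightarrow> op" where
  "oid B = (\<lambda>i j. if i = j \<and> i \<in> B then 1 else 0)"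

definition oadd :: "op \<Rightarrow> op \<Rightarrow> op" where
  "oadd A C = (\<lambda>i j. A i j + C i j)"

definition osub :: "op \<Rightarrow> op \<Rightarrow> op" where
  "osub A C = (\<lambda>i j. A i j - C i j)"

definition osc :: "complex \<Rightarrow> op \<Rightarrow> op" where
  "osc c A = (\<lambda>i j. c * A i j)"

definition omul :: "cfg set \<Rightarrow> op \<Rightarrow> op \<Rightarrow> op" where
  "omul B A C = (\<lambda>i j. \<Sum>k\<in>B. A i k * C k j)"

definition oadj :: "op \<Rightarrow> op" where
  "oadj A = (\<lambda>i j. cnj (A j i))"

definition oapp :: "cfg set \<Rightarrow> op \<Rightarrow> vec \<Rightarrow> vec" where
  "oapp B A v = (\<lambda>i. \<Sum>j\<in>B. A i j * v j)"

definition inprod :: "cfg set \<Rightarrow> vec \<Rightarrow> vec \<Rightarrow> complex" where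
  "inprod B u v = (\<Sum>i\<in>B. cnj (u i) * v i)"

definition vnorm :: "cfg set \<Rightarrow> vec \<Rightarrow> real" where
  "vnorm B v = sqrt (\<Sum>i\<in>B. (cmod (v i))\<^sup>2)"

definition opnorm :: "cfg set \<Rightarrow> op \<Rightarrow> real" where
  "opnorm B A = Sup {vnorm B (oapp B A v) | v. v \<in> vecs B \<and> vnorm B v \<le> 1}"

definition opow :: "cfg set \<Rightarrow> op \<Rightarrow> nat \<Rightarrow> op" where
  "opow B A k = (omul B A ^^ k) (oid B)"

definition oexp :: "cfg set \<Rightarrow> op \<Rightarrow> op" where
  "oexp B A = (\<lambda>i j. \<Sum>k. opow B A k i j / of_nat (fact k))"

definition self_adjoint :: "cfg set \<Rightarrow> op \<Rightarrow> bool" where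
  "self_adjoint B A \<longleftrightarrow> A \<in> ops B \<and> oadj A = A"

definition unitary :: "cfg set \<Rightarrow> op \<Rightarrow> bool" where
  "unitary B U \<longleftrightarrow> U \<in> ops B \<and> omul B (oadj U) U = oid B \<and> omul B U (oadj U) = oid B"

definition spectrum :: "cfg set \<Rightarrow> op \<Rightarrow> complex set" where
  "spectrum B A = {\<mu>. \<not> (\<exists>R\<in>ops B.
      omul B (osub A (osc \<mu> (oid B))) R = oid B \<and> omul B R (osub A (osc \<mu> (oid B))) = oid B)}"

definition var :: "cfg set \<Rightarrow> vec \<Rightarrow> op \<Rightarrow> real" where
  "var B \<psi> A = (vnorm B (\<lambda>i. oapp B A \<psi> i - inprod B \<psi> (oapp B A \<psi>) * \<psi> i))\<^sup>2"

definition rapid :: "(nat \<Rightarrow> real) \<Rightarrow> bool" where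
  "rapid f \<longleftrightarrow> (\<forall>k::nat. \<exists>C. \<forall>L. even L \<and> L > 0 \<longrightarrow> \<bar>f L\<bar> \<le> C / real L ^ k)"

definition half :: "nat \<Rightarrow> int" where
  "half L = int L div 2"

text \<open>Lambda_L = Z_L^d with representatives -L/2+1 .. L/2; x!0 is the coordinate x_1.\<close>
definition lattice :: "nat \<Rightarrow> nat \<Rightarrow> int list set" where
  "lattice d L = {x. length x = d \<and> (\<forall>i<d. - half L < x ! i \<and> x ! i \<le> half L)}"

definition cdist :: "nat \<Rightarrow> int \<Rightarrow> int \<Rightarrow> int" where
  "cdist L a b = min ((a - b) mod int L) ((b - a) mod int L)"

definition ldist :: "nat \<Rightarrow> int list \<Rightarrow> int list \<Rightarrow> int" where
  "ldist L x y = (\<Sum>i<length x. cdist L (x ! i) (y ! i))"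

definition nbhd :: "nat \<Rightarrow> nat \<Rightarrow> int list set \<Rightarrow> real \<Rightarrow> int list set" where
  "nbhd d L X r = {x \<in> lattice d L. \<exists>y\<in>X. real_of_int (ldist L x y) \<le> r}"

definition Gamma :: "nat \<Rightarrow> nat \<Rightarrow> int list set" where
  "Gamma d L = {x \<in> lattice d L. 0 \<le> x ! 0 \<and> x ! 0 < half L}"

definition bdry_minus :: "nat \<Rightarrow> nat \<Rightarrow> int list set" where
  "bdry_minus d L = {x \<in> lattice d L. x ! 0 = 0}"

definition bdry_plus :: "nat \<Rightarrow> nat \<Rightarrow> int list set" where
  "bdry_plus d L = {x \<in> lattice d L. x ! 0 = half L - 1}"

definition S_minus :: "nat \<Rightarrow> nat \<Rightarrow> int list set" where
  "S_minus d L = {x \<in> lattice d L. real_of_int (cdist L (x ! 0) 0) \<le> real L / 8}"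

definition S_plus :: "nat \<Rightarrow> nat \<Rightarrow> int list set" where
  "S_plus d L = {x \<in> lattice d L. real_of_int (cdist L (x ! 0) (half L)) \<le> real L / 8}"

definition d1 :: "nat \<Rightarrow> int list set \<Rightarrow> int list set \<Rightarrow> nat" where
  "d1 L X Y = Inf {nat (cdist L (x ! 0) (y ! 0)) | x y. x \<in> X \<and> y \<in> Y}"

definition spin_basis :: "nat \<Rightarrow> nat \<Rightarrow> nat \<Rightarrow> cfg set" where
  "spin_basis d n L = {\<sigma>. (\<forall>x s. \<sigma> (x, s) \<noteq> 0 \<longrightarrow> x \<in> lattice d L \<and> s = 0)
                         \<and> (\<forall>x\<in>lattice d L. \<sigma> (x, 0) < n)}"

definition restr :: "cfg \<Rightarrow> int list set \<Rightarrow> cfg" where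
  "restr \<sigma> X = (\<lambda>(x, s). if x \<in> X then \<sigma> (x, s) else 0)"

text \<open>A_X: operators of the form O_X tensor 1_{Lambda - X}.\<close>
definition spin_alg :: "nat \<Rightarrow> nat \<Rightarrow> nat \<Rightarrow> int list set \<Rightarrow> op set" where
  "spin_alg d n L X = {A \<in> ops (spin_basis d n L). \<exists>Oloc :: op.
      \<forall>\<sigma>\<in>spin_basis d n L. \<forall>\<tau>\<in>spin_basis d n L.
        A \<sigma> \<tau> = (if (\<forall>x\<in>lattice d L - X. \<sigma> (x, 0) = \<tau> (x, 0))
                   then Oloc (restr \<sigma> X) (restr \<tau> X) else 0)}"

definition modes :: "nat \<Rightarrow> nat \<Rightarrow> nat \<Rightarrow> (int list \<times> nat) set" where
  "modes d n L = {(x, s). x \<in> lattice d L \<and> s < n}"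

definition fermi_basis :: "nat \<Rightarrow> nat \<Rightarrow> nat \<Rightarrow> cfg set" where
  "fermi_basis d n L = {\<nu>. (\<forall>m. \<nu> m \<noteq> 0 \<longrightarrow> m \<in> modes d n L) \<and> (\<forall>m. \<nu> m \<le> 1)}"

text \<open>Annihilation operator c_m on the Fock space (Jordan--Wigner sign w.r.t. the
  lexicographic order of modes).\<close>
definition mode_less :: "int list \<times> nat \<Rightarrow> int list \<times> nat \<Rightarrow> bool" where
  "mode_less m m' \<longleftrightarrow> fst m < fst m' \<or> (fst m = fst m' \<and> snd m < snd m')"

definition annih :: "nat \<Rightarrow> nat \<Rightarrow> nat \<Rightarrow> int list \<times> nat \<Rightarrow> op" where
  "annih d n L m = (\<lambda>\<nu>' \<nu>. if \<nu> \<in> fermi_basis d n L \<and> \<nu> m = 1 \<and> \<nu>' = \<nu>(m := 0)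
      then (-1) ^ card {m' \<in> modes d n L. mode_less m' m \<and> \<nu> m' = 1} else 0)"

inductive_set gen_alg :: "cfg set \<Rightarrow> op set \<Rightarrow> op set" for B G where
  one: "oid B \<in> gen_alg B G"
| gen: "g \<in> G \<Longrightarrow> g \<in> gen_alg B G"
| add: "A \<in> gen_alg B G \<Longrightarrow> C \<in> gen_alg B G \<Longrightarrow> oadd A C \<in> gen_alg B G"
| mul: "A \<in> gen_alg B G \<Longrightarrow> C \<in> gen_alg B G \<Longrightarrow> omul B A C \<in> gen_alg B G"
| smul: "A \<in> gen_alg B G \<Longrightarrow> osc c A \<in> gen_alg B G"

definition parity :: "nat \<Rightarrow> nat \<Rightarrow> nat \<Rightarrow> op" where
  "parity d n L = (\<lambda>\<nu> \<nu>'. if \<nu> = \<nu>' \<and> \<nu> \<in> fermi_basis d n L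
      then (-1) ^ (\<Sum>m\<in>modes d n L. \<nu> m) else 0)"

definition fermi_alg :: "nat \<Rightarrow> nat \<Rightarrow> nat \<Rightarrow> int list set \<Rightarrow> op set" where
  "fermi_alg d n L X = {A \<in> gen_alg (fermi_basis d n L)
        (\<Union>m\<in>{(x, s). x \<in> X \<inter> lattice d L \<and> s < n}. {annih d n L m, oadj (annih d n L m)}).
      omul (fermi_basis d n L) A (parity d n L) = omul (fermi_basis d n L) (parity d n L) A}"

definition charge_sum :: "(int list \<Rightarrow> op) \<Rightarrow> int list set \<Rightarrow> op" where
  "charge_sum Qx Y = (\<lambda>i j. \<Sum>x\<in>Y. Qx x i j)"

end

theory Submission
  imports Defs "HOL-Library.Function_Algebras" "HOL-Computational_Algebra.Fundamental_Theorem_Algebra"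
begin

text \<open>Split \<open>Q = q\<^sub>- + q\<^sub>0 + q\<^sub>+\<close> into the charges in \<open>S\<^sub>-\<close>, in between, and in \<open>S\<^sub>+\<close>, and let
  \<open>k\<^sub>\<plusminus>\<close> be localized approximations of \<open>U\<^sup>*K\<^sub>\<plusminus>U\<close>.  Put \<open>Y\<^sub>\<plusminus> = q\<^sub>\<plusminus> - K\<^sub>\<plusminus>\<close> and
  \<open>X\<^sub>\<plusminus> = q\<^sub>\<plusminus> + T\<^sub>\<plusminus> - k\<^sub>\<plusminus>\<close>; then \<open>Qb = Y\<^sub>- + q\<^sub>0 + Y\<^sub>+\<close> has \<open>\<psi>\<close> as an almost eigenvector and
  \<open>U\<^sup>*Qb U\<close> is close to \<open>X = X\<^sub>- + q\<^sub>0 + X\<^sub>+\<close>.  Hence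
  \<open>exp(-itX) exp(itQb) = [exp(-itX\<^sub>-) exp(itY\<^sub>-)] [exp(-itX\<^sub>+) exp(itY\<^sub>+)]\<close> almost fixes \<open>\<psi>\<close>, and clustering
  forces \<open>w(t) = \<langle>exp(-itX\<^sub>-) exp(itY\<^sub>-)\<rangle>\<close> to be almost a phase.  Differentiating, \<open>w\<close> almost solves
  \<open>w' = -i\<langle>T\<^sub>-\<rangle>w\<close>, so \<open>w(-2\<pi>)\<close> is close to \<open>exp(2\<pi>i\<langle>T\<^sub>-\<rangle>)\<close>.  On the other hand the integrality of the charges and
  \<open>exp(2\<pi>i(Q + T\<^sub>-)) \<approx> 1\<close> give \<open>exp(2\<pi>iX\<^sub>-) \<approx> U\<^sup>*exp(2\<pi>iY\<^sub>-)U\<close>, and since \<open>\<psi>\<close> is an almost eigenvector of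
  both \<open>U\<close> and (again by clustering) \<open>exp(2\<pi>iY\<^sub>-)\<close>, \<open>w(-2\<pi>) \<approx> 1\<close>.  No bound on the norm of \<open>Q\<close> is
  available, which is why the argument runs through unitaries instead of \<open>Q\<close> itself.\<close>

section \<open>Finite matrices and vectors\<close>

text \<open>\<open>w\<close> is nearly a phase for this reason: a minus factor times a plus factor
  has expectation near 1, clustering splits it into two expectations of modulus at most 1, so each
  modulus is near 1. Passing from modulus to vectors costs a square root of the error. The only
  norms available are volume bounds on \<open>Tm\<close> and \<open>Km\<close>; they enter through
  the difference of two generators, in which the charges cancel, and a polynomial factor is harmless
  against rapid decay. The plus side satisfies exp(2\<pi>i(q+ + T+)) close to 1 although only the
  minus side is assumed to: U* Q U has integer spectrum, so the exponentials of q- + T-, q0 and q+ +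
  T+ multiply to almost 1, and the first two are known. The endpoint is -2\<pi> because the
  derivative of \<open>w\<close> carries -i. Exponentials are limits of polynomials in local
  operators; the limit is taken inside the clustering inequality, with slack in the norms. Spins and
  fermions enter only through algebras that commute when their supports are disjoint, so the
  analysis takes place at one fixed L with one error \<open>\<epsilon>\<close>.\<close>

definition vsc :: "complex \<Rightarrow> vec \<Rightarrow> vec" where
  "vsc c v = (\<lambda>i. c * v i)"

lemma vsc_apply [simp]: "vsc c v i = c * v i"
  by (simp add: vsc_def)

lemma vsc_1 [simp]: "vsc 1 v = v" and vsc_0 [simp]: "vsc 0 v = 0"
  and vsc_vsc [simp]: "vsc a (vsc b v) = vsc (a * b) v"
  by (auto simp: fun_eq_iff)

lemma vsc_add_right: "vsc c (u + v) = vsc c u + vsc c v"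
  and vsc_diff_right: "vsc c (u - v) = vsc c u - vsc c v"
  by (auto simp: fun_eq_iff algebra_simps)

lemma vecs_closed [simp, intro]:
  "0 \<in> vecs B" "u \<in> vecs B \<Longrightarrow> vsc c u \<in> vecs B"
  "u \<in> vecs B \<Longrightarrow> v \<in> vecs B \<Longrightarrow> u + v \<in> vecs B"
  "u \<in> vecs B \<Longrightarrow> v \<in> vecs B \<Longrightarrow> u - v \<in> vecs B"
  by (auto simp: vecs_def)

lemma ops_closed [simp, intro]:
  "oid B \<in> ops B" "A \<in> ops B \<Longrightarrow> osc c A \<in> ops B"
  "A \<in> ops B \<Longrightarrow> C \<in> ops B \<Longrightarrow> oadd A C \<in> ops B"
  "A \<in> ops B \<Longrightarrow> C \<in> ops B \<Longrightarrow> osub A C \<in> ops B"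
  "A \<in> ops B \<Longrightarrow> C \<in> ops B \<Longrightarrow> omul B A C \<in> ops B"
  "A \<in> ops B \<Longrightarrow> oadj A \<in> ops B"
  by (auto simp: ops_def oid_def osc_def oadd_def osub_def omul_def oadj_def)

lemma oapp_in_vecs [simp, intro]: "A \<in> ops B \<Longrightarrow> oapp B A v \<in> vecs B"
  by (auto simp: ops_def vecs_def oapp_def)

lemma oapp_oadd: "oapp B (oadd A C) v = oapp B A v + oapp B C v"
  and oapp_osub: "oapp B (osub A C) v = oapp B A v - oapp B C v"
  and oapp_osc: "oapp B (osc c A) v = vsc c (oapp B A v)"
  and oapp_add: "oapp B A (u + v) = oapp B A u + oapp B A v"
  and oapp_diff: "oapp B A (u - v) = oapp B A u - oapp B A v"
  and oapp_vsc: "oapp B A (vsc c v) = vsc c (oapp B A v)"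
  and oapp_0 [simp]: "oapp B A 0 = 0"
  by (auto simp: oapp_def oadd_def osub_def osc_def fun_eq_iff algebra_simps
      sum.distrib sum_subtractf sum_distrib_left)

lemmas oapp_simps = oapp_oadd oapp_osub oapp_osc oapp_add oapp_diff oapp_vsc

lemma inprod_add_left: "inprod B (u + v) w = inprod B u w + inprod B v w"
  and inprod_add_right: "inprod B w (u + v) = inprod B w u + inprod B w v"
  and inprod_diff_left: "inprod B (u - v) w = inprod B u w - inprod B v w"
  and inprod_diff_right: "inprod B w (u - v) = inprod B w u - inprod B w v"
  and inprod_vsc_left: "inprod B (vsc c u) w = cnj c * inprod B u w"
  and inprod_vsc_right: "inprod B w (vsc c u) = c * inprod B w u"
  and inprod_0_left [simp]: "inprod B 0 w = 0"
  and inprod_0_right [simp]: "inprod B w 0 = 0"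
  by (auto simp: inprod_def algebra_simps sum.distrib sum_subtractf sum_distrib_left)

lemmas inprod_simps = inprod_add_left inprod_add_right inprod_diff_left inprod_diff_right
  inprod_vsc_left inprod_vsc_right

lemma inprod_cnj: "cnj (inprod B u v) = inprod B v u"
  by (simp add: inprod_def mult.commute)

lemma inprod_oadj: "inprod B u (oapp B A v) = inprod B (oapp B (oadj A) u) v"
proof -
  have "inprod B u (oapp B A v) = (\<Sum>i\<in>B. \<Sum>j\<in>B. cnj (u i) * (A i j * v j))"
    by (simp add: inprod_def oapp_def sum_distrib_left)
  also have "\<dots> = (\<Sum>j\<in>B. \<Sum>i\<in>B. cnj (u i) * (A i j * v j))"
    by (rule sum.swap)
  also have "\<dots> = inprod B (oapp B (oadj A) u) v"
    by (simp add: inprod_def oapp_def oadj_def sum_distrib_left mult_ac)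
  finally show ?thesis .
qed

lemma inprod_self_adjoint:
  "self_adjoint B A \<Longrightarrow> inprod B (oapp B A u) v = inprod B u (oapp B A v)"
  by (simp add: inprod_oadj self_adjoint_def)

lemma vnorm_eq_L2_set: "vnorm B v = L2_set (\<lambda>i. cmod (v i)) B"
  by (simp add: vnorm_def L2_set_def)

lemma vnorm_nonneg [simp]: "0 \<le> vnorm B v"
  by (simp add: vnorm_def sum_nonneg)

lemma vnorm_0 [simp]: "vnorm B 0 = 0"
  by (simp add: vnorm_def)

lemma vnorm_triangle: "vnorm B (u + v) \<le> vnorm B u + vnorm B v"
  unfolding vnorm_eq_L2_set plus_fun_apply
  by (rule order_trans[OF L2_set_mono L2_set_triangle_ineq]) (auto simp: norm_triangle_ineq)

lemma vnorm_vsc [simp]: "vnorm B (vsc c v) = cmod c * vnorm B v"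
  unfolding vnorm_eq_L2_set vsc_apply norm_mult by (simp add: L2_set_right_distrib)

lemma vnorm_minus_commute: "vnorm B (u - v) = vnorm B (v - u)"
  by (simp add: vnorm_def norm_minus_commute)

lemma vnorm_triangle_diff: "vnorm B (u - w) \<le> vnorm B (u - v) + vnorm B (v - w)"
  using vnorm_triangle[of B "u - v" "v - w"] by simp

lemma vnorm_diff_le: "vnorm B (u - v) \<le> vnorm B u + vnorm B v"
  using vnorm_triangle[of B u "vsc (-1) v"] by (simp add: fun_eq_iff vnorm_def fun_diff_def plus_fun_def)

lemma inprod_self: "inprod B v v = of_real ((vnorm B v)\<^sup>2)"
  by (simp add: inprod_def vnorm_def sum_nonneg mult.commute flip: complex_norm_square)

lemma inprod_Cauchy_Schwarz: "cmod (inprod B u v) \<le> vnorm B u * vnorm B v"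
proof -
  have "cmod (inprod B u v) \<le> (\<Sum>i\<in>B. \<bar>cmod (u i)\<bar> * \<bar>cmod (v i)\<bar>)"
    unfolding inprod_def by (rule order_trans[OF norm_sum]) (simp add: norm_mult)
  also have "\<dots> \<le> vnorm B u * vnorm B v"
    unfolding vnorm_eq_L2_set by (rule L2_set_mult_ineq)
  finally show ?thesis .
qed

text \<open>A norm bound as a plain inequality in which any upper bound \<open>c\<close> is allowed:
  such bounds combine without handling the supremum in \<open>opnorm\<close>.\<close>

definition obounded :: "cfg set \<Rightarrow> op \<Rightarrow> real \<Rightarrow> bool" where
  "obounded B A c \<longleftrightarrow> (\<forall>v\<in>vecs B. vnorm B (oapp B A v) \<le> c * vnorm B v)"

lemma oboundedD: "obounded B A c \<Longrightarrow> v \<in> vecs B \<Longrightarrow> vnorm B (oapp B A v) \<le> c * vnorm B v"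
  by (simp add: obounded_def)

lemma obounded_mono: "obounded B A c \<Longrightarrow> c \<le> c' \<Longrightarrow> obounded B A c'"
  unfolding obounded_def by (meson mult_right_mono order_trans vnorm_nonneg)

lemma obounded_oadd: "obounded B A a \<Longrightarrow> obounded B C c \<Longrightarrow> obounded B (oadd A C) (a + c)"
  unfolding obounded_def oapp_oadd distrib_right
  by (meson add_mono order_trans vnorm_triangle)

lemma obounded_osub: "obounded B A a \<Longrightarrow> obounded B C c \<Longrightarrow> obounded B (osub A C) (a + c)"
  unfolding obounded_def oapp_osub distrib_right
  by (meson add_mono order_trans vnorm_diff_le)

lemma obounded_osc: "obounded B A a \<Longrightarrow> obounded B (osc c A) (cmod c * a)"
  unfolding obounded_def oapp_osc by (auto simp: mult_left_mono mult.assoc)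

abbreviation oconj :: "cfg set \<Rightarrow> op \<Rightarrow> op \<Rightarrow> op" where
  "oconj B U A \<equiv> omul B (omul B (oadj U) A) U"

text \<open>Spins and fermions differ here only in the index set. Finiteness makes the matrix
  calculus meaningful, since a sum over an infinite set is 0 by convention.\<close>

locale fin_basis =
  fixes B :: "cfg set"
  assumes fin [simp]: "finite B"
begin

lemma oapp_omul: "oapp B (omul B A C) v = oapp B A (oapp B C v)"
proof
  fix i
  have "oapp B (omul B A C) v i = (\<Sum>j\<in>B. \<Sum>k\<in>B. A i k * C k j * v j)"
    by (simp add: oapp_def omul_def sum_distrib_right)
  also have "\<dots> = (\<Sum>k\<in>B. \<Sum>j\<in>B. A i k * C k j * v j)"
    by (rule sum.swap)
  also have "\<dots> = oapp B A (oapp B C v) i"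
    by (simp add: oapp_def sum_distrib_left mult.assoc)
  finally show "oapp B (omul B A C) v i = oapp B A (oapp B C v) i" .
qed

lemma oapp_oid [simp]: "v \<in> vecs B \<Longrightarrow> oapp B (oid B) v = v"
proof
  fix i assume "v \<in> vecs B"
  have "oapp B (oid B) v i = (\<Sum>j\<in>B. if i = j then v j else 0)"
    unfolding oapp_def oid_def by (rule sum.cong) auto
  then show "oapp B (oid B) v i = v i"
    using \<open>v \<in> vecs B\<close> by (auto simp: vecs_def)
qed

definition delta :: "cfg \<Rightarrow> vec" where
  "delta j = (\<lambda>i. if i = j then 1 else 0)"

lemma delta_in_vecs [simp]: "j \<in> B \<Longrightarrow> delta j \<in> vecs B"
  by (auto simp: delta_def vecs_def)

lemma oapp_delta: "j \<in> B \<Longrightarrow> oapp B A (delta j) i = A i j"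
  by (simp add: oapp_def delta_def if_distrib cong: if_cong)

lemma ops_eqI:
  assumes "A \<in> ops B" "C \<in> ops B" "\<And>v. v \<in> vecs B \<Longrightarrow> oapp B A v = oapp B C v"
  shows "A = C"
proof (intro ext)
  fix i j
  show "A i j = C i j"
  proof (cases "j \<in> B")
    case True
    then show ?thesis
      using assms(3)[of "delta j"] oapp_delta by (metis delta_in_vecs)
  qed (use assms(1,2) in \<open>auto simp: ops_def\<close>)
qed

lemma vecs_eqI: "u \<in> vecs B \<Longrightarrow> v \<in> vecs B \<Longrightarrow> vnorm B (u - v) = 0 \<Longrightarrow> u = v"
  by (rule ext) (auto simp: vecs_def vnorm_def sum_nonneg_eq_0_iff)

text \<open>With w = \<open>oapp B (oadj A) v\<close>, the squared norm of w equals the pairing of v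
  with A w, hence is at most c times the norms of v and w; one norm of w cancels.\<close>

lemma obounded_oadj:
  assumes "obounded B A c" "A \<in> ops B" "0 \<le> c"
  shows "obounded B (oadj A) c"
  unfolding obounded_def
proof
  fix v assume v: "v \<in> vecs B"
  let ?w = "oapp B (oadj A) v"
  have "(vnorm B ?w)\<^sup>2 = cmod (inprod B ?w ?w)"
    by (simp add: inprod_self norm_power)
  also have "\<dots> = cmod (inprod B v (oapp B A ?w))"
    by (simp add: inprod_oadj)
  also have "\<dots> \<le> vnorm B v * (c * vnorm B ?w)"
    by (rule order_trans[OF inprod_Cauchy_Schwarz])
      (use assms in \<open>auto intro!: mult_left_mono oboundedD\<close>)
  finally have "vnorm B ?w * vnorm B ?w \<le> (c * vnorm B v) * vnorm B ?w"
    by (simp add: power2_eq_square mult_ac)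
  then show "vnorm B ?w \<le> c * vnorm B v"
    using assms(3) by (cases "vnorm B ?w = 0") (auto simp: less_le)
qed

lemma unitary_simps:
  assumes "unitary B U" "v \<in> vecs B"
  shows "oapp B (oadj U) (oapp B U v) = v" "oapp B U (oapp B (oadj U) v) = v"
  using assms by (metis oapp_omul oapp_oid unitary_def)+

lemma unitary_inprod:
  assumes "unitary B U" "v \<in> vecs B"
  shows "inprod B (oapp B U u) (oapp B U v) = inprod B u v"
  using unitary_simps(1)[OF assms] inprod_oadj[of B "oapp B U v" U u]
  by (metis inprod_cnj)

lemma unitary_vnorm:
  assumes "unitary B U" "v \<in> vecs B"
  shows "vnorm B (oapp B U v) = vnorm B v"
proof -
  have "complex_of_real ((vnorm B (oapp B U v))\<^sup>2) = of_real ((vnorm B v)\<^sup>2)"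
    using unitary_inprod[OF assms] by (metis inprod_self)
  then show ?thesis
    by (metis of_real_eq_iff power2_eq_iff_nonneg vnorm_nonneg)
qed

lemma oadj_oadj [simp]: "oadj (oadj A) = A"
  by (simp add: oadj_def)

lemma unitary_oadj: "unitary B U \<Longrightarrow> unitary B (oadj U)"
  by (auto simp: unitary_def)

text \<open>A crude norm, continuous in the entries. It shows that the supremum in
  \<open>opnorm\<close> is finite, dominates the exponential series, and turns entrywise convergence
  into convergence in norm.\<close>

definition osum :: "op \<Rightarrow> real" where
  "osum A = (\<Sum>i\<in>B. \<Sum>j\<in>B. cmod (A i j))"

lemma osum_nonneg: "0 \<le> osum A"
  by (simp add: osum_def sum_nonneg)

lemma cmod_le_vnorm: "i \<in> B \<Longrightarrow> cmod (v i) \<le> vnorm B v"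
  unfolding vnorm_eq_L2_set by (rule member_le_L2_set) auto

lemma obounded_osum: "obounded B A (osum A)"
  unfolding obounded_def
proof
  fix v assume "v \<in> vecs B"
  have "vnorm B (oapp B A v) \<le> (\<Sum>i\<in>B. cmod (oapp B A v i))"
    unfolding vnorm_eq_L2_set by (rule L2_set_le_sum) auto
  also have "\<dots> \<le> (\<Sum>i\<in>B. \<Sum>j\<in>B. cmod (A i j) * vnorm B v)"
    unfolding oapp_def
    by (intro sum_mono order_trans[OF norm_sum]) (auto simp: norm_mult cmod_le_vnorm intro!: mult_left_mono)
  also have "\<dots> = osum A * vnorm B v"
    by (simp add: osum_def sum_distrib_right)
  finally show "vnorm B (oapp B A v) \<le> osum A * vnorm B v" .
qed

lemma opnorm_bdd: "bdd_above {vnorm B (oapp B A v) | v. v \<in> vecs B \<and> vnorm B v \<le> 1}"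
proof (rule bdd_aboveI[of _ "osum A"])
  fix x assume "x \<in> {vnorm B (oapp B A v) | v. v \<in> vecs B \<and> vnorm B v \<le> 1}"
  then obtain v where "x = vnorm B (oapp B A v)" "v \<in> vecs B" "vnorm B v \<le> 1" by blast
  then show "x \<le> osum A"
    using oboundedD[OF obounded_osum, of v A] mult_left_mono[of "vnorm B v" 1 "osum A"] osum_nonneg[of A]
    by simp
qed

lemma opnorm_nonneg: "0 \<le> opnorm B A"
proof -
  have "vnorm B (oapp B A 0) \<le> opnorm B A"
    unfolding opnorm_def by (rule cSup_upper[OF _ opnorm_bdd]) force
  then show ?thesis by simp
qed

lemma obounded_opnorm: "obounded B A (opnorm B A)"
  unfolding obounded_def
proof
  fix v assume v: "v \<in> vecs B"
  show "vnorm B (oapp B A v) \<le> opnorm B A * vnorm B v"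
  proof (cases "vnorm B v = 0")
    case True
    then have "v = 0" using vecs_eqI[of v 0] v by simp
    then show ?thesis by (simp add: opnorm_nonneg)
  next
    case False
    then have pos: "vnorm B v > 0" by (simp add: less_le)
    let ?u = "vsc (of_real (inverse (vnorm B v))) v"
    have "vnorm B (oapp B A ?u) \<le> opnorm B A"
      unfolding opnorm_def
      by (rule cSup_upper[OF _ opnorm_bdd]) (use v pos in \<open>auto intro!: exI[of _ ?u] simp: norm_inverse\<close>)
    then show ?thesis
      using pos by (simp add: oapp_vsc norm_inverse norm_divide field_simps)
  qed
qed

lemma opnorm_le: 
  assumes "obounded B A c" "0 \<le> c" 
  shows "opnorm B A \<le> c"
  unfolding opnorm_def
proof (rule cSup_least)
  fix x assume "x \<in> {vnorm B (oapp B A v) | v. v \<in> vecs B \<and> vnorm B v \<le> 1}"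
  then obtain v where "x = vnorm B (oapp B A v)" "v \<in> vecs B" "vnorm B v \<le> 1" by blast
  then show "x \<le> c"
    using oboundedD[OF assms(1), of v] mult_left_mono[of "vnorm B v" 1 c] assms(2) by simp
qed (auto intro!: exI[of _ 0])

end

section \<open>Unitary groups generated by self-adjoint matrices\<close>

context fin_basis
begin

lemma opow_0: "opow B A 0 = oid B"
  and opow_Suc: "opow B A (Suc k) = omul B A (opow B A k)"
  by (simp_all add: opow_def)

lemma opow_in_ops [simp, intro]: "A \<in> ops B \<Longrightarrow> opow B A k \<in> ops B"
  by (induction k) (auto simp: opow_0 opow_Suc)

lemma opow_osc: "opow B (osc z A) k = osc (z ^ k) (opow B A k)"
  by (induction k)
    (auto simp: opow_0 opow_Suc osc_def omul_def fun_eq_iff sum_distrib_left mult_ac)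

lemma cmod_opow_le:
  assumes "A \<in> ops B"
  shows "cmod (opow B A k i j) \<le> osum A ^ k"
proof (induction k arbitrary: i)
  case 0
  then show ?case by (simp add: opow_0 oid_def)
next
  case (Suc k)
  have row: "(\<Sum>l\<in>B. cmod (A i l)) \<le> osum A"
  proof (cases "i \<in> B")
    case True
    then show ?thesis unfolding osum_def by (intro member_le_sum) (auto simp: sum_nonneg)
  next
    case False
    then have "(\<Sum>l\<in>B. cmod (A i l)) = 0" using assms by (simp add: ops_def)
    then show ?thesis using osum_nonneg[of A] by simp
  qed
  have "cmod (opow B A (Suc k) i j) \<le> (\<Sum>l\<in>B. cmod (A i l) * osum A ^ k)"
    unfolding opow_Suc omul_def
    by (rule order_trans[OF norm_sum]) (auto simp: norm_mult intro!: sum_mono mult_left_mono Suc)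
  also have "\<dots> = (\<Sum>l\<in>B. cmod (A i l)) * osum A ^ k"
    by (simp add: sum_distrib_right)
  also have "\<dots> \<le> osum A * osum A ^ k"
    by (intro mult_right_mono row zero_le_power osum_nonneg)
  finally show ?case by simp
qed

text \<open>The scalar \<open>z\<close> is kept apart from \<open>A\<close>, so that each entry of
  the exponential is an entire power series in \<open>z\<close> and can be differentiated
  termwise.\<close>

lemma oexp_summable:
  assumes "A \<in> ops B"
  shows "summable (\<lambda>k. opow B A k i j / of_nat (fact k) * z ^ k)"
proof (rule summable_comparison_test[OF _ summable_exp[of "osum A * cmod z"]], intro exI allI impI)
  fix k :: nat
  have "cmod (opow B A k i j / of_nat (fact k) * z ^ k) = inverse (fact k) * (cmod (opow B A k i j) * cmod z ^ k)"
    by (simp add: norm_mult norm_divide norm_power norm_inverse divide_inverse)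
  also have "\<dots> \<le> inverse (fact k) * (osum A ^ k * cmod z ^ k)"
    by (intro mult_left_mono mult_right_mono cmod_opow_le assms) auto
  finally show "norm (opow B A k i j / of_nat (fact k) * z ^ k) \<le> inverse (fact k) * (osum A * cmod z) ^ k"
    by (simp add: power_mult_distrib)
qed

lemma oexp_osc: "oexp B (osc z A) i j = (\<Sum>k. opow B A k i j / of_nat (fact k) * z ^ k)"
  unfolding oexp_def opow_osc by (simp add: osc_def mult.commute)

lemma oexp_in_ops [simp, intro]: "A \<in> ops B \<Longrightarrow> oexp B A \<in> ops B"
  using opow_in_ops[of A] by (auto simp: ops_def oexp_def)

lemma oexp_has_field_derivative:
  assumes "A \<in> ops B"
  shows "((\<lambda>z. oexp B (osc z A) i j) has_field_derivative omul B A (oexp B (osc z A)) i j) (at z)"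
proof -
  let ?c = "\<lambda>i j k. opow B A k i j / of_nat (fact k)"
  \<comment> \<open>The shift in \<open>diffs\<close> cancels one factor of the factorial and leaves
    the next power of \<open>A\<close>, that is, one extra factor \<open>A\<close> on the
    left.\<close>
  have "diffs (?c i j) k = (\<Sum>l\<in>B. A i l * ?c l j k)" for k
  proof -
    have "of_nat (fact (Suc k)) = of_nat (Suc k) * complex_of_nat (fact k)"
      by (simp only: fact_Suc of_nat_mult of_nat_id)
    then have "diffs (?c i j) k = opow B A (Suc k) i j / of_nat (fact k)"
      unfolding diffs_def by (simp del: of_nat_Suc of_nat_fact fact_Suc)
    then show ?thesis
      by (simp add: opow_Suc omul_def sum_divide_distrib)
  qed
  then have "(\<Sum>k. diffs (?c i j) k * z ^ k) = (\<Sum>k. \<Sum>l\<in>B. A i l * (?c l j k * z ^ k))"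
    by (simp add: sum_distrib_right mult.assoc)
  also have "\<dots> = (\<Sum>l\<in>B. \<Sum>k. A i l * (?c l j k * z ^ k))"
    by (intro suminf_sum summable_mult oexp_summable assms)
  also have "\<dots> = omul B A (oexp B (osc z A)) i j"
    unfolding omul_def oexp_osc by (intro sum.cong refl suminf_mult oexp_summable assms)
  finally show ?thesis
    using termdiffs_strong_converges_everywhere[of "?c i j", OF oexp_summable, OF assms, of z]
    by (simp add: oexp_osc)
qed

section \<open>The unitary group and its differential equation\<close>

definition expi :: "op \<Rightarrow> real \<Rightarrow> op" where
  "expi H t = oexp B (osc (\<i> * of_real t) H)"

abbreviation evol :: "op \<Rightarrow> real \<Rightarrow> vec \<Rightarrow> vec" where
  "evol H t \<equiv> oapp B (expi H t)"

lemma expi_in_ops [simp, intro]: "H \<in> ops B \<Longrightarrow> expi H t \<in> ops B"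
  by (simp add: expi_def)

lemma expi_0 [simp]: "expi H 0 = oid B"
proof (intro ext)
  fix i j
  have "opow B (osc 0 H) k i j / of_nat (fact k) = (if k = 0 then oid B i j else 0)" for k
    unfolding opow_osc by (cases k) (simp_all add: opow_0 osc_def)
  then show "expi H 0 i j = oid B i j"
    using suminf_finite[of "{0::nat}" "\<lambda>k. if k = 0 then oid B i j else 0"]
    by (simp add: expi_def oexp_def)
qed

lemma expi_has_vector_derivative:
  assumes "H \<in> ops B"
  shows "((\<lambda>t. expi H t i j) has_vector_derivative \<i> * omul B H (expi H t) i j) (at t)"
proof -
  have "((\<lambda>t. \<i> * of_real t) has_vector_derivative \<i>) (at t)"
    by (auto intro!: derivative_eq_intros)
  from field_vector_diff_chain_at[OF this oexp_has_field_derivative[OF assms]]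
  show ?thesis by (simp add: expi_def o_def)
qed

text \<open>Solutions of y' = iHy, differentiated coefficient by coefficient. Identities between
  exponentials are obtained below from uniqueness of such solutions instead of from series.\<close>

definition evolves :: "op \<Rightarrow> (real \<Rightarrow> vec) \<Rightarrow> bool" where
  "evolves H y \<longleftrightarrow> (\<forall>t. y t \<in> vecs B \<and>
     (\<forall>i. ((\<lambda>t. y t i) has_vector_derivative \<i> * oapp B H (y t) i) (at t)))"

lemma evolvesD:
  assumes "evolves H y"
  shows "y t \<in> vecs B" "((\<lambda>t. y t i) has_vector_derivative \<i> * oapp B H (y t) i) (at t)"
  using assms by (auto simp: evolves_def)

lemma has_vector_derivative_oapp:
  assumes "\<And>i j. ((\<lambda>t. F t i j) has_vector_derivative F' i j) (at t)"
    and "\<And>i. ((\<lambda>t. y t i) has_vector_derivative y' i) (at t)"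
  shows "((\<lambda>t. oapp B (F t) (y t) i) has_vector_derivative
    oapp B F' (y t) i + oapp B (F t) y' i) (at t)"
  unfolding oapp_def
  by (rule derivative_eq_intros has_vector_derivative_mult assms refl)+
    (simp add: sum.distrib add.commute)

lemma evolves_oapp:
  assumes "evolves H y" "C \<in> ops B" "K \<in> ops B"
    and "\<And>v. v \<in> vecs B \<Longrightarrow> oapp B C (oapp B H v) = oapp B K (oapp B C v)"
  shows "evolves K (\<lambda>t. oapp B C (y t))"
  unfolding evolves_def
proof (intro allI conjI)
  fix t i
  show "oapp B C (y t) \<in> vecs B" using assms by simp
  have "((\<lambda>t. oapp B C (y t) i) has_vector_derivative
      oapp B (\<lambda>i j. 0) (y t) i + oapp B C (vsc \<i> (oapp B H (y t))) i) (at t)"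
    by (rule has_vector_derivative_oapp) (use evolvesD[OF assms(1)] in auto)
  also have "oapp B (\<lambda>i j. 0) (y t) i + oapp B C (vsc \<i> (oapp B H (y t))) i
      = \<i> * oapp B K (oapp B C (y t)) i"
    using assms(4)[OF evolvesD(1)[OF assms(1)], of t] by (simp add: oapp_vsc) (simp add: oapp_def)
  finally show "((\<lambda>t. oapp B C (y t) i) has_vector_derivative \<i> * oapp B K (oapp B C (y t)) i) (at t)" .
qed

lemma evolves_expi:
  assumes "H \<in> ops B"
  shows "evolves H (\<lambda>t. evol H t v)"
  unfolding evolves_def
proof (intro allI conjI)
  fix t i
  have "((\<lambda>t. evol H t v i) has_vector_derivative
      oapp B (osc \<i> (omul B H (expi H t))) v i + evol H t 0 i) (at t)"
    by (rule has_vector_derivative_oapp)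
      (use expi_has_vector_derivative[OF assms] in \<open>auto simp: osc_def\<close>)
  then show "((\<lambda>t. evol H t v i) has_vector_derivative
      \<i> * oapp B H (evol H t v) i) (at t)"
    by (simp add: oapp_osc oapp_omul)
qed (use assms in auto)

text \<open>Self-adjointness moves \<open>H\<close> to the right argument, so only the difference of
  the generators survives. Equal generators give conservation of inner products; different ones give
  the perturbation bounds.\<close>

lemma inprod_evolves:
  assumes "evolves H y" "evolves K z" "self_adjoint B H"
  shows "((\<lambda>t. inprod B (y t) (z t)) has_vector_derivative
    \<i> * inprod B (y t) (oapp B (osub K H) (z t))) (at t)"
proof -
  have cnj: "((\<lambda>t. cnj (y t i)) has_vector_derivative cnj (\<i> * oapp B H (y t) i)) (at t)" for i
    by (rule has_vector_derivative_cnj evolvesD(2) assms(1))+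
  have "((\<lambda>t. inprod B (y t) (z t)) has_vector_derivative
      inprod B (vsc \<i> (oapp B H (y t))) (z t) + inprod B (y t) (vsc \<i> (oapp B K (z t)))) (at t)"
    unfolding inprod_def
    unfolding sum.distrib[symmetric]
    by (intro has_vector_derivative_sum has_vector_derivative_eq_rhs[OF has_vector_derivative_mult[OF
          cnj evolvesD(2)[OF assms(2)]]]) simp
  also have "inprod B (vsc \<i> (oapp B H (y t))) (z t) + inprod B (y t) (vsc \<i> (oapp B K (z t)))
      = \<i> * inprod B (y t) (oapp B (osub K H) (z t))"
    by (simp add: inprod_simps oapp_simps inprod_self_adjoint[OF assms(3)] algebra_simps)
  finally show ?thesis .
qed

lemma evolves_inprod_const:
  assumes "evolves H y" "evolves H z" "self_adjoint B H"
  shows "inprod B (y t) (z t) = inprod B (y 0) (z 0)"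
proof -
  have 0: "oapp B (osub H H) v = 0" for v
    by (simp add: oapp_simps)
  have d: "((\<lambda>t. inprod B (y t) (z t)) has_vector_derivative 0) (at x within UNIV)" for x
    using inprod_evolves[OF assms, of x] by (simp add: 0)
  show ?thesis
    by (rule has_vector_derivative_zero_constant[OF convex_UNIV d]) simp
qed

lemma evolves_diff:
  assumes "evolves H y" "evolves H z"
  shows "evolves H (\<lambda>t. y t - z t)"
  using assms unfolding evolves_def
  by (auto intro!: derivative_eq_intros simp: oapp_simps algebra_simps)

text \<open>The difference of two solutions is a solution, and its norm is conserved at the initial
  value 0.\<close>

lemma evolves_unique:
  assumes "evolves H y" "evolves H z" "self_adjoint B H" "y 0 = z 0"
  shows "y t = z t"
proof (rule vecs_eqI)
  have "complex_of_real ((vnorm B (y t - z t))\<^sup>2) = 0"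
    using evolves_inprod_const[OF evolves_diff evolves_diff, OF assms(1,2,1,2,3)] assms(4)
    by (simp add: inprod_self)
  then show "vnorm B (y t - z t) = 0" by simp
qed (use evolvesD[OF assms(1)] evolvesD[OF assms(2)] in auto)

lemma self_adjoint_ops: "self_adjoint B A \<Longrightarrow> A \<in> ops B"
  by (simp add: self_adjoint_def)

lemma oadj_simps:
  "oadj (oadd A C) = oadd (oadj A) (oadj C)" "oadj (osub A C) = osub (oadj A) (oadj C)"
  "oadj (osc c A) = osc (cnj c) (oadj A)" "oadj (oid B) = oid B"
  "oadj (omul B A C) = omul B (oadj C) (oadj A)"
  by (auto simp: oadj_def oadd_def osub_def osc_def oid_def omul_def mult.commute intro!: ext)

lemma self_adjoint_closed:
  "self_adjoint B (oid B)"
  "self_adjoint B A \<Longrightarrow> self_adjoint B C \<Longrightarrow> self_adjoint B (oadd A C)"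
  "self_adjoint B A \<Longrightarrow> self_adjoint B C \<Longrightarrow> self_adjoint B (osub A C)"
  "self_adjoint B A \<Longrightarrow> self_adjoint B (osc (of_real r) A)"
  by (auto simp: self_adjoint_def oadj_simps)

text \<open>Both sides solve the equation of \<open>H\<close> with the same initial value.\<close>

lemma expi_commute:
  assumes "self_adjoint B H" "C \<in> ops B" "v \<in> vecs B" "omul B C H = omul B H C"
  shows "oapp B C (evol H t v) = evol H t (oapp B C v)"
proof (rule evolves_unique[where H = H])
  have "H \<in> ops B" using assms by (simp add: self_adjoint_ops)
  then show "evolves H (\<lambda>t. oapp B C (evol H t v))"
    by (rule evolves_oapp[OF evolves_expi]) (use assms \<open>H \<in> ops B\<close> in \<open>simp_all flip: oapp_omul\<close>)
  show "evolves H (\<lambda>t. evol H t (oapp B C v))"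
    by (rule evolves_expi[OF \<open>H \<in> ops B\<close>])
qed (use assms in auto)

text \<open>The product rule produces H + K as generator once \<open>K\<close> has been moved
  through the exponential of \<open>H\<close>.\<close>

lemma expi_oadd:
  assumes "self_adjoint B H" "self_adjoint B K" "v \<in> vecs B" "omul B H K = omul B K H"
  shows "evol (oadd H K) t v = evol H t (evol K t v)"
proof (rule evolves_unique[where H = "oadd H K"])
  have ops [simp]: "H \<in> ops B" "K \<in> ops B" using assms by (auto simp: self_adjoint_ops)
  show "evolves (oadd H K) (\<lambda>t. evol (oadd H K) t v)"
    by (rule evolves_expi) simp
  show "evolves (oadd H K) (\<lambda>t. evol H t (evol K t v))"
    unfolding evolves_def
  proof (intro allI conjI)
    fix t i
    let ?w = "evol K t v"
    have "((\<lambda>t. evol H t (evol K t v) i) has_vector_derivative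
       oapp B (osc \<i> (omul B H (expi H t))) ?w i + evol H t (vsc \<i> (oapp B K ?w)) i) (at t)"
      by (rule has_vector_derivative_oapp)
        (use expi_has_vector_derivative evolvesD[OF evolves_expi] in \<open>auto simp: osc_def\<close>)
    also have "oapp B (osc \<i> (omul B H (expi H t))) ?w + evol H t (vsc \<i> (oapp B K ?w))
       = vsc \<i> (oapp B (oadd H K) (evol H t ?w))"
      using expi_commute[OF assms(1), of K ?w t] assms
      by (simp add: oapp_simps oapp_omul vsc_add_right)
    then have "oapp B (osc \<i> (omul B H (expi H t))) ?w i + evol H t (vsc \<i> (oapp B K ?w)) i
       = \<i> * oapp B (oadd H K) (evol H t ?w) i"
      by (metis plus_fun_apply vsc_apply)
    finally show "((\<lambda>t. evol H t (evol K t v) i) has_vector_derivative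
       \<i> * oapp B (oadd H K) (evol H t ?w) i) (at t)" .
  qed simp
qed (use assms self_adjoint_closed in auto)

lemma omul_assoc: "omul B (omul B A C) D = omul B A (omul B C D)"
proof (intro ext)
  fix i j
  have "omul B (omul B A C) D i j = oapp B (omul B A C) (\<lambda>k. D k j) i"
    by (simp add: omul_def oapp_def)
  also have "\<dots> = omul B A (omul B C D) i j"
    unfolding oapp_omul by (simp add: omul_def oapp_def)
  finally show "omul B (omul B A C) D i j = omul B A (omul B C D) i j" .
qed

lemma self_adjoint_conj:
  "self_adjoint B H \<Longrightarrow> U \<in> ops B \<Longrightarrow> self_adjoint B (oconj B U H)"
  by (simp add: self_adjoint_def oadj_simps omul_assoc)

lemma expi_conj:
  assumes "self_adjoint B H" "unitary B U" "v \<in> vecs B"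
    and "K = oconj B U H"
  shows "evol K t v = oapp B (oadj U) (evol H t (oapp B U v))"
proof (rule evolves_unique[where H = K])
  have ops [simp]: "H \<in> ops B" "U \<in> ops B" using assms by (auto simp: self_adjoint_ops unitary_def)
  then have [simp]: "K \<in> ops B" using assms(4) by simp
  show "evolves K (\<lambda>t. evol K t v)"
    by (rule evolves_expi) simp
  show "evolves K (\<lambda>t. oapp B (oadj U) (evol H t (oapp B U v)))"
    by (rule evolves_oapp[OF evolves_expi])
      (auto simp: assms(4) oapp_omul unitary_simps[OF assms(2)])
  show "self_adjoint B K"
    using assms by (simp add: self_adjoint_def oadj_simps omul_assoc unitary_def)
qed (use assms unitary_simps in \<open>auto simp: unitary_def\<close>)

lemma expi_inprod:
  assumes "self_adjoint B H" "u \<in> vecs B" "v \<in> vecs B"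
  shows "inprod B (evol H t u) (evol H t v) = inprod B u v"
  using evolves_inprod_const[OF evolves_expi evolves_expi assms(1)] assms
  by (simp add: self_adjoint_ops)

lemma expi_vnorm:
  assumes "self_adjoint B H" "v \<in> vecs B"
  shows "vnorm B (evol H t v) = vnorm B v"
proof -
  have "complex_of_real ((vnorm B (evol H t v))\<^sup>2) = of_real ((vnorm B v)\<^sup>2)"
    using expi_inprod[OF assms assms(2)] by (metis inprod_self)
  then show ?thesis
    by (metis of_real_eq_iff power2_eq_iff_nonneg vnorm_nonneg)
qed

lemma expi_uminus: "expi (osc (-1) H) t = expi H (- t)"
proof -
  have "osc (\<i> * of_real t) (osc (-1) H) = osc (\<i> * of_real (- t)) H"
    by (simp add: osc_def)
  then show ?thesis by (simp only: expi_def)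
qed

lemma expi_cancel:
  assumes "self_adjoint B H" "v \<in> vecs B"
  shows "evol H t (evol H (- t) v) = v"
proof -
  have "evol (oadd H (osc (-1) H)) t v = evol H t (evol (osc (-1) H) t v)"
    by (rule expi_oadd)
      (use assms self_adjoint_closed(4)[of H "-1"] in \<open>auto simp: omul_def osc_def mult_ac sum_negf\<close>)
  moreover have "oadd H (osc (-1) H) = osc 0 H"
    by (simp add: oadd_def osc_def)
  moreover have "expi (osc 0 H) t = expi H 0"
    by (simp add: expi_def osc_def)
  ultimately show ?thesis using assms by (simp add: expi_uminus)
qed

lemma expi_cancel':
  assumes "self_adjoint B H" "v \<in> vecs B"
  shows "evol H (- t) (evol H t v) = v"
  using expi_cancel[OF assms, of "- t"] by simp

lemma expi_adjoint:
  assumes "self_adjoint B H" "u \<in> vecs B" "v \<in> vecs B"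
  shows "inprod B u (evol H t v) = inprod B (evol H (- t) u) v"
  using expi_inprod[OF assms(1), of "evol H (- t) u" v t] assms
  by (simp add: expi_cancel self_adjoint_ops)

section \<open>Comparison of two unitary groups\<close>

lemma norm_diff_le_of_vector_derivative:
  fixes f :: "real \<Rightarrow> complex"
  assumes "\<And>x. (f has_vector_derivative f' x) (at x)" "\<And>x. x \<in> closed_segment 0 t \<Longrightarrow> cmod (f' x) \<le> c"
  shows "cmod (f t - f 0) \<le> c * \<bar>t\<bar>"
proof -
  have "cmod (f t - f 0) \<le> c * norm (t - 0)"
  proof (rule differentiable_bound[OF convex_closed_segment, of 0 t])
    show "(f has_derivative (\<lambda>h. h *\<^sub>R f' x)) (at x within closed_segment 0 t)" for x
      using assms(1)[of x] unfolding has_vector_derivative_def by (rule has_derivative_at_withinI)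
    show "onorm (\<lambda>h. h *\<^sub>R f' x) \<le> c" if "x \<in> closed_segment 0 t" for x
      by (rule onorm_le) (use assms(2)[OF that] in \<open>auto simp: mult.commute[of c] intro!: mult_left_mono\<close>)
  qed auto
  then show ?thesis by simp
qed

text \<open>Duhamel's estimate. The generators have to be close only along the one trajectory of
  \<open>K\<close> that starts at \<open>v\<close>, not in operator norm;
  \<open>expi_eigen_le\<close> depends on this form.\<close>

lemma expi_diff_le:
  assumes "self_adjoint B H" "self_adjoint B K" "v \<in> vecs B"
    and "\<And>s. vnorm B (oapp B (osub K H) (evol K s v)) \<le> c"
  shows "vnorm B (evol K t v - evol H t v) \<le> c * \<bar>t\<bar>"
proof -
  note ops = assms(1,2)[THEN self_adjoint_ops]
  let ?d = "evol K t v - evol H t v"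
  \<comment> \<open>The trajectory of \<open>H\<close> is started so that it reaches the difference
    \<open>?d\<close> at time t. The pairing \<open>?f\<close> then changes between 0 and t by
    exactly the squared norm of \<open>?d\<close>.\<close>
  let ?u = "evol H (- t) ?d"
  have d: "?d \<in> vecs B" using ops by simp
  have u: "?u \<in> vecs B" "evol H t ?u = ?d" "vnorm B ?u = vnorm B ?d"
    using ops d by (auto simp: expi_cancel[OF assms(1)] expi_vnorm[OF assms(1)])
  let ?f = "\<lambda>s. inprod B (evol H s ?u) (evol K s v)"
  have "cmod (?f t - ?f 0) \<le> (vnorm B ?d * c) * \<bar>t\<bar>"
  proof (rule norm_diff_le_of_vector_derivative)
    show "(?f has_vector_derivative \<i> * inprod B (evol H s ?u)
       (oapp B (osub K H) (evol K s v))) (at s)" for s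
      by (rule inprod_evolves[OF evolves_expi evolves_expi]) (use ops assms in auto)
    show "cmod (\<i> * inprod B (evol H s ?u) (oapp B (osub K H) (evol K s v)))
        \<le> vnorm B ?d * c" for s
      using order_trans[OF inprod_Cauchy_Schwarz mult_left_mono[OF assms(4)[of s] vnorm_nonneg],
          of "evol H s ?u"] u
      by (simp add: norm_mult expi_vnorm[OF assms(1) u(1)])
  qed
  moreover have "?f t - ?f 0 = inprod B ?d ?d"
    using u(1) assms(3) expi_inprod[OF assms(1) u(1) assms(3), of t]
    by (simp only: expi_0 oapp_oid u(2) inprod_diff_right)
  ultimately have "vnorm B ?d * vnorm B ?d \<le> (c * \<bar>t\<bar>) * vnorm B ?d"
    by (simp add: inprod_self norm_mult power2_eq_square mult_ac)
  moreover have "0 \<le> c" using assms(4)[of 0] vnorm_nonneg order_trans by blast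
  ultimately show ?thesis
    by (cases "vnorm B ?d = 0") (auto simp: less_le)
qed

lemma expi_diff_obounded:
  assumes "self_adjoint B H" "self_adjoint B K" "v \<in> vecs B" "obounded B (osub K H) c"
  shows "vnorm B (evol K t v - evol H t v) \<le> c * \<bar>t\<bar> * vnorm B v"
proof -
  have "vnorm B (oapp B (osub K H) (evol K s v)) \<le> c * vnorm B v" for s
    using oboundedD[OF assms(4), of "evol K s v"] assms
    by (simp add: expi_vnorm self_adjoint_ops)
  from expi_diff_le[OF assms(1-3) this, of t] show ?thesis by (simp add: mult_ac)
qed

lemma expi_scalar:
  assumes "v \<in> vecs B"
  shows "evol (osc (of_real r) (oid B)) t v = vsc (cis (r * t)) v"
proof (rule evolves_unique[where H = "osc (of_real r) (oid B)" and t = t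
      and y = "\<lambda>t. evol (osc (of_real r) (oid B)) t v" and z = "\<lambda>t. vsc (cis (r * t)) v"])
  show "evolves (osc (of_real r) (oid B)) (\<lambda>t. vsc (cis (r * t)) v)"
    unfolding evolves_def
  proof (intro allI conjI)
    fix t i
    have "((\<lambda>t. cis (r * t)) has_vector_derivative r *\<^sub>R (\<i> * cis (r * t))) (at t)"
      by (auto intro!: derivative_eq_intros simp: has_vector_derivative_def scaleR_conv_of_real mult_ac)
    then have "((\<lambda>t. cis (r * t) * v i) has_vector_derivative (r *\<^sub>R (\<i> * cis (r * t))) * v i) (at t)"
      by (rule has_vector_derivative_mult_left)
    then show "((\<lambda>t. vsc (cis (r * t)) v i) has_vector_derivative
      \<i> * oapp B (osc (of_real r) (oid B)) (vsc (cis (r * t)) v) i) (at t)"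
      using assms by (simp add: oapp_simps scaleR_conv_of_real mult_ac)
  qed (use assms in auto)
  show "evolves (osc (of_real r) (oid B)) (\<lambda>t. evol (osc (of_real r) (oid B)) t v)"
    by (rule evolves_expi) simp
qed (use assms self_adjoint_closed in auto)

text \<open>\<open>H\<close> is compared with the scalar generator r, whose trajectory stays on
  multiples of \<open>v\<close>; there the discrepancy is the eigenvalue defect up to a
  phase.\<close>

lemma expi_eigen_le:
  assumes "self_adjoint B H" "v \<in> vecs B"
  shows "vnorm B (evol H t v - vsc (cis (r * t)) v)
    \<le> vnorm B (oapp B H v - vsc (of_real r) v) * \<bar>t\<bar>"
proof -
  let ?K = "osc (of_real r) (oid B)"
  have "vnorm B (evol ?K t v - evol H t v)
    \<le> vnorm B (oapp B H v - vsc (of_real r) v) * \<bar>t\<bar>"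
  proof (rule expi_diff_le[OF assms(1) self_adjoint_closed(4)[OF self_adjoint_closed(1)] assms(2)])
    fix s
    have "oapp B (osub ?K H) (evol ?K s v) = vsc (- cis (r * s)) (oapp B H v - vsc (of_real r) v)"
      using assms by (simp add: expi_scalar oapp_simps vsc_diff_right fun_eq_iff algebra_simps)
    then show "vnorm B (oapp B (osub ?K H) (evol ?K s v))
      \<le> vnorm B (oapp B H v - vsc (of_real r) v)" by simp
  qed
  then show ?thesis using assms by (simp add: expi_scalar vnorm_minus_commute)
qed

lemma expi_eigen:
  assumes "self_adjoint B H" "v \<in> vecs B" "oapp B H v = vsc (of_real r) v"
  shows "evol H t v = vsc (cis (r * t)) v"
  using expi_eigen_le[OF assms(1,2), of t r] assms vnorm_nonneg[of B]
  by (intro vecs_eqI) (auto simp: self_adjoint_ops order_antisym)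

end

section \<open>Integer spectrum and limits of local operators\<close>

definition oalgebra :: "cfg set \<Rightarrow> op set \<Rightarrow> bool" where
  "oalgebra B S \<longleftrightarrow> S \<subseteq> ops B \<and> oid B \<in> S \<and> (\<forall>A\<in>S. \<forall>c. osc c A \<in> S) \<and>
     (\<forall>A\<in>S. \<forall>C\<in>S. oadd A C \<in> S \<and> omul B A C \<in> S)"

lemma oalgebra_osub: "oalgebra B S \<Longrightarrow> A \<in> S \<Longrightarrow> C \<in> S \<Longrightarrow> osub A C \<in> S"
proof -
  assume "oalgebra B S" "A \<in> S" "C \<in> S"
  then have "oadd A (osc (-1) C) \<in> S" by (auto simp: oalgebra_def)
  also have "oadd A (osc (-1) C) = osub A C" by (simp add: oadd_def osc_def osub_def)
  finally show ?thesis .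
qed

context fin_basis
begin

section \<open>Annihilating polynomials and integer spectrum\<close>

definition poly_oapp :: "op \<Rightarrow> complex poly \<Rightarrow> vec \<Rightarrow> vec" where
  "poly_oapp A p v = (\<lambda>i. \<Sum>k\<le>degree p. coeff p k * (oapp B A ^^ k) v i)"

lemma poly_oapp_altdef:
  assumes "degree p \<le> n"
  shows "poly_oapp A p v i = (\<Sum>k\<le>n. coeff p k * (oapp B A ^^ k) v i)"
  unfolding poly_oapp_def using assms
  by (intro sum.mono_neutral_left) (auto simp: coeff_eq_0)

lemma funpow_oapp_linear:
  "(oapp B A ^^ k) (u - vsc c v) = (oapp B A ^^ k) u - vsc c ((oapp B A ^^ k) v)"
  by (induction k) (simp_all only: funpow.simps o_apply id_apply oapp_simps)

text \<open>A root of the polynomial is traded for a change of the vector, which lowers the degree;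
  this drives the induction that replaces diagonalisation.\<close>

lemma poly_oapp_linear_factor:
  "poly_oapp A ([:- c, 1:] * q) v = poly_oapp A q (oapp B A v - vsc c v)"
proof
  fix i
  let ?T = "\<lambda>k v. (oapp B A ^^ k) v i" and ?n = "degree q"
  have deg: "degree ([:- c, 1:] * q) \<le> Suc ?n"
    using degree_mult_le[of "[:- c, 1:]" q] by simp
  have co: "coeff ([:- c, 1:] * q) k = (case k of 0 \<Rightarrow> 0 | Suc m \<Rightarrow> coeff q m) - c * coeff q k" for k
    by (simp add: mult_pCons_left coeff_pCons split: nat.split)
  have "poly_oapp A ([:- c, 1:] * q) v i
      = (\<Sum>k\<le>Suc ?n. (case k of 0 \<Rightarrow> 0 | Suc m \<Rightarrow> coeff q m) * ?T k v) - (\<Sum>k\<le>Suc ?n. c * coeff q k * ?T k v)"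
    unfolding poly_oapp_altdef[OF deg] co by (simp only: left_diff_distrib sum_subtractf)
  also have "(\<Sum>k\<le>Suc ?n. (case k of 0 \<Rightarrow> 0 | Suc m \<Rightarrow> coeff q m) * ?T k v)
      = (\<Sum>k\<le>?n. coeff q k * ?T k (oapp B A v))"
    by (subst sum.atMost_Suc_shift) (simp add: funpow_swap1)
  also have "(\<Sum>k\<le>Suc ?n. c * coeff q k * ?T k v) = (\<Sum>k\<le>?n. c * coeff q k * ?T k v)"
    by (simp add: coeff_eq_0)
  finally show "poly_oapp A ([:- c, 1:] * q) v i = poly_oapp A q (oapp B A v - vsc c v) i"
    by (simp add: poly_oapp_def funpow_oapp_linear sum_subtractf right_diff_distrib mult_ac)
qed

text \<open>The vectors v, Av, ..., \<open>A^N\<close> v with N = \<open>card B\<close> are one more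
  than the dimension, so they satisfy a linear relation; its coefficients form the
  polynomial.\<close>

lemma exists_annihilating_poly:
  assumes "A \<in> ops B" "v \<in> vecs B"
  shows "\<exists>p. p \<noteq> 0 \<and> poly_oapp A p v = 0"
proof -
  interpret vs: vector_space vsc
    by unfold_locales (auto simp: fun_eq_iff algebra_simps)
  define f where "f k = (oapp B A ^^ k) v" for k
  define N where "N = card B"
  have f_vecs: "f k \<in> vecs B" for k
    using assms by (cases k) (auto simp: f_def)
  have span: "u \<in> vs.span (delta ` B)" if "u \<in> vecs B" for u
  proof -
    have "u = (\<Sum>j\<in>B. vsc (u j) (delta j))"
    proof
      fix i
      have "(\<Sum>j\<in>B. vsc (u j) (delta j)) i = (\<Sum>j\<in>B. vsc (u j) (delta j) i)"
        using fin by (induction B rule: finite_induct) auto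
      also have "\<dots> = (\<Sum>j\<in>B. if i = j then u j else 0)"
        by (intro sum.cong) (auto simp: delta_def)
      also have "\<dots> = u i"
        using that by (auto simp: vecs_def)
      finally show "u i = (\<Sum>j\<in>B. vsc (u j) (delta j)) i" by simp
    qed
    then show ?thesis
      by (metis (no_types, lifting) vs.span_base vs.span_scale vs.span_sum imageI)
  qed
  have "\<exists>c. (\<exists>k\<le>N. c k \<noteq> 0) \<and> (\<forall>i. (\<Sum>k\<le>N. c k * f k i) = 0)"
  \<comment> \<open>Linear dependence concerns the set of iterates, so a repetition among them is
    invisible to it and is treated apart: it is a relation by itself.\<close>
  proof (cases "inj_on f {..N}")
    case True
    let ?S = "f ` {..N}"
    have "vs.dependent ?S"
    proof (rule ccontr)
      assume "\<not> vs.dependent ?S"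
      then have "card ?S \<le> card (delta ` B)"
        using vs.independent_span_bound[of "delta ` B" ?S] span f_vecs by auto
      also have "\<dots> \<le> N" unfolding N_def by (rule card_image_le) simp
      finally show False using card_image[OF True] by simp
    qed
    then obtain u where u: "\<exists>x\<in>?S. u x \<noteq> 0" "(\<Sum>x\<in>?S. vsc (u x) x) = 0"
      using vs.dependent_finite[of ?S] by auto
    have ev: "(\<Sum>k\<in>K. vsc (u (f k)) (f k)) i = (\<Sum>k\<in>K. u (f k) * f k i)" if "finite K" for K i
      using that by induction auto
    have "(\<Sum>k\<le>N. u (f k) * f k i) = 0" for i
      using u(2) sum.reindex[OF True, of "\<lambda>x. vsc (u x) x"] ev[of "{..N}" i] by (simp add: o_def)
    then show ?thesis using u(1) by (intro exI[of _ "\<lambda>k. u (f k)"]) auto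
  next
    case False
    then obtain a b where ab: "a \<le> N" "b \<le> N" "a \<noteq> b" "f a = f b"
      by (auto simp: inj_on_def)
    let ?c = "\<lambda>k. (if k = a then 1 else 0) - (if k = b then 1 else 0) :: complex"
    have "(\<Sum>k\<le>N. ?c k * f k i) = f a i - f b i" for i
      using ab by (simp add: left_diff_distrib sum_subtractf if_distrib[of "\<lambda>x. x * _"] cong: if_cong)
    then show ?thesis using ab by (intro exI[of _ ?c]) auto
  qed
  then obtain c k where c: "k \<le> N" "c k \<noteq> 0" "\<And>i. (\<Sum>k\<le>N. c k * f k i) = 0"
    by blast
  define p where "p = (\<Sum>k\<le>N. monom (c k) k)"
  have co: "coeff p k = (if k \<le> N then c k else 0)" for k
    by (simp add: p_def coeff_sum)
  have "degree p \<le> N"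
    by (rule degree_le) (simp add: co)
  then have "poly_oapp A p v = 0"
    using c(3) by (auto simp: poly_oapp_altdef co f_def fun_eq_iff)
  moreover have "p \<noteq> 0" using c co[of k] by auto
  ultimately show ?thesis by blast
qed

lemma not_in_spectrum_inj:
  assumes "z \<notin> spectrum B A" "v \<in> vecs B" "oapp B A v = vsc z v"
  shows "v = 0"
proof -
  obtain R where "omul B R (osub A (osc z (oid B))) = oid B"
    using assms(1) by (auto simp: spectrum_def)
  then have "v = oapp B R (oapp B (osub A (osc z (oid B))) v)"
    using assms(2) by (metis oapp_oid oapp_omul)
  also have "\<dots> = 0"
    using assms by (simp add: oapp_simps)
  finally show ?thesis .
qed

text \<open>Peeling off one linear factor of an annihilating polynomial leaves a vector \<open>d = exp(2\<pi>iA)v - v\<close>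
  with \<open>Ad = zd\<close>.  It vanishes if \<open>z\<close> is not in the spectrum; otherwise \<open>d\<close> is fixed by the unitary
  \<open>exp(2\<pi>iA)\<close> and also lies in the range of \<open>exp(2\<pi>iA) - 1\<close>, hence is orthogonal to itself.\<close>

lemma expi_2pi_of_annihilated:
  assumes "self_adjoint B A" "spectrum B A \<subseteq> \<int>" "v \<in> vecs B" "p \<noteq> 0" "poly_oapp A p v = 0"
  shows "evol A (2 * pi) v = v"
  using assms(3-5)
proof (induction "degree p" arbitrary: p v rule: less_induct)
  case less
  note A = self_adjoint_ops[OF assms(1)]
  show ?case
  proof (cases "degree p = 0")
    case True
    then obtain c where "p = [:c:]" by (rule degree_eq_zeroE)
    then have "c \<noteq> 0" "\<And>i. c * v i = 0"
      using less by (auto simp: poly_oapp_def fun_eq_iff)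
    then have "v = 0" by (auto simp: fun_eq_iff)
    then show ?thesis by simp
  next
    case False
    then obtain z where "poly p z = 0"
      using fundamental_theorem_of_algebra[of p] constant_degree[of p] by auto
    then obtain q where p: "p = [:- z, 1:] * q"
      by (auto simp: poly_eq_0_iff_dvd elim: dvdE)
    then have q: "q \<noteq> 0" using less.prems by auto
    then have q': "degree q < degree p"
      unfolding p by (subst degree_mult_eq) auto
    let ?E = "evol A (2 * pi)"
    define d where "d = ?E v - v"
    have d: "d \<in> vecs B" using A less.prems by (simp add: d_def)
    have "?E (oapp B A v - vsc z v) = oapp B A v - vsc z v"
      by (rule less.hyps[OF q'])
        (use q A less.prems in \<open>auto simp: p simp flip: poly_oapp_linear_factor\<close>)
    moreover have "oapp B A (?E v) = ?E (oapp B A v)"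
      using expi_commute[OF assms(1) A less.prems(1)] by simp
    ultimately have Ad: "oapp B A d = vsc z d"
      by (simp add: d_def oapp_simps vsc_diff_right algebra_simps)
    have "d = 0"
    proof (cases "z \<in> spectrum B A")
      case False
      then show ?thesis using not_in_spectrum_inj[OF _ d Ad] by simp
    next
      case True
      then obtain m :: int where m: "z = of_int m"
        using assms(2) by (auto elim: Ints_cases)
      have "cis (of_int m * (2 * pi)) = 1"
        using cis_multiple_2pi[of "of_int m"] by (simp add: mult_ac)
      then have Ed: "?E d = d"
        using expi_eigen[OF assms(1) d, of "of_int m" "2 * pi"] Ad m by simp
      have "inprod B d d = inprod B (?E v) (?E d) - inprod B v d"
        unfolding Ed by (simp add: d_def inprod_diff_left)
      also have "\<dots> = 0"
        using expi_inprod[OF assms(1) less.prems(1) d] by simp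
      finally show ?thesis
        using vecs_eqI[OF d, of 0] by (simp add: inprod_self)
    qed
    then show ?thesis by (simp add: d_def)
  qed
qed

lemma expi_2pi_integer_spectrum:
  assumes "self_adjoint B A" "spectrum B A \<subseteq> \<int>" "v \<in> vecs B"
  shows "evol A (2 * pi) v = v"
  using expi_2pi_of_annihilated[OF assms] exists_annihilating_poly[OF self_adjoint_ops[OF assms(1)] assms(3)]
  by blast

text \<open>The local algebras are closed under finite algebraic operations, whereas exponentials
  arise as infinite series. Entrywise limits suffice because every expectation is a finite
  expression in the entries.\<close>

definition entry_closure :: "op set \<Rightarrow> op set" where
  "entry_closure S = {A \<in> ops B. \<exists>F. (\<forall>n. F n \<in> S) \<and> (\<forall>i j. (\<lambda>n. F n i j) \<longlonglongrightarrow> A i j)}"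

lemma entry_closureE:
  assumes "A \<in> entry_closure S"
  obtains F where "A \<in> ops B" "\<And>n. F n \<in> S" "\<And>i j. (\<lambda>n. F n i j) \<longlonglongrightarrow> A i j"
  using assms by (auto simp: entry_closure_def)

lemma entry_closure_omul:
  assumes S: "oalgebra B S" and "A \<in> entry_closure S" "C \<in> entry_closure S"
  shows "omul B A C \<in> entry_closure S"
proof -
  obtain F where F: "A \<in> ops B" "\<And>n. F n \<in> S" "\<And>i j. (\<lambda>n. F n i j) \<longlonglongrightarrow> A i j"
    using assms(2) by (rule entry_closureE) blast
  obtain G where G: "C \<in> ops B" "\<And>n. G n \<in> S" "\<And>i j. (\<lambda>n. G n i j) \<longlonglongrightarrow> C i j"
    using assms(3) by (rule entry_closureE) blast
  have "\<And>i j. (\<lambda>n. omul B (F n) (G n) i j) \<longlonglongrightarrow> omul B A C i j"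
    unfolding omul_def by (intro tendsto_sum tendsto_mult F G)
  moreover have "omul B (F n) (G n) \<in> S" for n
    using S F G by (simp add: oalgebra_def)
  ultimately show ?thesis
    using F(1) G(1) unfolding entry_closure_def
    by (auto intro!: exI[of _ "\<lambda>n. omul B (F n) (G n)"])
qed

text \<open>The partial sums of the exponential series are polynomials in \<open>H\<close>.\<close>

lemma entry_closure_expi:
  assumes S: "oalgebra B S" and "H \<in> S"
  shows "expi H t \<in> entry_closure S"
proof -
  have H: "H \<in> ops B" using assms by (auto simp: oalgebra_def)
  define F where "F n = (\<lambda>i j. \<Sum>k<n. opow B H k i j / of_nat (fact k) * (\<i> * of_real t) ^ k)" for n
  have pow: "opow B H k \<in> S" for k
    using assms by (induction k) (auto simp: opow_0 opow_Suc oalgebra_def)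
  have "F n \<in> S" for n
  proof (induction n)
    case 0
    have "F 0 = osc 0 (oid B)" by (simp add: F_def osc_def)
    then show ?case using S by (simp add: oalgebra_def)
  next
    case (Suc n)
    have "F (Suc n) = oadd (F n) (osc ((\<i> * of_real t) ^ n / of_nat (fact n)) (opow B H n))"
      by (simp add: F_def oadd_def osc_def mult.commute)
    then show ?case using S Suc pow by (simp add: oalgebra_def)
  qed
  moreover have "(\<lambda>n. F n i j) \<longlonglongrightarrow> expi H t i j" for i j
    unfolding F_def expi_def oexp_osc by (rule summable_LIMSEQ[OF oexp_summable[OF H]])
  ultimately show ?thesis
    using H unfolding entry_closure_def by (auto intro!: exI[of _ F])
qed

text \<open>Approximants of a contraction may exceed norm 1, but eventually not norm 2. Hence the
  bound 2 in the clustering hypotheses.\<close>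

lemma entry_closure_approx:
  assumes "\<And>i j. (\<lambda>n. F n i j) \<longlonglongrightarrow> A i j" "obounded B A 1"
  shows "eventually (\<lambda>n. obounded B (F n) 2) sequentially"
proof -
  have "(\<lambda>n. osum (osub (F n) A)) \<longlonglongrightarrow> (\<Sum>i\<in>B. \<Sum>j\<in>B. cmod (A i j - A i j))"
    unfolding osum_def osub_def by (intro tendsto_intros assms)
  then have "eventually (\<lambda>n. osum (osub (F n) A) < 1) sequentially"
    by (rule order_tendstoD) simp
  then show ?thesis
  proof eventually_elim
    case (elim n)
    have "F n = oadd A (osub (F n) A)" by (simp add: oadd_def osub_def)
    then show ?case
      using obounded_mono[OF obounded_oadd[OF assms(2) obounded_osum[of "osub (F n) A"]], of 2] elim
      by simp
  qed
qed

lemma clustering_entry_closure: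
  assumes "A \<in> entry_closure S" "C \<in> entry_closure S'" "obounded B A 1" "obounded B C 1"
    and cl: "\<And>A C. A \<in> S \<Longrightarrow> C \<in> S' \<Longrightarrow> obounded B A 2 \<Longrightarrow> obounded B C 2 \<Longrightarrow>
      cmod (inprod B \<psi> (oapp B (omul B A C) \<psi>)
        - inprod B \<psi> (oapp B A \<psi>) * inprod B \<psi> (oapp B C \<psi>)) \<le> \<epsilon>"
  shows "cmod (inprod B \<psi> (oapp B (omul B A C) \<psi>)
        - inprod B \<psi> (oapp B A \<psi>) * inprod B \<psi> (oapp B C \<psi>)) \<le> \<epsilon>"
proof -
  obtain F where F: "\<And>n. F n \<in> S" "\<And>i j. (\<lambda>n. F n i j) \<longlonglongrightarrow> A i j"
    using assms(1) by (rule entry_closureE) blast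
  obtain G where G: "\<And>n. G n \<in> S'" "\<And>i j. (\<lambda>n. G n i j) \<longlonglongrightarrow> C i j"
    using assms(2) by (rule entry_closureE) blast
  show ?thesis
  proof (rule tendsto_upperbound)
    show "(\<lambda>n. cmod (inprod B \<psi> (oapp B (omul B (F n) (G n)) \<psi>)
        - inprod B \<psi> (oapp B (F n) \<psi>) * inprod B \<psi> (oapp B (G n) \<psi>))) \<longlonglongrightarrow>
      cmod (inprod B \<psi> (oapp B (omul B A C) \<psi>)
        - inprod B \<psi> (oapp B A \<psi>) * inprod B \<psi> (oapp B C \<psi>))"
      unfolding inprod_def oapp_def omul_def by (intro tendsto_intros F G)
    show "eventually (\<lambda>n. cmod (inprod B \<psi> (oapp B (omul B (F n) (G n)) \<psi>)
        - inprod B \<psi> (oapp B (F n) \<psi>) * inprod B \<psi> (oapp B (G n) \<psi>)) \<le> \<epsilon>) sequentially"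
      using entry_closure_approx[OF F(2) assms(3)] entry_closure_approx[OF G(2) assms(4)]
      by eventually_elim (use cl F(1) G(1) in auto)
  qed simp
qed

end

section \<open>The transport estimate in fixed volume\<close>

context fin_basis
begin

lemma omul_oadd_right: "omul B A (oadd C D) = oadd (omul B A C) (omul B A D)"
  and omul_oadd_left: "omul B (oadd C D) A = oadd (omul B C A) (omul B D A)"
  by (auto simp: omul_def oadd_def algebra_simps sum.distrib intro!: ext)

lemma expi_expi_commute:
  assumes "self_adjoint B H" "self_adjoint B K" "omul B H K = omul B K H" "v \<in> vecs B"
  shows "evol H t (evol K s v) = evol K s (evol H t v)"
proof (rule expi_commute[OF assms(2) _ assms(4)])
  note ops = assms(1,2)[THEN self_adjoint_ops]
  show "expi H t \<in> ops B" using ops by simp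
  show "omul B (expi H t) K = omul B K (expi H t)"
    by (rule ops_eqI) (use ops expi_commute[OF assms(1) ops(2)] assms(3) in \<open>auto simp: oapp_omul\<close>)
qed

lemma obounded_expi: "self_adjoint B H \<Longrightarrow> obounded B (expi H t) 1"
  by (simp add: obounded_def expi_vnorm)

lemma obounded_omul_1:
  "A \<in> ops B \<Longrightarrow> C \<in> ops B \<Longrightarrow> obounded B A 1 \<Longrightarrow> obounded B C 1 \<Longrightarrow> obounded B (omul B A C) 1"
  unfolding obounded_def oapp_omul by (auto intro: order_trans)

lemma inprod_oapp_le:
  assumes "obounded B A c" "v \<in> vecs B"
  shows "cmod (inprod B u (oapp B A v)) \<le> vnorm B u * (c * vnorm B v)"
  by (rule order_trans[OF inprod_Cauchy_Schwarz mult_left_mono[OF oboundedD[OF assms] vnorm_nonneg]])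

lemma inprod_quadratic_diff_le:
  assumes "obounded B A c" "0 \<le> c" "u \<in> vecs B" "v \<in> vecs B" "vnorm B u \<le> 1" "vnorm B v \<le> 1"
  shows "cmod (inprod B u (oapp B A u) - inprod B v (oapp B A v)) \<le> 2 * c * vnorm B (u - v)"
proof -
  have "inprod B u (oapp B A u) - inprod B v (oapp B A v)
      = inprod B (u - v) (oapp B A u) + inprod B v (oapp B A (u - v))"
    by (simp add: inprod_simps oapp_simps)
  moreover have "cmod (inprod B (u - v) (oapp B A u)) \<le> vnorm B (u - v) * (c * 1)"
    by (rule order_trans[OF inprod_oapp_le[OF assms(1,3)]])
      (use assms in \<open>auto intro!: mult_left_mono mult_left_le\<close>)
  moreover have "cmod (inprod B v (oapp B A (u - v))) \<le> 1 * (c * vnorm B (u - v))"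
    by (rule order_trans[OF inprod_oapp_le[OF assms(1)]])
      (use assms in \<open>auto intro!: mult_left_le_one_le\<close>)
  ultimately show ?thesis
    using norm_triangle_ineq[of "inprod B (u - v) (oapp B A u)" "inprod B v (oapp B A (u - v))"]
    by (simp add: algebra_simps)
qed

text \<open>Pythagoras for the component of \<open>v\<close> orthogonal to \<open>\<psi>\<close>. An
  overlap of modulus near 1 thus puts \<open>v\<close> near a multiple of \<open>\<psi>\<close>, at
  the price of a square root.\<close>

lemma vnorm_residual:
  assumes "vnorm B v = 1" "vnorm B \<psi> = 1"
  shows "(vnorm B (v - vsc (inprod B \<psi> v) \<psi>))\<^sup>2 = 1 - (cmod (inprod B \<psi> v))\<^sup>2"
proof -
  let ?a = "inprod B \<psi> v"
  have "complex_of_real ((vnorm B (v - vsc ?a \<psi>))\<^sup>2) = 1 - ?a * cnj ?a"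
    using assms
    by (simp only: inprod_self[symmetric] inprod_simps inprod_cnj[of B \<psi> v, symmetric])
      (simp add: inprod_self algebra_simps)
  then show ?thesis
    by (metis complex_norm_square of_real_1 of_real_diff of_real_eq_iff)
qed

lemma inprod_self_adjoint_real:
  assumes "self_adjoint B A"
  shows "inprod B v (oapp B A v) = of_real (Re (inprod B v (oapp B A v)))"
proof -
  have "cnj (inprod B v (oapp B A v)) = inprod B v (oapp B A v)"
    by (simp add: inprod_cnj inprod_self_adjoint[OF assms])
  then have "Im (inprod B v (oapp B A v)) = 0" by (simp add: complex_eq_iff)
  then show ?thesis by (simp add: complex_eq_iff)
qed

end

text \<open>One volume, with all errors below a single \<open>\<epsilon>\<close>. Supports appear
  only as two algebras that commute with each other and with \<open>q0\<close>, integrality only as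
  triviality of the exponentials at 2\<pi>. The bound 1 on \<open>\<epsilon>\<close> lets linear
  errors be absorbed into \<open>sqrt \<epsilon>\<close>.\<close>

locale charge_transport = fin_basis +
  fixes U :: op and \<psi> :: vec and qm q0 qp Tm Tp Km Kp km kp :: op
    and SM SP :: "op set" and \<epsilon> N :: real
  assumes algM: "oalgebra B SM" and algP: "oalgebra B SP"
    and commMP: "\<And>A C. A \<in> SM \<Longrightarrow> C \<in> SP \<Longrightarrow> omul B A C = omul B C A"
    and commM0: "\<And>A. A \<in> SM \<Longrightarrow> omul B A q0 = omul B q0 A"
    and commP0: "\<And>A. A \<in> SP \<Longrightarrow> omul B A q0 = omul B q0 A"
    and inM: "qm \<in> SM" "Tm \<in> SM" "Km \<in> SM" "km \<in> SM"
    and inP: "qp \<in> SP" "Tp \<in> SP" "Kp \<in> SP" "kp \<in> SP"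
    and saM: "self_adjoint B qm" "self_adjoint B Tm" "self_adjoint B Km" "self_adjoint B km"
    and saP: "self_adjoint B qp" "self_adjoint B Tp" "self_adjoint B Kp" "self_adjoint B kp"
    and sa0: "self_adjoint B q0"
    and intg: "\<And>v. v \<in> vecs B \<Longrightarrow> evol qm (2 * pi) v = v"
      "\<And>v. v \<in> vecs B \<Longrightarrow> evol q0 (2 * pi) v = v"
      "\<And>v. v \<in> vecs B \<Longrightarrow> evol qp (2 * pi) v = v"
    and U: "unitary B U" and psi: "\<psi> \<in> vecs B" "vnorm B \<psi> = 1"
    and eU: "vnorm B (oapp B U \<psi> - vsc (inprod B \<psi> (oapp B U \<psi>)) \<psi>) \<le> \<epsilon>"
    and eQ: "\<And>Qb. Qb = osub (osub (oadd (oadd qm q0) qp) Km) Kp \<Longrightarrow>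
      vnorm B (oapp B Qb \<psi> - vsc (inprod B \<psi> (oapp B Qb \<psi>)) \<psi>) \<le> \<epsilon>"
    and eT: "\<And>Q. Q = oadd (oadd qm q0) qp \<Longrightarrow>
      obounded B (osub (osub (osub (oconj B U Q) Q) Tm) Tp) \<epsilon>"
    and eKm: "obounded B (osub (oconj B U Km) km) \<epsilon>"
    and eKp: "obounded B (osub (oconj B U Kp) kp) \<epsilon>"
    and eE: "obounded B (osub (expi (oadd (oadd (oadd qm q0) qp) Tm) (2 * pi)) (oid B)) \<epsilon>"
    and cl: "\<And>A C. A \<in> SM \<Longrightarrow> C \<in> SP \<Longrightarrow> obounded B A 2 \<Longrightarrow> obounded B C 2 \<Longrightarrow>
      cmod (inprod B \<psi> (oapp B (omul B A C) \<psi>)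
        - inprod B \<psi> (oapp B A \<psi>) * inprod B \<psi> (oapp B C \<psi>)) \<le> \<epsilon>"
    and bT: "obounded B Tm N" and bK: "obounded B Km N" and N: "0 \<le> N" and eps: "0 \<le> \<epsilon>" "\<epsilon> \<le> 1"
begin

section \<open>Generators before and after transport\<close>

definition "Ym = osub qm Km"
definition "Yp = osub qp Kp"
definition "Xm = osub (oadd qm Tm) km"
definition "Xp = osub (oadd qp Tp) kp"
definition "Qb = oadd Ym (oadd q0 Yp)"
definition "X = oadd Xm (oadd q0 Xp)"
text \<open>The charge \<open>qm\<close> cancels and Tm + Km - km remains. This is what gives
  \<open>D\<close> a norm bound although none is available for \<open>Xm\<close> or
  \<open>Ym\<close>.\<close>

definition "D = osub Xm Ym"
definition "u = inprod B \<psi> (oapp B U \<psi>)"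
definition "q = Re (inprod B \<psi> (oapp B Qb \<psi>))"

lemma eps_le_sqrt: "\<epsilon> \<le> sqrt \<epsilon>"
proof -
  have "\<epsilon> * \<epsilon> \<le> \<epsilon> * 1" using eps by (intro mult_left_mono)
  then show ?thesis using eps by (intro real_le_rsqrt) (simp add: power2_eq_square)
qed

lemma oalgebra_oadd: "oalgebra B S \<Longrightarrow> A \<in> S \<Longrightarrow> C \<in> S \<Longrightarrow> oadd A C \<in> S"
  by (simp add: oalgebra_def)

lemma memM [simp]: "Ym \<in> SM" "Xm \<in> SM" "D \<in> SM" "oadd qm Tm \<in> SM"
  unfolding Ym_def Xm_def D_def
  by (intro oalgebra_osub[OF algM] oalgebra_oadd[OF algM] inM)+

lemma memP [simp]: "Yp \<in> SP" "Xp \<in> SP" "oadd qp Tp \<in> SP"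
  unfolding Yp_def Xp_def
  by (intro oalgebra_osub[OF algP] oalgebra_oadd[OF algP] inP)+

lemma sa [simp]: "self_adjoint B Ym" "self_adjoint B Yp" "self_adjoint B Xm" "self_adjoint B Xp"
  "self_adjoint B Qb" "self_adjoint B X" "self_adjoint B D"
  "self_adjoint B (oadd qm Tm)" "self_adjoint B (oadd qp Tp)"
  unfolding Ym_def Yp_def Xm_def Xp_def Qb_def X_def D_def
  by (intro self_adjoint_closed saM saP sa0)+

lemmas sa_ops [simp] = sa[THEN self_adjoint_ops] saM[THEN self_adjoint_ops] saP[THEN self_adjoint_ops]
  sa0[THEN self_adjoint_ops]

lemma U_ops [simp]: "U \<in> ops B" "oadj U \<in> ops B"
  using U by (auto simp: unitary_def)

lemma commM0P:
  assumes "A \<in> SM" "C \<in> SP"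
  shows "omul B A (oadd q0 C) = omul B (oadd q0 C) A"
  using commMP[OF assms] commM0[OF assms(1)] by (simp add: omul_oadd_left omul_oadd_right)

lemma expi_split:
  assumes "A \<in> SM" "C \<in> SP" "self_adjoint B A" "self_adjoint B C" "v \<in> vecs B"
  shows "evol (oadd A (oadd q0 C)) t v = evol A t (evol q0 t (evol C t v))"
proof -
  have "evol (oadd A (oadd q0 C)) t v = evol A t (evol (oadd q0 C) t v)"
    by (rule expi_oadd) (use assms commM0P self_adjoint_closed sa0 in auto)
  also have "evol (oadd q0 C) t v = evol q0 t (evol C t v)"
    by (rule expi_oadd) (use assms commP0 sa0 in auto)
  finally show ?thesis .
qed

text \<open>At time 2\<pi> the middle charge drops out by integrality.\<close>

lemma expi_split_2pi:
  assumes "A \<in> SM" "C \<in> SP" "self_adjoint B A" "self_adjoint B C" "v \<in> vecs B"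
  shows "evol (oadd A (oadd q0 C)) (2 * pi) v
    = evol A (2 * pi) (evol C (2 * pi) v)"
  using assms by (simp add: expi_split intg self_adjoint_ops)

text \<open>The expectation of AC is close to the phase z and, by clustering, to the product of the
  two expectations. The one of \<open>C\<close> has modulus at most 1, so the one of
  \<open>A\<close> cannot be much smaller than 1 in modulus.\<close>

lemma rigidity:
  assumes "A \<in> entry_closure SM" "C \<in> entry_closure SP" "obounded B A 1" "obounded B C 1"
    and "vnorm B (oapp B A (oapp B C \<psi>) - vsc z \<psi>) \<le> \<delta>" "cmod z = 1"
  shows "1 - cmod (inprod B \<psi> (oapp B A \<psi>)) \<le> \<delta> + \<epsilon>"
proof -
  let ?a = "inprod B \<psi> (oapp B A \<psi>)" and ?c = "inprod B \<psi> (oapp B C \<psi>)"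
  let ?ac = "inprod B \<psi> (oapp B A (oapp B C \<psi>))"
  have "?ac - z = inprod B \<psi> (oapp B A (oapp B C \<psi>) - vsc z \<psi>)"
    using psi by (simp add: inprod_simps inprod_self)
  then have 1: "cmod (?ac - z) \<le> \<delta>"
    using inprod_Cauchy_Schwarz[of B \<psi> "oapp B A (oapp B C \<psi>) - vsc z \<psi>"] psi assms(5) by simp
  have 2: "cmod (?ac - ?a * ?c) \<le> \<epsilon>"
    using clustering_entry_closure[OF assms(1-4) cl] by (simp add: oapp_omul)
  have "cmod ?c \<le> 1"
    using inprod_oapp_le[OF assms(4) psi(1), of \<psi>] psi by simp
  then have 3: "cmod (?a * ?c) \<le> cmod ?a"
    using mult_left_mono[of "cmod ?c" 1 "cmod ?a"] by (simp add: norm_mult)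
  have "z = (?a * ?c) + ((?ac - ?a * ?c) - (?ac - z))" by simp
  then have "cmod z \<le> cmod (?a * ?c) + (cmod (?ac - ?a * ?c) + cmod (?ac - z))"
    using norm_triangle_ineq[of "?a * ?c" "(?ac - ?a * ?c) - (?ac - z)"]
      norm_triangle_ineq4[of "?ac - ?a * ?c" "?ac - z"] by simp
  then show ?thesis using 1 2 3 assms(6) by simp
qed

text \<open>For an overlap of modulus a at most 1, the squared residual 1 - a^2 is at most 2(1 - a).
  The condition on \<open>k\<close> and \<open>c\<close> only rounds the square root up to a
  convenient number.\<close>

lemma residual_le:
  assumes "v \<in> vecs B" "vnorm B v = 1" "1 - cmod (inprod B \<psi> v) \<le> k * \<epsilon>" "2 * k \<le> c\<^sup>2" "0 \<le> c"
  shows "vnorm B (v - vsc (inprod B \<psi> v) \<psi>) \<le> c * sqrt \<epsilon>"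
proof -
  let ?a = "cmod (inprod B \<psi> v)"
  have "?a \<le> 1" using inprod_Cauchy_Schwarz[of B \<psi> v] assms psi by simp
  then have "(1 - ?a) * (1 + ?a) \<le> (1 - ?a) * 2"
    by (intro mult_left_mono) auto
  also have "\<dots> \<le> 2 * k * \<epsilon>" using assms(3) by simp
  also have "\<dots> \<le> c\<^sup>2 * \<epsilon>" using assms(4) eps by (intro mult_right_mono)
  finally have "(vnorm B (v - vsc (inprod B \<psi> v) \<psi>))\<^sup>2 \<le> (c * sqrt \<epsilon>)\<^sup>2"
    using vnorm_residual[OF assms(2) psi(2)] eps
    by (simp add: power_mult_distrib power2_eq_square algebra_simps)
  then show ?thesis
    by (rule power2_le_imp_le) (use assms eps in auto)
qed

lemma cmod_u: "cmod u \<le> 1" "1 - (cmod u)\<^sup>2 \<le> \<epsilon>"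
proof -
  have n: "vnorm B (oapp B U \<psi>) = 1" using unitary_vnorm[OF U psi(1)] psi by simp
  then show "cmod u \<le> 1"
    unfolding u_def using inprod_Cauchy_Schwarz[of B \<psi> "oapp B U \<psi>"] psi by simp
  have "1 - (cmod u)\<^sup>2 = (vnorm B (oapp B U \<psi> - vsc u \<psi>))\<^sup>2"
    using vnorm_residual[OF n psi(2)] by (simp add: u_def)
  also have "\<dots> \<le> \<epsilon>\<^sup>2"
    using eU by (intro power_mono) (auto simp: u_def)
  also have "\<dots> \<le> \<epsilon>" using eps mult_left_mono[of \<epsilon> 1 \<epsilon>] by (simp add: power2_eq_square)
  finally show "1 - (cmod u)\<^sup>2 \<le> \<epsilon>" .
qed

section \<open>The total generators acting on the state\<close>

lemma Qb_eigen: "vnorm B (evol Qb t \<psi> - vsc (cis (q * t)) \<psi>) \<le> \<epsilon> * \<bar>t\<bar>"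
proof -
  have "Qb = osub (osub (oadd (oadd qm q0) qp) Km) Kp"
    by (simp add: Qb_def Ym_def Yp_def oadd_def osub_def fun_eq_iff)
  then have "vnorm B (oapp B Qb \<psi> - vsc (inprod B \<psi> (oapp B Qb \<psi>)) \<psi>) \<le> \<epsilon>" by (rule eQ)
  then have "vnorm B (oapp B Qb \<psi> - vsc (of_real q) \<psi>) \<le> \<epsilon>"
    unfolding q_def by (simp flip: inprod_self_adjoint_real[OF sa(5)])
  then have "vnorm B (oapp B Qb \<psi> - vsc (of_real q) \<psi>) * \<bar>t\<bar> \<le> \<epsilon> * \<bar>t\<bar>"
    by (rule mult_right_mono) simp
  with expi_eigen_le[OF sa(5) psi(1), of t q] show ?thesis by (rule order_trans)
qed

text \<open>Since \<open>U\<close> almost fixes the ray of \<open>\<psi>\<close>, conjugation by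
  \<open>U\<close> preserves the phase. The extra \<open>2 * \<epsilon>\<close> comes from replacing
  U \<psi> by its projection in each of the two terms.\<close>

lemma conj_expi_eigen:
  "vnorm B (oapp B (oadj U) (evol Qb t (oapp B U \<psi>)) - vsc (cis (q * t)) \<psi>) \<le> \<epsilon> * \<bar>t\<bar> + 2 * \<epsilon>"
proof -
  let ?E = "evol Qb t" and ?c = "cis (q * t)" and ?d = "oapp B U \<psi> - vsc u \<psi>"
  have d: "?d \<in> vecs B" "vnorm B ?d \<le> \<epsilon>" using psi eU by (auto simp: u_def)
  have "oapp B (oadj U) (?E (oapp B U \<psi>)) - vsc ?c \<psi> = oapp B (oadj U) (?E (oapp B U \<psi>) - vsc ?c (oapp B U \<psi>))"
    using psi by (simp add: oapp_simps unitary_simps[OF U])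
  then have "vnorm B (oapp B (oadj U) (?E (oapp B U \<psi>)) - vsc ?c \<psi>) = vnorm B (?E (oapp B U \<psi>) - vsc ?c (oapp B U \<psi>))"
    by (simp add: unitary_vnorm[OF unitary_oadj[OF U]])
  also have "?E (oapp B U \<psi>) - vsc ?c (oapp B U \<psi>) = (?E ?d - vsc ?c ?d) + vsc u (?E \<psi> - vsc ?c \<psi>)"
    by (simp add: oapp_simps vsc_diff_right mult.commute)
  also have "vnorm B \<dots> \<le> (vnorm B (?E ?d) + vnorm B (vsc ?c ?d)) + vnorm B (vsc u (?E \<psi> - vsc ?c \<psi>))"
    by (rule order_trans[OF vnorm_triangle add_right_mono[OF vnorm_diff_le]])
  also have "\<dots> \<le> (\<epsilon> + \<epsilon>) + 1 * (\<epsilon> * \<bar>t\<bar>)"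
    unfolding vnorm_vsc using d Qb_eigen[of t] cmod_u
    by (intro add_mono mult_mono) (auto simp: expi_vnorm)
  also have "\<dots> = \<epsilon> * \<bar>t\<bar> + 2 * \<epsilon>" by simp
  finally show ?thesis .
qed

text \<open>The difference is a combination of exactly three assumed errors: the localisation of the
  two conjugated boundary terms and the defect in the charge transport.\<close>

lemma obounded_conj_Qb_X: "obounded B (osub X (oconj B U Qb)) (3 * \<epsilon>)"
proof -
  let ?Q = "oadd (oadd qm q0) qp"
  let ?a = "osub (osub (osub (oconj B U ?Q) ?Q) Tm) Tp"
  let ?b = "osub (oconj B U Km) km" and ?c = "osub (oconj B U Kp) kp"
  have "obounded B (osub (oadd ?b ?c) ?a) ((\<epsilon> + \<epsilon>) + \<epsilon>)"
    by (intro obounded_osub obounded_oadd eKm eKp eT refl)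
  moreover have "oapp B (osub (oadd ?b ?c) ?a) v = oapp B (osub X (oconj B U Qb)) v" for v
    unfolding X_def Qb_def Xm_def Xp_def Ym_def Yp_def by (simp add: oapp_simps oapp_omul algebra_simps)
  ultimately show ?thesis unfolding obounded_def by simp
qed

text \<open>Both evolutions multiply \<open>\<psi>\<close> by almost inverse phases. The factor
  \<open>vsc 1\<close> is kept so that the statement matches \<open>rigidity\<close> with z =
  1.\<close>

lemma X_Qb_fixes_psi:
  assumes "\<bar>t\<bar> \<le> 2 * pi"
  shows "vnorm B (evol X (- t) (evol Qb t \<psi>) - vsc 1 \<psi>) \<le> 34 * \<epsilon>"
proof -
  let ?E = "evol X (- t)" and ?c = "cis (q * t)"
  let ?K = "oconj B U Qb"
  let ?d = "evol Qb t \<psi> - vsc ?c \<psi>"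
  have K: "self_adjoint B ?K" by (rule self_adjoint_conj) auto
  have cc: "?c * cis (q * - t) = 1" by (simp add: cis_mult)
  have "vnorm B (?E \<psi> - evol ?K (- t) \<psi>) \<le> 3 * \<epsilon> * \<bar>t\<bar>"
    using expi_diff_obounded[OF K sa(6) psi(1) obounded_conj_Qb_X, of "- t"] psi by simp
  moreover have "vnorm B (evol ?K (- t) \<psi> - vsc (cis (q * - t)) \<psi>) \<le> \<epsilon> * \<bar>t\<bar> + 2 * \<epsilon>"
    using conj_expi_eigen[of "- t"] expi_conj[OF sa(5) U psi(1) refl, of "- t"] by simp
  ultimately have 1: "vnorm B (?E \<psi> - vsc (cis (q * - t)) \<psi>) \<le> 3 * \<epsilon> * \<bar>t\<bar> + (\<epsilon> * \<bar>t\<bar> + 2 * \<epsilon>)"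
    using vnorm_triangle_diff[of B "?E \<psi>" "vsc (cis (q * - t)) \<psi>" "evol ?K (- t) \<psi>"]
    by linarith
  have "?E (evol Qb t \<psi>) - vsc 1 \<psi> = ?E ?d + vsc ?c (?E \<psi> - vsc (cis (q * - t)) \<psi>)"
    unfolding oapp_simps vsc_diff_right vsc_vsc cc by simp
  then have "vnorm B (?E (evol Qb t \<psi>) - vsc 1 \<psi>)
      = vnorm B (?E ?d + vsc ?c (?E \<psi> - vsc (cis (q * - t)) \<psi>))" by (rule arg_cong)
  also have "\<dots> \<le> vnorm B ?d + vnorm B (?E \<psi> - vsc (cis (q * - t)) \<psi>)"
    by (rule order_trans[OF vnorm_triangle]) (use psi in \<open>simp add: expi_vnorm\<close>)
  also have "\<dots> \<le> \<epsilon> * \<bar>t\<bar> + (3 * \<epsilon> * \<bar>t\<bar> + (\<epsilon> * \<bar>t\<bar> + 2 * \<epsilon>))"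
    by (intro add_mono Qb_eigen 1)
  also have "\<dots> = \<epsilon> * (5 * \<bar>t\<bar> + 2)" by (simp add: algebra_simps)
  \<comment> \<open>5 |t| + 2 is at most 10\<pi> + 2, which is below 34.\<close>
  also have "\<dots> \<le> \<epsilon> * 34"
    using assms pi_approx eps by (intro mult_left_mono) auto
  also have "\<dots> = 34 * \<epsilon>" by simp
  finally show ?thesis .
qed

text \<open>The expectation of exp(-itXm) exp(itYm), with the first factor moved to the left
  argument so that \<open>inprod_evolves\<close> differentiates it directly.\<close>

definition "w t = inprod B (evol Xm t \<psi>) (evol Ym t \<psi>)"

text \<open>The plus factors and the middle charge are commuted past the minus factors; the two
  evolutions of \<open>q0\<close> then meet and cancel.\<close>

lemma factorize:
  assumes "v \<in> vecs B"
  shows "evol Xm (- t) (evol Ym t (evol Xp (- t) (evol Yp t v)))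
    = evol X (- t) (evol Qb t v)"
proof -
  let ?E = "\<lambda>H s. evol H s"
  have "?E X (- t) (?E Qb t v)
      = ?E Xm (- t) (?E q0 (- t) (?E Xp (- t) (?E Ym t (?E q0 t (?E Yp t v)))))"
    unfolding X_def Qb_def using assms by (simp add: expi_split)
  moreover have "?E Xp (- t) (?E Ym t (?E q0 t (?E Yp t v))) = ?E Ym t (?E Xp (- t) (?E q0 t (?E Yp t v)))"
    using assms commMP[OF memM(1) memP(2)] by (intro expi_expi_commute) auto
  moreover have "?E Xp (- t) (?E q0 t (?E Yp t v)) = ?E q0 t (?E Xp (- t) (?E Yp t v))"
    using assms commP0[OF memP(2)] sa0 by (intro expi_expi_commute) auto
  moreover have "?E q0 (- t) (?E Ym t (?E q0 t (?E Xp (- t) (?E Yp t v))))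
      = ?E Ym t (?E q0 (- t) (?E q0 t (?E Xp (- t) (?E Yp t v))))"
    using assms commM0[OF memM(1)] sa0 by (intro expi_expi_commute) auto
  moreover have "?E q0 (- t) (?E q0 t (?E Xp (- t) (?E Yp t v))) = ?E Xp (- t) (?E Yp t v)"
    using assms sa0 by (intro expi_cancel') auto
  ultimately show ?thesis by (simp only:)
qed

text \<open>Rigidity controls A = exp(-itXm) exp(itYm), but the residual is taken for its adjoint:
  that form replaces exp(itXm) \<psi> by a multiple of exp(itYm) \<psi> in the derivative of
  \<open>w\<close>.\<close>

lemma residual_w:
  assumes "\<bar>t\<bar> \<le> 2 * pi"
  shows "vnorm B (evol Ym (- t) (evol Xm t \<psi>) - vsc (cnj (w t)) \<psi>) \<le> 9 * sqrt \<epsilon>"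
proof -
  let ?A = "omul B (expi Xm (- t)) (expi Ym t)" and ?C = "omul B (expi Xp (- t)) (expi Yp t)"
  let ?z = "evol Ym (- t) (evol Xm t \<psi>)"
  have "1 - cmod (inprod B \<psi> (oapp B ?A \<psi>)) \<le> 34 * \<epsilon> + \<epsilon>"
  proof (rule rigidity)
    show "?A \<in> entry_closure SM" "?C \<in> entry_closure SP"
      by (intro entry_closure_omul entry_closure_expi algM algP memM memP)+
    show "obounded B ?A 1" "obounded B ?C 1"
      by (intro obounded_omul_1 obounded_expi; simp)+
    show "vnorm B (oapp B ?A (oapp B ?C \<psi>) - vsc 1 \<psi>) \<le> 34 * \<epsilon>"
      using X_Qb_fixes_psi[OF assms] factorize[OF psi(1), of t] by (simp add: oapp_omul)
  qed simp
  moreover have "inprod B \<psi> (oapp B ?A \<psi>) = w t"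
    using psi by (simp add: oapp_omul w_def expi_adjoint)
  moreover have z: "inprod B \<psi> ?z = cnj (w t)"
    using psi by (simp add: w_def expi_adjoint inprod_cnj)
  ultimately have "1 - cmod (inprod B \<psi> ?z) \<le> 35 * \<epsilon>" by simp
  \<comment> \<open>With k = 35 the condition of \<open>residual_le\<close> reads 70 at most
    81.\<close>
  then have "vnorm B (?z - vsc (inprod B \<psi> ?z) \<psi>) \<le> 9 * sqrt \<epsilon>"
    by (rule residual_le[rotated 2]) (use psi in \<open>auto simp: expi_vnorm\<close>)
  then show ?thesis by (simp add: z)
qed

text \<open>No bound on \<open>km\<close> is given, only its distance to the conjugate of
  \<open>Km\<close>, so that conjugate is inserted and removed; the surplus
  \<open>\<epsilon>\<close> is at most 1.\<close>

lemma obounded_D: "obounded B D (3 * N + 1)"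
proof -
  have c: "obounded B (oconj B U Km) N"
    unfolding obounded_def
  proof
    fix v assume "v \<in> vecs B"
    then show "vnorm B (oapp B (oconj B U Km) v) \<le> N * vnorm B v"
      using oboundedD[OF bK, of "oapp B U v"]
      by (simp add: oapp_omul unitary_vnorm[OF U] unitary_vnorm[OF unitary_oadj[OF U]])
  qed
  let ?K = "oconj B U Km"
  have "obounded B (oadd (osub (oadd Tm Km) ?K) (osub ?K km)) (((N + N) + N) + \<epsilon>)"
    by (intro obounded_oadd obounded_osub bT bK eKm c)
  moreover have "oadd (osub (oadd Tm Km) ?K) (osub ?K km) = D"
    by (simp add: D_def Xm_def Ym_def oadd_def osub_def fun_eq_iff)
  ultimately show ?thesis
    using obounded_mono[of B D _ "3 * N + 1"] eps by simp
qed

definition "\<tau> = Re (inprod B \<psi> (oapp B Tm \<psi>))"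

text \<open>The boundary terms cancel in expectation: that of \<open>km\<close> is close to that of
  \<open>Km\<close> in the state U \<psi>, and U \<psi> is close to u \<psi> with |u| close to 1.
  Only \<open>Tm\<close> contributes.\<close>

lemma expectation_D: "cmod (inprod B \<psi> (oapp B D \<psi>) - of_real \<tau>) \<le> \<epsilon> + 3 * N * \<epsilon>"
proof -
  let ?K = "oconj B U Km"
  have e: "oapp B D \<psi> = oapp B Tm \<psi> + (oapp B Km \<psi> - oapp B km \<psi>)"
    by (simp add: D_def Xm_def Ym_def oapp_simps)
  have tau: "of_real \<tau> = inprod B \<psi> (oapp B Tm \<psi>)"
    unfolding \<tau>_def by (rule inprod_self_adjoint_real[OF saM(2), symmetric])
  have K: "inprod B \<psi> (oapp B ?K \<psi>) = inprod B (oapp B U \<psi>) (oapp B Km (oapp B U \<psi>))"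
    by (simp add: oapp_omul inprod_oadj)
  let ?u = "vsc u \<psi>" and ?v = "oapp B U \<psi>"
  let ?a = "inprod B ?v (oapp B Km ?v)" and ?b = "inprod B ?u (oapp B Km ?u)"
  let ?k = "inprod B \<psi> (oapp B Km \<psi>)"
  have 1: "cmod (?a - ?b) \<le> 2 * N * \<epsilon>"
  proof -
    have "cmod (?a - ?b) \<le> 2 * N * vnorm B (?v - ?u)"
      by (rule inprod_quadratic_diff_le[OF bK N])
        (use psi cmod_u in \<open>auto simp: unitary_vnorm[OF U]\<close>)
    also have "\<dots> \<le> 2 * N * \<epsilon>" using eU N by (intro mult_left_mono) (auto simp: u_def)
    finally show ?thesis .
  qed
  have 2: "cmod (?b - ?k) \<le> N * \<epsilon>"
  proof -
    have "?b - ?k = - of_real (1 - (cmod u)\<^sup>2) * ?k"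
      unfolding inprod_simps oapp_simps of_real_diff complex_norm_square by (simp add: algebra_simps)
    then have "cmod (?b - ?k) = \<bar>1 - (cmod u)\<^sup>2\<bar> * cmod ?k"
      by (simp only: norm_minus_cancel norm_mult norm_of_real mult_minus_left)
    also have "\<dots> \<le> \<epsilon> * N"
    proof (rule mult_mono)
      show "\<bar>1 - (cmod u)\<^sup>2\<bar> \<le> \<epsilon>" using cmod_u power_le_one[of "cmod u" 2] by auto
      show "cmod ?k \<le> N" using inprod_oapp_le[OF bK psi(1), of \<psi>] psi by simp
    qed (use eps in auto)
    finally show ?thesis by (simp only: mult.commute)
  qed
  have 3: "cmod (?a - inprod B \<psi> (oapp B km \<psi>)) \<le> \<epsilon>"
    using inprod_oapp_le[OF eKm psi(1), of \<psi>] psi K by (simp add: oapp_osub inprod_diff_right)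
  have "inprod B \<psi> (oapp B D \<psi>) - of_real \<tau> = (?a - inprod B \<psi> (oapp B km \<psi>)) - (?a - ?b) - (?b - ?k)"
    unfolding tau e by (simp add: inprod_simps)
  moreover have "cmod ((?a - inprod B \<psi> (oapp B km \<psi>)) - (?a - ?b) - (?b - ?k))
      \<le> cmod (?a - inprod B \<psi> (oapp B km \<psi>)) + cmod (?a - ?b) + cmod (?b - ?k)"
    by (rule order_trans[OF norm_triangle_ineq4 add_right_mono[OF norm_triangle_ineq4]])
  ultimately show ?thesis using 1 2 3 by simp
qed

text \<open>exp(itYm) \<psi> need not be close to a multiple of \<open>\<psi>\<close> a priori. But
  \<open>D\<close> commutes with the evolution of \<open>?R\<close>, which may be inserted on both
  sides and completes exp(itYm) to exp(itQb), and this acts on \<open>\<psi>\<close> almost as a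
  phase. The constant 13 exceeds 4\<pi>.\<close>

lemma expectation_D_evolved:
  assumes "\<bar>t\<bar> \<le> 2 * pi"
  shows "cmod (inprod B (evol Ym t \<psi>) (oapp B D (evol Ym t \<psi>)) - inprod B \<psi> (oapp B D \<psi>))
    \<le> 13 * (3 * N + 1) * \<epsilon>"
proof -
  let ?R = "oadd q0 Yp" and ?y = "evol Ym t \<psi>" and ?b = "vsc (cis (q * t)) \<psi>"
  have R: "self_adjoint B ?R" by (intro self_adjoint_closed sa0 sa)
  have Qy: "evol ?R t ?y = evol Qb t \<psi>"
  proof -
    have "evol ?R t ?y = evol Ym t (evol ?R t \<psi>)"
      using psi R by (intro expi_expi_commute) (auto simp: commM0P)
    moreover have "evol Qb t \<psi> = evol Ym t (evol ?R t \<psi>)"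
      unfolding Qb_def using psi R by (intro expi_oadd) (auto simp: commM0P)
    ultimately show ?thesis by (simp only:)
  qed
  have "oapp B D (evol ?R t ?y) = evol ?R t (oapp B D ?y)"
    using R by (intro expi_commute) (auto simp: commM0P)
  then have 1: "inprod B ?y (oapp B D ?y) = inprod B (evol Qb t \<psi>) (oapp B D (evol Qb t \<psi>))"
    using expi_inprod[OF R, of ?y "oapp B D ?y" t] by (simp add: Qy)
  have 2: "inprod B \<psi> (oapp B D \<psi>) = inprod B ?b (oapp B D ?b)"
    by (simp add: inprod_simps oapp_simps cis_cnj cis_mult flip: mult.assoc)
  have "cmod (inprod B ?y (oapp B D ?y) - inprod B \<psi> (oapp B D \<psi>))
      \<le> 2 * (3 * N + 1) * vnorm B (evol Qb t \<psi> - ?b)"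
    unfolding 1 2 by (rule inprod_quadratic_diff_le[OF obounded_D])
      (use N psi in \<open>auto simp: expi_vnorm\<close>)
  also have "\<dots> \<le> 2 * (3 * N + 1) * (\<epsilon> * (2 * pi))"
    using N eps assms by (intro mult_left_mono order_trans[OF Qb_eigen]) auto
  also have "\<dots> = ((3 * N + 1) * \<epsilon>) * (4 * pi)" by simp
  also have "\<dots> \<le> ((3 * N + 1) * \<epsilon>) * 13"
    using N eps pi_approx by (intro mult_left_mono) auto
  finally show ?thesis by (simp add: mult_ac)
qed

lemma w_has_vector_derivative:
  "(w has_vector_derivative - \<i> * inprod B (evol Xm t \<psi>) (oapp B D (evol Ym t \<psi>))) (at t)"
proof -
  have "(w has_vector_derivative \<i> * inprod B (evol Xm t \<psi>) (oapp B (osub Ym Xm) (evol Ym t \<psi>))) (at t)"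
    unfolding w_def by (rule inprod_evolves[OF evolves_expi evolves_expi]) auto
  then show ?thesis by (simp add: D_def oapp_simps inprod_simps algebra_simps)
qed

text \<open>The left vector is replaced by its multiple of exp(itYm) \<psi>, which extracts the
  factor w(t); what remains is the expectation of \<open>D\<close>, close to \<open>\<tau>\<close>.
  The errors add up to 69N + 23.\<close>

lemma w_derivative_approx:
  assumes "\<bar>t\<bar> \<le> 2 * pi"
  shows "cmod (inprod B (evol Xm t \<psi>) (oapp B D (evol Ym t \<psi>)) - w t * of_real \<tau>)
    \<le> 70 * (N + 1) * sqrt \<epsilon>"
proof -
  let ?y = "evol Ym t \<psi>" and ?z = "evol Ym (- t) (evol Xm t \<psi>)"
  let ?M = "3 * N + 1" and ?d = "?z - vsc (cnj (w t)) \<psi>"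
  have "evol Xm t \<psi> = evol Ym t ?z"
    using psi by (simp add: expi_cancel)
  moreover have "evol Ym t ?z = evol Ym t ?d + vsc (cnj (w t)) ?y"
    unfolding oapp_simps by simp
  ultimately have x: "evol Xm t \<psi> = evol Ym t ?d + vsc (cnj (w t)) ?y"
    by (rule trans)
  have "inprod B x z = inprod B a z + c * inprod B y z" if "x = a + vsc (cnj c) y" for x a y z c
    by (simp add: that inprod_simps)
  from this[OF x]
  have "inprod B (evol Xm t \<psi>) (oapp B D ?y)
     = inprod B (evol Ym t ?d) (oapp B D ?y) + w t * inprod B ?y (oapp B D ?y)" .
  then have eq: "inprod B (evol Xm t \<psi>) (oapp B D ?y) - w t * of_real \<tau>
     = inprod B (evol Ym t ?d) (oapp B D ?y)
       + w t * ((inprod B ?y (oapp B D ?y) - inprod B \<psi> (oapp B D \<psi>)) + (inprod B \<psi> (oapp B D \<psi>) - of_real \<tau>))"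
    by (simp add: algebra_simps)
  have w: "cmod (w t) \<le> 1"
    unfolding w_def by (rule order_trans[OF inprod_Cauchy_Schwarz]) (use psi in \<open>simp add: expi_vnorm\<close>)
  have "cmod (inprod B (evol Ym t ?d) (oapp B D ?y)) \<le> vnorm B ?d * (?M * 1)"
    using inprod_oapp_le[OF obounded_D, of ?y "evol Ym t ?d"] psi by (simp add: expi_vnorm)
  also have "\<dots> \<le> (9 * sqrt \<epsilon>) * (?M * 1)"
    using N by (intro mult_right_mono residual_w assms) auto
  finally have 1: "cmod (inprod B (evol Ym t ?d) (oapp B D ?y)) \<le> 9 * ?M * sqrt \<epsilon>"
    by (simp add: mult_ac)
  have "cmod (w t * ((inprod B ?y (oapp B D ?y) - inprod B \<psi> (oapp B D \<psi>)) + (inprod B \<psi> (oapp B D \<psi>) - of_real \<tau>)))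
      \<le> 1 * (13 * ?M * \<epsilon> + (\<epsilon> + 3 * N * \<epsilon>))"
    unfolding norm_mult using N eps
    by (intro mult_mono w order_trans[OF norm_triangle_ineq] add_mono expectation_D_evolved assms expectation_D) auto
  also have "\<dots> = (42 * N + 14) * \<epsilon>" by (simp add: algebra_simps)
  also have "\<dots> \<le> (42 * N + 14) * sqrt \<epsilon>" using N eps_le_sqrt by (intro mult_left_mono) auto
  finally have "cmod (inprod B (evol Xm t \<psi>) (oapp B D ?y) - w t * of_real \<tau>)
     \<le> 9 * ?M * sqrt \<epsilon> + (42 * N + 14) * sqrt \<epsilon>"
    unfolding eq by (intro order_trans[OF norm_triangle_ineq] add_mono 1)
  also have "\<dots> = (69 * N + 23) * sqrt \<epsilon>" by (simp add: algebra_simps)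
  also have "\<dots> \<le> (70 * (N + 1)) * sqrt \<epsilon>" using N eps by (intro mult_right_mono) auto
  finally show ?thesis .
qed

text \<open>Multiplication by the integrating factor \<open>cis (\<tau> * t)\<close> gives a
  function with small derivative and value 1 at 0. The time -2\<pi> yields the phase with exponent
  +2\<pi>i\<tau>.\<close>

lemma w_final_phase: "cmod (w (- 2 * pi) - cis (2 * pi * \<tau>)) \<le> 448 * (N + 1) * sqrt \<epsilon>"
proof -
  let ?f = "\<lambda>t. w t * cis (\<tau> * t)"
  let ?g = "\<lambda>t. inprod B (evol Xm t \<psi>) (oapp B D (evol Ym t \<psi>))"
  have "cmod (?f (- 2 * pi) - ?f 0) \<le> (70 * (N + 1) * sqrt \<epsilon>) * \<bar>- 2 * pi\<bar>"
  proof (rule norm_diff_le_of_vector_derivative)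
    fix t
    have c: "((\<lambda>t. cis (\<tau> * t)) has_vector_derivative \<tau> *\<^sub>R (\<i> * cis (\<tau> * t))) (at t)"
      by (auto intro!: derivative_eq_intros simp: has_vector_derivative_def scaleR_conv_of_real mult_ac)
    show "(?f has_vector_derivative w t * (\<tau> *\<^sub>R (\<i> * cis (\<tau> * t))) + (- \<i> * ?g t) * cis (\<tau> * t)) (at t)"
      by (rule has_vector_derivative_mult[OF w_has_vector_derivative c])
    assume "t \<in> closed_segment 0 (- 2 * pi)"
    then have t: "\<bar>t\<bar> \<le> 2 * pi" by (auto simp: closed_segment_eq_real_ivl split: if_splits)
    have "w t * (\<tau> *\<^sub>R (\<i> * cis (\<tau> * t))) + (- \<i> * ?g t) * cis (\<tau> * t)
        = - \<i> * cis (\<tau> * t) * (?g t - w t * of_real \<tau>)"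
      by (simp add: scaleR_conv_of_real algebra_simps)
    then show "cmod (w t * (\<tau> *\<^sub>R (\<i> * cis (\<tau> * t))) + (- \<i> * ?g t) * cis (\<tau> * t)) \<le> 70 * (N + 1) * sqrt \<epsilon>"
      using w_derivative_approx[OF t] by (simp add: norm_mult)
  qed
  \<comment> \<open>448/70 = 6.4 exceeds 2\<pi>.\<close>
  also have "\<dots> \<le> (70 * (N + 1) * sqrt \<epsilon>) * (448 / 70)"
    using N eps pi_approx by (intro mult_left_mono) auto
  also have "\<dots> = 448 * (N + 1) * sqrt \<epsilon>" by (simp add: field_simps)
  finally have *: "cmod (?f (- 2 * pi) - ?f 0) \<le> 448 * (N + 1) * sqrt \<epsilon>" .
  have "?f 0 = 1" using psi by (simp add: w_def inprod_self)
  then have "w (- 2 * pi) - cis (2 * pi * \<tau>) = cis (2 * pi * \<tau>) * (?f (- 2 * pi) - ?f 0)"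
    by (simp add: right_diff_distrib cis_mult mult.left_commute[of _ "w _"] mult_ac(1))
  then show ?thesis using * by (simp add: norm_mult)
qed

text \<open>The conjugated charge has trivial exponential at 2\<pi> and is close to the sum of the
  dressed charges, whose exponential is the product of a minus and a plus factor. The minus factor
  is near 1 by hypothesis, hence so is the plus factor. The constant 8 exceeds 1 + 2\<pi>.\<close>

lemma V_near_identity:
  assumes "v \<in> vecs B"
  shows "vnorm B (evol (oadd qp Tp) (2 * pi) v - v) \<le> 8 * \<epsilon> * vnorm B v"
proof -
  let ?Q = "oadd qm (oadd q0 qp)" and ?P = "2 * pi"
  let ?K1 = "oconj B U ?Q" and ?K2 = "oadd (oadd qm Tm) (oadd q0 (oadd qp Tp))"
  let ?V = "evol (oadd qp Tp) ?P v" and ?W = "evol (oadd qm Tm) ?P"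
  have Qsa: "self_adjoint B ?Q" by (intro self_adjoint_closed saM saP sa0)
  have K1: "self_adjoint B ?K1" by (intro self_adjoint_conj Qsa U_ops)
  have K2: "self_adjoint B ?K2" by (intro self_adjoint_closed saM saP sa0)
  have Qa: "?Q = oadd (oadd qm q0) qp" by (simp add: oadd_def add.assoc)
  have Q1: "evol ?Q ?P x = x" if "x \<in> vecs B" for x
    using that by (simp add: expi_split_2pi inM inP saM saP intg)
  have E1: "evol ?K1 ?P v = v"
    using expi_conj[OF Qsa U assms refl, of ?P] Q1[of "oapp B U v"] assms
    by (simp add: unitary_simps[OF U])
  have E2: "evol ?K2 ?P v = ?W ?V"
    using assms by (simp add: expi_split_2pi)
  have "obounded B (osub ?K1 ?K2) \<epsilon>"
    using eT[OF Qa] unfolding obounded_def by (simp add: oapp_simps algebra_simps)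
  from expi_diff_obounded[OF K2 K1 assms this, of ?P]
  have 1: "vnorm B (v - ?W ?V) \<le> \<epsilon> * ?P * vnorm B v" by (simp add: E1 E2)
  have W: "vnorm B (?W x - x) \<le> \<epsilon> * vnorm B x" if "x \<in> vecs B" for x
  proof -
    have "oadd (oadd qm Tm) (oadd q0 qp) = oadd (oadd (oadd qm q0) qp) Tm"
      by (simp add: oadd_def add_ac)
    \<comment> \<open>The hypothesis concerns the full charge plus \<open>Tm\<close>; by integrality
      its other two parts leave no trace at 2\<pi>.\<close>
    moreover have "evol (oadd (oadd qm Tm) (oadd q0 qp)) ?P x = ?W x"
      using that by (simp add: expi_split_2pi inP saP intg)
    ultimately show ?thesis
      using oboundedD[OF eE that] that by (simp add: oapp_osub)
  qed
  have "vnorm B (?V - v) \<le> vnorm B (?V - ?W ?V) + vnorm B (?W ?V - v)"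
    by (rule vnorm_triangle_diff)
  also have "\<dots> \<le> \<epsilon> * vnorm B v + \<epsilon> * ?P * vnorm B v"
    using W[of ?V] 1 assms by (simp add: vnorm_minus_commute[of B ?V] vnorm_minus_commute[of B _ v] expi_vnorm)
  also have "\<dots> = (\<epsilon> * vnorm B v) * (1 + ?P)" by (simp add: algebra_simps)
  also have "\<dots> \<le> (\<epsilon> * vnorm B v) * 8" using eps pi_approx by (intro mult_left_mono) auto
  also have "\<dots> = 8 * \<epsilon> * vnorm B v" by simp
  finally show ?thesis .
qed

text \<open>The undressed plus charge \<open>qp\<close> is used in place of \<open>Yp\<close>: it is
  invisible at 2\<pi>, so the conjugated exponential involves \<open>Ym\<close> alone. After
  conjugation it becomes \<open>qp\<close> plus \<open>Tp\<close>, which is nearly invisible by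
  \<open>V_near_identity\<close>. The constant 21 exceeds 8 + 4\<pi>.\<close>

lemma expi_Xm_near_conj:
  assumes "v \<in> vecs B"
  shows "vnorm B (evol Xm (2 * pi) v - oapp B (oadj U) (evol Ym (2 * pi) (oapp B U v)))
    \<le> 21 * \<epsilon> * vnorm B v"
proof -
  let ?P = "2 * pi" and ?H = "oadd Ym (oadd q0 qp)" and ?K4 = "oadd Xm (oadd q0 (oadd qp Tp))"
  let ?K3 = "oconj B U ?H"
  let ?V = "evol (oadd qp Tp) ?P v" and ?E = "evol Xm ?P"
  let ?A = "oapp B (oadj U) (evol Ym (2 * pi) (oapp B U v))"
  have H: "self_adjoint B ?H" by (intro self_adjoint_closed saM saP sa0 sa)
  have K3: "self_adjoint B ?K3" by (intro self_adjoint_conj H U_ops)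
  have K4: "self_adjoint B ?K4" by (intro self_adjoint_closed saM saP sa0 sa)
  have E3: "evol ?K3 ?P v = ?A"
    using expi_conj[OF H U assms refl, of ?P] assms by (simp add: expi_split_2pi inP saP intg)
  have E4: "evol ?K4 ?P v = ?E ?V"
    using assms by (simp add: expi_split_2pi)
  have "obounded B (osub (osub (oconj B U Km) km)
     (osub (osub (osub (oconj B U (oadd (oadd qm q0) qp)) (oadd (oadd qm q0) qp)) Tm) Tp)) (\<epsilon> + \<epsilon>)"
    by (intro obounded_osub eKm eT refl)
  then have "obounded B (osub ?K4 ?K3) (2 * \<epsilon>)"
    unfolding obounded_def Xm_def Ym_def by (simp add: oapp_simps oapp_omul algebra_simps)
  from expi_diff_obounded[OF K3 K4 assms this, of ?P]
  have 1: "vnorm B (?E ?V - ?A) \<le> 2 * \<epsilon> * ?P * vnorm B v" by (simp add: E3 E4)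
  have "?E v - ?E ?V = ?E (v - ?V)" by (simp add: oapp_simps)
  then have 2: "vnorm B (?E v - ?E ?V) \<le> 8 * \<epsilon> * vnorm B v"
    using V_near_identity[OF assms] assms by (simp add: expi_vnorm vnorm_minus_commute)
  have "vnorm B (?E v - ?A) \<le> vnorm B (?E v - ?E ?V) + vnorm B (?E ?V - ?A)"
    by (rule vnorm_triangle_diff)
  also have "\<dots> \<le> 8 * \<epsilon> * vnorm B v + 2 * \<epsilon> * ?P * vnorm B v"
    by (rule add_mono[OF 2 1])
  also have "\<dots> = (\<epsilon> * vnorm B v) * (8 + 4 * pi)" by (simp add: algebra_simps)
  also have "\<dots> \<le> (\<epsilon> * vnorm B v) * 21" using eps pi_approx by (intro mult_left_mono) auto
  also have "\<dots> = 21 * \<epsilon> * vnorm B v" by simp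
  finally show ?thesis .
qed

text \<open>w(-2\<pi>) is the expectation of exp(2\<pi>iXm) exp(-2\<pi>iYm). The right factor acts
  on \<open>\<psi>\<close> almost as the conjugate of \<open>a\<close>; the left one has nearly the
  expectation of exp(2\<pi>iYm) in the state U \<psi>, that is a |u|^2. The product |a|^2 |u|^2 is
  near 1.\<close>

lemma w_final_one: "cmod (w (- 2 * pi) - 1) \<le> 44 * sqrt \<epsilon>"
proof -
  let ?P = "2 * pi"
  let ?A = "evol Ym ?P" and ?As = "evol Ym (- ?P) \<psi>" and ?E = "evol Xm ?P"
  define a where "a = inprod B \<psi> (?A \<psi>)"
  have "1 - cmod (inprod B \<psi> (?A \<psi>)) \<le> 7 * \<epsilon> + \<epsilon>"
  proof (rule rigidity)
    show "expi Ym ?P \<in> entry_closure SM" "expi Yp ?P \<in> entry_closure SP"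
      by (intro entry_closure_expi algM algP memM memP)+
    have "evol Ym ?P (evol Yp ?P \<psi>) = evol Qb ?P \<psi>"
      unfolding Qb_def using psi by (simp add: expi_split_2pi)
    then have "vnorm B (evol Ym ?P (evol Yp ?P \<psi>) - vsc (cis (q * ?P)) \<psi>) \<le> \<epsilon> * ?P"
      using Qb_eigen[of ?P] by simp
    also have "\<dots> \<le> \<epsilon> * 7" using eps pi_approx by (intro mult_left_mono) auto
    finally show "vnorm B (evol Ym ?P (evol Yp ?P \<psi>) - vsc (cis (q * ?P)) \<psi>) \<le> 7 * \<epsilon>"
      by simp
  qed (auto intro: obounded_expi)
  then have a8: "1 - cmod a \<le> 8 * \<epsilon>" by (simp add: a_def)
  have a1: "cmod a \<le> 1"
    unfolding a_def using inprod_Cauchy_Schwarz[of B \<psi> "?A \<psi>"] psi by (simp add: expi_vnorm)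
  have As: "inprod B \<psi> ?As = cnj a"
    using psi by (simp add: a_def expi_adjoint inprod_cnj)
  have "vnorm B (?As - vsc (inprod B \<psi> ?As) \<psi>) \<le> 4 * sqrt \<epsilon>"
    by (rule residual_le[where k = 8]) (use psi a8 As in \<open>auto simp: expi_vnorm\<close>)
  then have 1: "vnorm B (?As - vsc (cnj a) \<psi>) \<le> 4 * sqrt \<epsilon>" by (simp add: As)
  have w: "w (- (2 * pi)) = inprod B \<psi> (?E ?As)"
    using psi by (simp add: w_def expi_adjoint)
  have "w (- 2 * pi) - cnj a * inprod B \<psi> (?E \<psi>) = inprod B \<psi> (?E (?As - vsc (cnj a) \<psi>))"
    by (simp add: w oapp_simps inprod_simps)
  then have e1: "cmod (w (- 2 * pi) - cnj a * inprod B \<psi> (?E \<psi>)) \<le> 4 * sqrt \<epsilon>"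
    using inprod_Cauchy_Schwarz[of B \<psi> "?E (?As - vsc (cnj a) \<psi>)"] 1 psi by (simp add: expi_vnorm)
  let ?v = "oapp B U \<psi>"
  have "inprod B \<psi> (?E \<psi>) - inprod B ?v (?A ?v) = inprod B \<psi> (?E \<psi> - oapp B (oadj U) (?A ?v))"
    by (simp add: inprod_simps inprod_oadj)
  then have e2: "cmod (inprod B \<psi> (?E \<psi>) - inprod B ?v (?A ?v)) \<le> 21 * \<epsilon>"
    using inprod_Cauchy_Schwarz[of B \<psi> "?E \<psi> - oapp B (oadj U) (?A ?v)"] expi_Xm_near_conj[OF psi(1)] psi
    by simp
  let ?u = "vsc u \<psi>"
  have "cmod (inprod B ?v (?A ?v) - inprod B ?u (?A ?u)) \<le> 2 * 1 * vnorm B (?v - ?u)"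
    by (rule inprod_quadratic_diff_le) (use psi cmod_u in \<open>auto simp: unitary_vnorm[OF U] intro: obounded_expi\<close>)
  also have "\<dots> \<le> 2 * 1 * \<epsilon>" using eU by (intro mult_left_mono) (auto simp: u_def)
  finally have e3: "cmod (inprod B ?v (?A ?v) - inprod B ?u (?A ?u)) \<le> 2 * \<epsilon>" by simp
  have "cnj a * inprod B ?u (?A ?u) = of_real ((cmod a)\<^sup>2 * (cmod u)\<^sup>2)"
    unfolding oapp_simps inprod_simps of_real_mult complex_norm_square a_def[symmetric]
    by (simp add: mult_ac)
  then have "cmod (cnj a * inprod B ?u (?A ?u) - 1) = \<bar>(cmod a)\<^sup>2 * (cmod u)\<^sup>2 - 1\<bar>"
    by (metis norm_of_real of_real_1 of_real_diff)
  also have "\<dots> \<le> 17 * \<epsilon>"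
  proof -
    have a2: "1 - (cmod a)\<^sup>2 \<le> 16 * \<epsilon>"
    proof -
      have "(1 - cmod a) * (1 + cmod a) \<le> (8 * \<epsilon>) * 2"
        using a8 a1 eps by (intro mult_mono) auto
      then show ?thesis by (simp add: power2_eq_square algebra_simps)
    qed
    have le1: "(cmod a)\<^sup>2 \<le> 1" "(cmod u)\<^sup>2 \<le> 1" using a1 cmod_u by (auto intro: power_le_one)
    have "(cmod a)\<^sup>2 * (1 - (cmod u)\<^sup>2) \<le> 1 * \<epsilon>"
      using le1 cmod_u eps by (intro mult_mono) auto
    then have "1 - (cmod a)\<^sup>2 * (cmod u)\<^sup>2 \<le> 17 * \<epsilon>" using a2 by (simp add: algebra_simps)
    moreover have "(cmod a)\<^sup>2 * (cmod u)\<^sup>2 \<le> 1" using le1 by (intro mult_le_one) auto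
    ultimately show ?thesis by simp
  qed
  finally have e4: "cmod (cnj a * inprod B ?u (?A ?u) - 1) \<le> 17 * \<epsilon>" .
  have e23: "cmod (cnj a * (inprod B \<psi> (?E \<psi>) - inprod B ?v (?A ?v)) + cnj a * (inprod B ?v (?A ?v) - inprod B ?u (?A ?u)))
     \<le> 1 * (21 * \<epsilon>) + 1 * (2 * \<epsilon>)"
    by (intro order_trans[OF norm_triangle_ineq] add_mono; unfold norm_mult; intro mult_mono)
      (use a1 e2 e3 in auto)
  have eq: "w (- 2 * pi) - 1 = (w (- 2 * pi) - cnj a * inprod B \<psi> (?E \<psi>))
     + (cnj a * (inprod B \<psi> (?E \<psi>) - inprod B ?v (?A ?v)) + cnj a * (inprod B ?v (?A ?v) - inprod B ?u (?A ?u)))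
     + (cnj a * inprod B ?u (?A ?u) - 1)"
    by (simp add: algebra_simps)
  \<comment> \<open>44 = 4 + 21 + 2 + 17, after \<open>\<epsilon>\<close> is bounded by its square
    root.\<close>
  have "cmod (w (- 2 * pi) - 1) \<le> 4 * sqrt \<epsilon> + (1 * (21 * \<epsilon>) + 1 * (2 * \<epsilon>)) + 17 * \<epsilon>"
    unfolding eq by (intro order_trans[OF norm_triangle_ineq] add_mono e1 e23 e4)
  then show ?thesis using eps_le_sqrt by simp
qed

theorem phase_near_one: "cmod (cis (2 * pi * \<tau>) - 1) \<le> 500 * (N + 1) * sqrt \<epsilon>"
proof -
  have "cmod (cis (2 * pi * \<tau>) - 1) \<le> cmod (w (- 2 * pi) - cis (2 * pi * \<tau>)) + cmod (w (- 2 * pi) - 1)"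
    using norm_triangle_ineq4[of "w (- 2 * pi) - 1" "w (- 2 * pi) - cis (2 * pi * \<tau>)"] by simp
  also have "\<dots> \<le> 448 * (N + 1) * sqrt \<epsilon> + 44 * sqrt \<epsilon>"
    by (intro add_mono w_final_phase w_final_one)
  also have "\<dots> = (448 * (N + 1) + 44) * sqrt \<epsilon>" by (simp add: algebra_simps)
  also have "\<dots> \<le> (500 * (N + 1)) * sqrt \<epsilon>" using N eps by (intro mult_right_mono) auto
  finally show ?thesis .
qed

end

section \<open>Spin and fermion algebras\<close>

lemma finite_lattice: "finite (lattice d L)"
  and card_lattice_le: "card (lattice d L) \<le> (L + 1) ^ d"
proof -
  let ?S = "{- half L..half L}"
  have sub: "lattice d L \<subseteq> {x. set x \<subseteq> ?S \<and> length x = d}"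
    by (fastforce simp: lattice_def in_set_conv_nth)
  have fin: "finite {x. set x \<subseteq> ?S \<and> length x = d}" by (rule finite_lists_length_eq) simp
  show "finite (lattice d L)" by (rule finite_subset[OF sub fin])
  have "card (lattice d L) \<le> card ?S ^ d"
    using card_mono[OF fin sub] card_lists_length_eq[of ?S d] by simp
  also have "card ?S \<le> L + 1" by (simp add: half_def)
  then have "card ?S ^ d \<le> (L + 1) ^ d" by (rule power_mono) simp
  finally show "card (lattice d L) \<le> (L + 1) ^ d" .
qed

lemma sum_single:
  "finite S \<Longrightarrow> k \<in> S \<Longrightarrow> (\<And>x. x \<in> S \<Longrightarrow> x \<noteq> k \<Longrightarrow> f x = 0) \<Longrightarrow> sum f S = f k"
  using sum.mono_neutral_right[of S "{k}" f] by simp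

section \<open>Spin matrices supported in a region\<close>

definition eq_on :: "cfg \<Rightarrow> cfg \<Rightarrow> int list set \<Rightarrow> bool" where
  "eq_on \<sigma> \<tau> X \<longleftrightarrow> (\<forall>x\<in>X. \<forall>s. \<sigma> (x, s) = \<tau> (x, s))"

text \<open>The intermediate configurations in products of local matrices have this shape: they are
  altered on the support and inherited elsewhere.\<close>

definition splice_cfg :: "int list set \<Rightarrow> cfg \<Rightarrow> cfg \<Rightarrow> cfg" where
  "splice_cfg X \<sigma> \<tau> = (\<lambda>(x, s). if x \<in> X then \<sigma> (x, s) else \<tau> (x, s))"

lemma finite_spin_basis: "finite (spin_basis d n L)"
proof -
  let ?F = "(\<lambda>f (x, s). if x \<in> lattice d L \<and> s = 0 then f x else 0) ` (\<Pi>\<^sub>E x\<in>lattice d L. {..<n})"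
  have "spin_basis d n L \<subseteq> ?F"
  proof
    fix \<sigma> assume that: "\<sigma> \<in> spin_basis d n L"
    show "\<sigma> \<in> ?F"
    proof (rule image_eqI[of _ _ "\<lambda>x\<in>lattice d L. \<sigma> (x, 0)"])
      show "(\<lambda>x\<in>lattice d L. \<sigma> (x, 0)) \<in> (\<Pi>\<^sub>E x\<in>lattice d L. {..<n})"
        using that by (auto simp: spin_basis_def)
      show "\<sigma> = (\<lambda>(x, s). if x \<in> lattice d L \<and> s = 0 then (\<lambda>x\<in>lattice d L. \<sigma> (x, 0)) x else 0)"
        using that by (force simp: spin_basis_def fun_eq_iff)
    qed
  qed
  moreover have "finite ?F" by (intro finite_imageI finite_PiE finite_lattice) auto
  ultimately show ?thesis by (rule finite_subset)
qed

lemma spin_basis_agree: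
  assumes "\<sigma> \<in> spin_basis d n L" "\<tau> \<in> spin_basis d n L"
  shows "(\<forall>x\<in>lattice d L - X. \<sigma> (x, 0) = \<tau> (x, 0)) \<longleftrightarrow> eq_on \<sigma> \<tau> (- X)"
proof -
  have "\<sigma> (x, s) = 0 \<and> \<tau> (x, s) = 0" if "\<not> (x \<in> lattice d L \<and> s = 0)" for x s
    using assms that by (auto simp: spin_basis_def)
  then show ?thesis unfolding eq_on_def by (metis ComplI DiffD1 DiffD2 DiffI Compl_iff)
qed

lemma eq_on_restr: "eq_on \<sigma> \<tau> X \<longleftrightarrow> restr \<sigma> X = restr \<tau> X"
  by (auto simp: eq_on_def restr_def fun_eq_iff split: if_splits)

lemma splice_cfg_in_basis:
  "\<sigma> \<in> spin_basis d n L \<Longrightarrow> \<tau> \<in> spin_basis d n L \<Longrightarrow> splice_cfg X \<sigma> \<tau> \<in> spin_basis d n L"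
  by (auto simp: spin_basis_def splice_cfg_def split: if_splits)

lemma cfg_eqI: "eq_on \<sigma> \<tau> X \<Longrightarrow> eq_on \<sigma> \<tau> (- X) \<Longrightarrow> \<sigma> = \<tau>"
  by (auto simp: eq_on_def fun_eq_iff)

text \<open>The existential local factor is replaced by two intrinsic conditions: entries vanish
  unless the configurations agree off \<open>X\<close>, and otherwise depend only on their
  restrictions to \<open>X\<close>. Closure properties can then be checked entry by entry.\<close>

lemma spin_alg_iff:
  "A \<in> spin_alg d n L X \<longleftrightarrow> A \<in> ops (spin_basis d n L) \<and>
     (\<forall>\<sigma>\<in>spin_basis d n L. \<forall>\<tau>\<in>spin_basis d n L. A \<sigma> \<tau> \<noteq> 0 \<longrightarrow> eq_on \<sigma> \<tau> (- X)) \<and>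
     (\<forall>\<sigma>\<in>spin_basis d n L. \<forall>\<tau>\<in>spin_basis d n L. \<forall>\<sigma>'\<in>spin_basis d n L. \<forall>\<tau>'\<in>spin_basis d n L.
        eq_on \<sigma> \<tau> (- X) \<and> eq_on \<sigma>' \<tau>' (- X) \<and> eq_on \<sigma> \<sigma>' X \<and> eq_on \<tau> \<tau>' X \<longrightarrow> A \<sigma> \<tau> = A \<sigma>' \<tau>')"
  (is "?l \<longleftrightarrow> ?r")
proof
  assume ?l
  then obtain Ol where "A \<in> ops (spin_basis d n L)"
    and Ol: "\<And>\<sigma> \<tau>. \<sigma> \<in> spin_basis d n L \<Longrightarrow> \<tau> \<in> spin_basis d n L \<Longrightarrow>
       A \<sigma> \<tau> = (if eq_on \<sigma> \<tau> (- X) then Ol (restr \<sigma> X) (restr \<tau> X) else 0)"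
    by (auto simp: spin_alg_def spin_basis_agree)
  have "A \<sigma> \<tau> = A \<sigma>' \<tau>'" if "\<sigma> \<in> spin_basis d n L" "\<tau> \<in> spin_basis d n L" "\<sigma>' \<in> spin_basis d n L"
    "\<tau>' \<in> spin_basis d n L" "eq_on \<sigma> \<tau> (- X)" "eq_on \<sigma>' \<tau>' (- X)" "eq_on \<sigma> \<sigma>' X" "eq_on \<tau> \<tau>' X" for \<sigma> \<tau> \<sigma>' \<tau>'
    using that by (simp add: Ol eq_on_restr[of _ _ X])
  moreover have "eq_on \<sigma> \<tau> (- X)" if "\<sigma> \<in> spin_basis d n L" "\<tau> \<in> spin_basis d n L" "A \<sigma> \<tau> \<noteq> 0" for \<sigma> \<tau>
    using that by (simp add: Ol split: if_splits)
  ultimately show ?r using \<open>A \<in> ops (spin_basis d n L)\<close> by blast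
next
  assume r: ?r
  let ?B = "spin_basis d n L"
  let ?P = "\<lambda>a b (\<sigma>, \<tau>). \<sigma> \<in> ?B \<and> \<tau> \<in> ?B \<and> eq_on \<sigma> \<tau> (- X) \<and> restr \<sigma> X = a \<and> restr \<tau> X = b"
  \<comment> \<open>The factor is read off from any admissible pair with the given restrictions; the
    second condition makes the choice immaterial.\<close>
  define Ol where "Ol a b = (case SOME p. ?P a b p of (\<sigma>, \<tau>) \<Rightarrow> A \<sigma> \<tau>)" for a b
  have "A \<sigma> \<tau> = Ol (restr \<sigma> X) (restr \<tau> X)"
    if "\<sigma> \<in> ?B" "\<tau> \<in> ?B" "eq_on \<sigma> \<tau> (- X)" for \<sigma> \<tau>
  proof -
    obtain \<sigma>' \<tau>' where p: "(SOME p. ?P (restr \<sigma> X) (restr \<tau> X) p) = (\<sigma>', \<tau>')" by fastforce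
    have "?P (restr \<sigma> X) (restr \<tau> X) (\<sigma>', \<tau>')"
      unfolding p[symmetric] by (rule someI[of _ "(\<sigma>, \<tau>)"]) (use that in auto)
    then have "\<sigma>' \<in> ?B" "\<tau>' \<in> ?B" "eq_on \<sigma>' \<tau>' (- X)" "eq_on \<sigma> \<sigma>' X" "eq_on \<tau> \<tau>' X"
      by (auto simp: eq_on_restr[of _ _ X])
    then have "A \<sigma> \<tau> = A \<sigma>' \<tau>'" using r that by blast
    then show ?thesis by (simp add: Ol_def p)
  qed
  moreover have "A \<in> ops ?B" using r by blast
  moreover have "A \<sigma> \<tau> = 0" if "\<sigma> \<in> ?B" "\<tau> \<in> ?B" "\<not> eq_on \<sigma> \<tau> (- X)" for \<sigma> \<tau>
    using r that by blast
  ultimately show ?l unfolding spin_alg_def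
    by (auto intro!: exI[of _ Ol] simp: spin_basis_agree)
qed

lemma spin_algD:
  assumes "A \<in> spin_alg d n L X"
  shows "A \<in> ops (spin_basis d n L)"
    "\<sigma> \<in> spin_basis d n L \<Longrightarrow> \<tau> \<in> spin_basis d n L \<Longrightarrow> A \<sigma> \<tau> \<noteq> 0 \<Longrightarrow> eq_on \<sigma> \<tau> (- X)"
    "\<sigma> \<in> spin_basis d n L \<Longrightarrow> \<tau> \<in> spin_basis d n L \<Longrightarrow> \<sigma>' \<in> spin_basis d n L \<Longrightarrow> \<tau>' \<in> spin_basis d n L \<Longrightarrow>
      eq_on \<sigma> \<tau> (- X) \<Longrightarrow> eq_on \<sigma>' \<tau>' (- X) \<Longrightarrow> eq_on \<sigma> \<sigma>' X \<Longrightarrow> eq_on \<tau> \<tau>' X \<Longrightarrow> A \<sigma> \<tau> = A \<sigma>' \<tau>'"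
  using assms unfolding spin_alg_iff by blast+

lemma spin_algI:
  assumes "A \<in> ops (spin_basis d n L)"
    and "\<And>\<sigma> \<tau>. \<sigma> \<in> spin_basis d n L \<Longrightarrow> \<tau> \<in> spin_basis d n L \<Longrightarrow> A \<sigma> \<tau> \<noteq> 0 \<Longrightarrow> eq_on \<sigma> \<tau> (- X)"
    and "\<And>\<sigma> \<tau> \<sigma>' \<tau>'. \<sigma> \<in> spin_basis d n L \<Longrightarrow> \<tau> \<in> spin_basis d n L \<Longrightarrow> \<sigma>' \<in> spin_basis d n L \<Longrightarrow>
      \<tau>' \<in> spin_basis d n L \<Longrightarrow> eq_on \<sigma> \<tau> (- X) \<Longrightarrow> eq_on \<sigma>' \<tau>' (- X) \<Longrightarrow> eq_on \<sigma> \<sigma>' X \<Longrightarrow>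
      eq_on \<tau> \<tau>' X \<Longrightarrow> A \<sigma> \<tau> = A \<sigma>' \<tau>'"
  shows "A \<in> spin_alg d n L X"
  unfolding spin_alg_iff using assms by blast

lemma spin_alg_omul:
  assumes A: "A \<in> spin_alg d n L X" and C: "C \<in> spin_alg d n L X"
  shows "omul (spin_basis d n L) A C \<in> spin_alg d n L X"
proof -
  let ?B = "spin_basis d n L"
  note finB = finite_spin_basis[of d n L]
  have "eq_on \<sigma> \<tau> (- X)" if B: "\<sigma> \<in> ?B" "\<tau> \<in> ?B" and nz: "omul ?B A C \<sigma> \<tau> \<noteq> 0" for \<sigma> \<tau>
  proof -
    obtain k where k: "k \<in> ?B" "A \<sigma> k \<noteq> 0" "C k \<tau> \<noteq> 0"
      using nz unfolding omul_def by (auto elim: sum.not_neutral_contains_not_neutral)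
    then have "eq_on \<sigma> k (- X)" "eq_on k \<tau> (- X)"
      using spin_algD(2)[OF A] spin_algD(2)[OF C] B by auto
    then show ?thesis by (simp add: eq_on_def)
  qed
  moreover have "omul ?B A C \<sigma> \<tau> = omul ?B A C \<sigma>' \<tau>'"
    if B: "\<sigma> \<in> ?B" "\<tau> \<in> ?B" "\<sigma>' \<in> ?B" "\<tau>' \<in> ?B"
      and e: "eq_on \<sigma> \<tau> (- X)" "eq_on \<sigma>' \<tau>' (- X)" "eq_on \<sigma> \<sigma>' X" "eq_on \<tau> \<tau>' X" for \<sigma> \<tau> \<sigma>' \<tau>'
  proof -
    have restrict: "omul ?B A C \<rho> \<rho>' = (\<Sum>k\<in>{k \<in> ?B. eq_on \<rho> k (- X)}. A \<rho> k * C k \<rho>')" if "\<rho> \<in> ?B" for \<rho> \<rho>'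
      unfolding omul_def using spin_algD(2)[OF A that] finB
      by (intro sum.mono_neutral_right) auto
    have "(\<Sum>k\<in>{k \<in> ?B. eq_on \<sigma> k (- X)}. A \<sigma> k * C k \<tau>)
        = (\<Sum>k\<in>{k \<in> ?B. eq_on \<sigma>' k (- X)}. A \<sigma>' k * C k \<tau>')"
    \<comment> \<open>Contributing configurations agree with the row index off \<open>X\<close>. The
      bijection keeps the part on \<open>X\<close> and exchanges the surroundings of \<sigma> for
      those of \<sigma>', under which both entries are unchanged.\<close>
    proof (rule sum.reindex_bij_witness[where i = "\<lambda>k. splice_cfg X k \<sigma>" and j = "\<lambda>k. splice_cfg X k \<sigma>'"])
      fix k assume "k \<in> {k \<in> ?B. eq_on \<sigma> k (- X)}"
      then have k: "k \<in> ?B" "eq_on \<sigma> k (- X)" by auto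
      let ?k = "splice_cfg X k \<sigma>'"
      have k': "?k \<in> ?B" using k B by (simp add: splice_cfg_in_basis)
      show "splice_cfg X ?k \<sigma> = k" using k by (auto simp: splice_cfg_def eq_on_def fun_eq_iff)
      show "?k \<in> {k \<in> ?B. eq_on \<sigma>' k (- X)}" using k' by (auto simp: splice_cfg_def eq_on_def)
      have "A \<sigma> k = A \<sigma>' ?k"
        by (rule spin_algD(3)[OF A]) (use k k' B e in \<open>auto simp: splice_cfg_def eq_on_def\<close>)
      moreover have "C k \<tau> = C ?k \<tau>'"
        by (rule spin_algD(3)[OF C]) (use k k' B e in \<open>auto simp: splice_cfg_def eq_on_def\<close>)
      ultimately show "A \<sigma>' ?k * C ?k \<tau>' = A \<sigma> k * C k \<tau>" by simp
    next
      fix k assume "k \<in> {k \<in> ?B. eq_on \<sigma>' k (- X)}"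
      then have k: "k \<in> ?B" "eq_on \<sigma>' k (- X)" by auto
      show "splice_cfg X (splice_cfg X k \<sigma>) \<sigma>' = k" using k by (auto simp: splice_cfg_def eq_on_def fun_eq_iff)
      show "splice_cfg X k \<sigma> \<in> {k \<in> ?B. eq_on \<sigma> k (- X)}"
        using k B splice_cfg_in_basis[of k d n L \<sigma> X] by (auto simp: splice_cfg_def eq_on_def)
    qed
    then show ?thesis using restrict B by simp
  qed
  moreover have "omul ?B A C \<in> ops ?B" using spin_algD(1)[OF A] spin_algD(1)[OF C] by simp
  ultimately show ?thesis by (intro spin_algI)
qed

lemma oalgebra_spin_alg: "oalgebra (spin_basis d n L) (spin_alg d n L X)"
proof -
  let ?B = "spin_basis d n L"
  have "oid ?B \<in> spin_alg d n L X"
  proof (rule spin_algI)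
    show "eq_on \<sigma> \<tau> (- X)" if "oid ?B \<sigma> \<tau> \<noteq> 0" for \<sigma> \<tau>
      using that by (auto simp: oid_def eq_on_def split: if_splits)
    show "oid ?B \<sigma> \<tau> = oid ?B \<sigma>' \<tau>'"
      if "\<sigma> \<in> ?B" "\<tau> \<in> ?B" "\<sigma>' \<in> ?B" "\<tau>' \<in> ?B"
        "eq_on \<sigma> \<tau> (- X)" "eq_on \<sigma>' \<tau>' (- X)" "eq_on \<sigma> \<sigma>' X" "eq_on \<tau> \<tau>' X" for \<sigma> \<tau> \<sigma>' \<tau>'
    proof -
      have "\<sigma> = \<tau> \<longleftrightarrow> eq_on \<sigma> \<tau> X" "\<sigma>' = \<tau>' \<longleftrightarrow> eq_on \<sigma>' \<tau>' X"
        using that cfg_eqI by (auto simp: eq_on_def)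
      moreover have "eq_on \<sigma> \<tau> X \<longleftrightarrow> eq_on \<sigma>' \<tau>' X"
        using that by (simp add: eq_on_def)
      ultimately show ?thesis using that by (simp add: oid_def)
    qed
  qed simp
  moreover have "osc c A \<in> spin_alg d n L X" if "A \<in> spin_alg d n L X" for A c
  proof (rule spin_algI)
    show "osc c A \<in> ops ?B" using spin_algD(1)[OF that] by simp
    show "eq_on \<sigma> \<tau> (- X)" if "\<sigma> \<in> ?B" "\<tau> \<in> ?B" "osc c A \<sigma> \<tau> \<noteq> 0" for \<sigma> \<tau>
      using spin_algD(2)[OF \<open>A \<in> spin_alg d n L X\<close> that(1,2)] that(3) by (auto simp: osc_def)
  qed (simp add: osc_def, intro disjI2, rule spin_algD(3)[OF that])
  moreover have "oadd A C \<in> spin_alg d n L X" if A: "A \<in> spin_alg d n L X" and C: "C \<in> spin_alg d n L X" for A C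
  proof (rule spin_algI)
    show "oadd A C \<in> ops ?B" using spin_algD(1)[OF A] spin_algD(1)[OF C] by simp
    show "eq_on \<sigma> \<tau> (- X)" if "\<sigma> \<in> ?B" "\<tau> \<in> ?B" "oadd A C \<sigma> \<tau> \<noteq> 0" for \<sigma> \<tau>
    proof -
      have "A \<sigma> \<tau> \<noteq> 0 \<or> C \<sigma> \<tau> \<noteq> 0" using that(3) by (auto simp: oadd_def)
      then show ?thesis using spin_algD(2)[OF A that(1,2)] spin_algD(2)[OF C that(1,2)] by blast
    qed
  qed (unfold oadd_def, intro arg_cong2[of _ _ _ _ "(+)"] spin_algD(3)[OF A] spin_algD(3)[OF C])
  ultimately show ?thesis
    unfolding oalgebra_def using spin_alg_omul spin_algD(1) by (metis subsetI)
qed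

lemma spin_alg_mono:
  assumes "X \<subseteq> Y"
  shows "spin_alg d n L X \<subseteq> spin_alg d n L Y"
proof
  fix A assume A: "A \<in> spin_alg d n L X"
  let ?B = "spin_basis d n L"
  show "A \<in> spin_alg d n L Y"
  proof (rule spin_algI[OF spin_algD(1)[OF A]])
    show "eq_on \<sigma> \<tau> (- Y)" if "\<sigma> \<in> ?B" "\<tau> \<in> ?B" "A \<sigma> \<tau> \<noteq> 0" for \<sigma> \<tau>
      using spin_algD(2)[OF A that] assms by (auto simp: eq_on_def)
  next
    fix \<sigma> \<tau> \<sigma>' \<tau>'
    assume B: "\<sigma> \<in> ?B" "\<tau> \<in> ?B" "\<sigma>' \<in> ?B" "\<tau>' \<in> ?B"
      and e: "eq_on \<sigma> \<tau> (- Y)" "eq_on \<sigma>' \<tau>' (- Y)" "eq_on \<sigma> \<sigma>' Y" "eq_on \<tau> \<tau>' Y"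
    \<comment> \<open>Agreement off \<open>Y\<close> does not give agreement off the smaller
      \<open>X\<close>, but the two pairs agree at exactly the same modes, so their entries vanish
      or coincide together.\<close>
    have iff: "\<sigma> (x, s) = \<tau> (x, s) \<longleftrightarrow> \<sigma>' (x, s) = \<tau>' (x, s)" for x s
      using e by (cases "x \<in> Y") (simp_all add: eq_on_def)
    have sub: "eq_on \<sigma> \<sigma>' X" "eq_on \<tau> \<tau>' X" using e(3,4) assms by (auto simp: eq_on_def)
    show "A \<sigma> \<tau> = A \<sigma>' \<tau>'"
    proof (cases "eq_on \<sigma> \<tau> (- X)")
      case True
      moreover have "eq_on \<sigma>' \<tau>' (- X)" using True by (simp add: eq_on_def iff)
      ultimately show ?thesis using sub B by (intro spin_algD(3)[OF A])
    next
      case False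
      moreover have "\<not> eq_on \<sigma>' \<tau>' (- X)" using False by (simp add: eq_on_def iff)
      ultimately have "A \<sigma> \<tau> = 0" "A \<sigma>' \<tau>' = 0" using spin_algD(2)[OF A] B by blast+
      then show ?thesis by simp
    qed
  qed
qed

lemma spin_alg_oadj:
  assumes "A \<in> spin_alg d n L X"
  shows "oadj A \<in> spin_alg d n L X"
proof -
  have sym: "eq_on \<sigma> \<tau> Y" if "eq_on \<tau> \<sigma> Y" for \<sigma> \<tau> Y using that by (auto simp: eq_on_def)
  show ?thesis
  proof (rule spin_algI)
    show "oadj A \<in> ops (spin_basis d n L)" using spin_algD(1)[OF assms] by simp
    show "eq_on \<sigma> \<tau> (- X)" if "\<sigma> \<in> spin_basis d n L" "\<tau> \<in> spin_basis d n L" "oadj A \<sigma> \<tau> \<noteq> 0" for \<sigma> \<tau>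
      using spin_algD(2)[OF assms that(2,1)] that(3) by (auto simp: oadj_def intro: sym)
  qed (simp add: oadj_def, rule spin_algD(3)[OF assms]; (assumption | erule sym))
qed

text \<open>With disjoint supports a single intermediate configuration survives in each product,
  namely the one already changed on the support of the left factor; the entries then match by
  locality.\<close>

lemma spin_alg_commute:
  assumes A: "A \<in> spin_alg d n L X" and C: "C \<in> spin_alg d n L Y" and disj: "X \<inter> Y = {}"
  shows "omul (spin_basis d n L) A C = omul (spin_basis d n L) C A"
proof (intro ext)
  fix \<sigma> \<tau>
  let ?B = "spin_basis d n L"
  note finB = finite_spin_basis[of d n L]
  show "omul ?B A C \<sigma> \<tau> = omul ?B C A \<sigma> \<tau>"
  proof (cases "\<sigma> \<in> ?B \<and> \<tau> \<in> ?B")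
    case False
    then show ?thesis
      using spin_algD(1)[OF A] spin_algD(1)[OF C] by (auto simp: omul_def ops_def)
  next
    case True
    then have B: "\<sigma> \<in> ?B" "\<tau> \<in> ?B" by auto
    have single: "omul ?B F G \<sigma> \<tau> = F \<sigma> (splice_cfg Z \<tau> \<sigma>) * G (splice_cfg Z \<tau> \<sigma>) \<tau>"
      if F: "F \<in> spin_alg d n L Z" and G: "G \<in> spin_alg d n L Z'" and "Z \<inter> Z' = {}" for F G Z Z'
      unfolding omul_def
    proof (rule sum_single[OF finB splice_cfg_in_basis[OF B(2,1)]])
      fix k assume k: "k \<in> ?B" "k \<noteq> splice_cfg Z \<tau> \<sigma>"
      show "F \<sigma> k * G k \<tau> = 0"
      proof (rule ccontr)
        assume "F \<sigma> k * G k \<tau> \<noteq> 0"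
        then have "eq_on \<sigma> k (- Z)" "eq_on k \<tau> (- Z')"
          using spin_algD(2)[OF F] spin_algD(2)[OF G] B k by auto
        then have "k = splice_cfg Z \<tau> \<sigma>"
          using that(3) by (auto simp: eq_on_def splice_cfg_def fun_eq_iff disjoint_iff)
        then show False using k by simp
      qed
    qed
    let ?k = "splice_cfg X \<tau> \<sigma>" and ?l = "splice_cfg Y \<tau> \<sigma>"
    have kl: "?k \<in> ?B" "?l \<in> ?B" using B by (auto simp: splice_cfg_in_basis)
    have "A \<sigma> ?k * C ?k \<tau> = C \<sigma> ?l * A ?l \<tau>"
    proof (cases "eq_on \<sigma> \<tau> (- (X \<union> Y))")
      case True
      have "A \<sigma> ?k = A ?l \<tau>"
        by (rule spin_algD(3)[OF A]) (use B kl True disj in \<open>auto simp: eq_on_def splice_cfg_def\<close>)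
      moreover have "C ?k \<tau> = C \<sigma> ?l"
        by (rule spin_algD(3)[OF C]) (use B kl True disj in \<open>auto simp: eq_on_def splice_cfg_def\<close>)
      ultimately show ?thesis by simp
    next
      case False
      have "\<not> eq_on ?k \<tau> (- Y)" "\<not> eq_on ?l \<tau> (- X)"
        using False by (auto simp: eq_on_def splice_cfg_def split: if_splits)
      then have "C ?k \<tau> = 0" "A ?l \<tau> = 0"
        using spin_algD(2)[OF A] spin_algD(2)[OF C] B kl by blast+
      then show ?thesis by simp
    qed
    moreover have "Y \<inter> X = {}" using disj by auto
    ultimately show ?thesis using single[OF A C disj] single[OF C A] by simp
  qed
qed

section \<open>Fermionic Fock space and anticommutation\<close>

lemma finite_modes: "finite (modes d n L)"
proof -
  have "modes d n L = lattice d L \<times> {..<n}" by (auto simp: modes_def)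
  then show ?thesis by (simp add: finite_lattice)
qed

lemma finite_fermi_basis: "finite (fermi_basis d n L)"
proof -
  have "fermi_basis d n L \<subseteq> (\<lambda>S m. if m \<in> S then 1 else 0) ` Pow (modes d n L)"
  proof
    fix \<nu> assume \<nu>: "\<nu> \<in> fermi_basis d n L"
    have "\<nu> m = (if m \<in> {m. \<nu> m = 1} then 1 else 0)" for m
    proof -
      have "\<nu> m \<le> 1" using \<nu> unfolding fermi_basis_def by blast
      then show ?thesis by auto
    qed
    then show "\<nu> \<in> (\<lambda>S m. if m \<in> S then 1 else 0) ` Pow (modes d n L)"
      using \<nu> by (intro image_eqI[of _ _ "{m. \<nu> m = 1}"]) (auto simp: fermi_basis_def)
  qed
  then show ?thesis
    by (rule finite_subset) (simp add: finite_modes)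
qed

definition jw_sign :: "nat \<Rightarrow> nat \<Rightarrow> nat \<Rightarrow> int list \<times> nat \<Rightarrow> cfg \<Rightarrow> complex" where
  "jw_sign d n L m \<nu> = (-1) ^ card {m' \<in> modes d n L. mode_less m' m \<and> \<nu> m' = 1}"

lemma annih_jw: "annih d n L m \<nu>' \<nu> =
    (if \<nu> \<in> fermi_basis d n L \<and> \<nu> m = 1 \<and> \<nu>' = \<nu>(m := 0) then jw_sign d n L m \<nu> else 0)"
  by (simp add: annih_def jw_sign_def)

text \<open>Emptying a mode lowers the count behind the sign by one exactly when that mode precedes
  \<open>m\<close>.\<close>

lemma jw_sign_upd:
  assumes "\<nu> m' = 1" "m' \<in> modes d n L"
  shows "jw_sign d n L m (\<nu>(m' := 0)) = (if mode_less m' m then - 1 else 1) * jw_sign d n L m \<nu>"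
proof (cases "mode_less m' m")
  case False
  then have "{k \<in> modes d n L. mode_less k m \<and> (\<nu>(m' := 0)) k = 1}
      = {k \<in> modes d n L. mode_less k m \<and> \<nu> k = 1}" by auto
  then show ?thesis using False by (simp add: jw_sign_def)
next
  case True
  let ?S = "{k \<in> modes d n L. mode_less k m \<and> (\<nu>(m' := 0)) k = 1}"
  have "{k \<in> modes d n L. mode_less k m \<and> \<nu> k = 1} = insert m' ?S"
    using True assms by auto
  moreover have "finite ?S" "m' \<notin> ?S" using finite_modes[of d n L] by auto
  ultimately show ?thesis using True by (simp add: jw_sign_def)
qed

lemma mode_less_total: "m \<noteq> m' \<Longrightarrow> mode_less m m' \<longleftrightarrow> \<not> mode_less m' m"
  by (auto simp: mode_less_def prod_eq_iff)

lemma fermi_basis_upd: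
  "\<nu> \<in> fermi_basis d n L \<Longrightarrow> \<nu>(m := 0) \<in> fermi_basis d n L"
  "\<nu> \<in> fermi_basis d n L \<Longrightarrow> m \<in> modes d n L \<Longrightarrow> \<nu>(m := 1) \<in> fermi_basis d n L"
  by (auto simp: fermi_basis_def)

lemma annih_in_ops: "annih d n L m \<in> ops (fermi_basis d n L)"
  using fermi_basis_upd(1) by (auto simp: ops_def annih_jw)

text \<open>Both orders remove the same two particles. The mode removed first alters the sign of the
  other only if it precedes it, and for distinct modes this holds in exactly one order.\<close>

lemma annih_annih_anticommute:
  assumes m: "m \<noteq> m'" "m \<in> modes d n L" "m' \<in> modes d n L"
  shows "omul (fermi_basis d n L) (annih d n L m) (annih d n L m')
    = osc (-1) (omul (fermi_basis d n L) (annih d n L m') (annih d n L m))"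
proof (intro ext)
  fix i j
  let ?B = "fermi_basis d n L"
  have prod: "omul ?B (annih d n L a) (annih d n L b) i j =
      (if j \<in> ?B \<and> j a = 1 \<and> j b = 1 \<and> i = j(a := 0, b := 0)
       then jw_sign d n L a (j(b := 0)) * jw_sign d n L b j else 0)"
    if ab: "a \<noteq> b" for a b
  proof (cases "j \<in> ?B")
    case False
    then show ?thesis by (simp add: omul_def annih_jw)
  next
    case True
    have "omul ?B (annih d n L a) (annih d n L b) i j
        = annih d n L a i (j(b := 0)) * annih d n L b (j(b := 0)) j"
      unfolding omul_def
      by (rule sum_single) (auto simp: finite_fermi_basis True fermi_basis_upd annih_jw)
    then show ?thesis using True ab by (auto simp: annih_jw fermi_basis_upd fun_upd_twist)
  qed
  have "m' \<noteq> m" using m by simp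
  then show "omul ?B (annih d n L m) (annih d n L m') i j
      = osc (-1) (omul ?B (annih d n L m') (annih d n L m)) i j"
    unfolding osc_def prod[OF \<open>m \<noteq> m'\<close>] prod[OF \<open>m' \<noteq> m\<close>]
    using m mode_less_total[OF m(1)] by (auto simp: jw_sign_upd fun_upd_twist)
qed

lemma annih_creat_anticommute:
  assumes m: "m \<noteq> m'" "m \<in> modes d n L" "m' \<in> modes d n L"
  shows "omul (fermi_basis d n L) (annih d n L m) (oadj (annih d n L m'))
    = osc (-1) (omul (fermi_basis d n L) (oadj (annih d n L m')) (annih d n L m))"
proof (intro ext)
  fix i j
  let ?B = "fermi_basis d n L" and ?s = "jw_sign d n L"
  have cnj: "cnj (?s a \<nu>) = ?s a \<nu>" for a \<nu> by (simp add: jw_sign_def)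
  show "omul ?B (annih d n L m) (oadj (annih d n L m')) i j
      = osc (-1) (omul ?B (oadj (annih d n L m')) (annih d n L m)) i j"
  proof (cases "j \<in> ?B")
    case False
    have "oadj (annih d n L m') k j = 0" "annih d n L m k j = 0" for k
      using False fermi_basis_upd(1)[of k d n L m'] by (auto simp: oadj_def annih_jw)
    then show ?thesis by (simp add: omul_def osc_def)
  next
    case True
    let ?J = "j(m' := 1)"
    have J: "?J \<in> ?B" using True m(3) by (rule fermi_basis_upd(2))
    have l: "omul ?B (annih d n L m) (oadj (annih d n L m')) i j
        = annih d n L m i ?J * oadj (annih d n L m') ?J j"
      unfolding omul_def
    proof (rule sum_single[OF finite_fermi_basis J])
      fix k assume "k \<noteq> ?J"
      moreover have "k = j(m' := 1)" if "k m' = 1" "j = k(m' := 0)"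
        using that fun_upd_triv[of k m'] by simp
      ultimately have "annih d n L m' j k = 0" by (auto simp: annih_jw)
      then show "annih d n L m i k * oadj (annih d n L m') k j = 0" by (simp add: oadj_def)
    qed
    have r: "omul ?B (oadj (annih d n L m')) (annih d n L m) i j
        = oadj (annih d n L m') i (j(m := 0)) * annih d n L m (j(m := 0)) j"
      unfolding omul_def
      by (rule sum_single) (auto simp: finite_fermi_basis True fermi_basis_upd annih_jw)
    show ?thesis
    \<comment> \<open>The only case with nonzero entries: \<open>m'\<close> is created and
      \<open>m\<close> destroyed. All signs are expressed through the configuration
      \<open>?J\<close> with both modes filled, so that exactly one of them flips.\<close>
    proof (cases "j m' = 0 \<and> j m = 1 \<and> i = ?J(m := 0)")
      case True': True
      then have jJ: "?J(m' := 0) = j" by (metis fun_upd_triv fun_upd_upd)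
      have iB: "i \<in> ?B" "i m' = 1" using True' J fermi_basis_upd(1) m by simp_all
      have ji: "j(m := 0) = i(m' := 0)"
      proof -
        have "i(m' := 0) = ?J(m' := 0, m := 0)"
          using True' fun_upd_twist[OF m(1), of ?J 0 0] by simp
        then show ?thesis unfolding jJ by (rule sym)
      qed
      have sj: "?s m j = (if mode_less m' m then - 1 else 1) * ?s m ?J"
        using jw_sign_upd[of ?J m' d n L m] m(3) unfolding jJ by simp
      have si: "?s m' i = (if mode_less m m' then - 1 else 1) * ?s m' ?J"
        using True' jw_sign_upd[of ?J m d n L m'] m by simp
      have a: "annih d n L m i ?J = ?s m ?J" "annih d n L m (j(m := 0)) j = ?s m j"
        using True' J True m(1) by (simp_all add: annih_jw)
      have b: "oadj (annih d n L m') ?J j = ?s m' ?J"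
        unfolding oadj_def annih_jw jJ using J by (simp add: cnj)
      have c: "oadj (annih d n L m') i (j(m := 0)) = ?s m' i"
        unfolding oadj_def annih_jw ji using iB by (simp add: cnj)
      have "x * y = (-1) * ((if \<not> p then - 1 else 1) * y * ((if p then - 1 else 1) * x))"
        for x y :: complex and p by (cases p) simp_all
      then show ?thesis
        unfolding osc_def l r a b c sj si mode_less_total[OF m(1)] .
    next
      case False
      have "annih d n L m i ?J * oadj (annih d n L m') ?J j = 0"
      proof (rule ccontr)
        assume nz: "\<not> ?thesis"
        have nz': "annih d n L m i ?J \<noteq> 0" "annih d n L m' j ?J \<noteq> 0"
          using nz by (auto simp: oadj_def)
        have 1: "j m = 1 \<and> i = ?J(m := 0)"
          using nz'(1) m(1) unfolding annih_jw by (simp split: if_splits)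
        have "j = ?J(m' := 0)"
          using nz'(2) unfolding annih_jw by presburger
        from fun_cong[OF this, of m'] have "j m' = 0" by simp
        with 1 False show False by blast
      qed
      moreover have "oadj (annih d n L m') i (j(m := 0)) * annih d n L m (j(m := 0)) j = 0"
      proof (rule ccontr)
        assume "\<not> ?thesis"
        then have *: "j m = 1" "i m' = 1" "j(m := 0) = i(m' := 0)"
          by (auto simp: annih_jw oadj_def split: if_splits)
        have "j m' = 0" using fun_cong[OF *(3), of m'] m(1) by simp
        moreover have "i = ?J(m := 0)"
        proof -
          have "i = (i(m' := 0))(m' := 1)" using *(2) by (metis fun_upd_triv fun_upd_upd)
          also have "\<dots> = ?J(m := 0)"
            unfolding *(3)[symmetric] by (rule fun_upd_twist[OF m(1)])
          finally show ?thesis .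
        qed
        ultimately show False using False *(1) by blast
      qed
      ultimately show ?thesis unfolding osc_def l r by (simp only: mult_zero_right)
    qed
  qed
qed

section \<open>Parity grading and commutation of even elements\<close>

lemma gen_alg_mono:
  assumes "G \<subseteq> G'"
  shows "gen_alg B G \<subseteq> gen_alg B G'"
proof
  fix A assume "A \<in> gen_alg B G"
  then show "A \<in> gen_alg B G'"
    by induction (use assms in \<open>auto intro: gen_alg.intros\<close>)
qed

lemma gen_alg_ops:
  assumes "G \<subseteq> ops B" "A \<in> gen_alg B G"
  shows "A \<in> ops B"
  using assms(2) by induction (use assms(1) in auto)

context fin_basis
begin

lemma gen_alg_oadj:
  assumes "\<And>g. g \<in> G \<Longrightarrow> oadj g \<in> G" "A \<in> gen_alg B G"
  shows "oadj A \<in> gen_alg B G"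
  using assms(2) by induction (auto simp: oadj_simps intro: gen_alg.intros assms(1))

lemma omul_oid [simp]: "A \<in> ops B \<Longrightarrow> omul B A (oid B) = A" "A \<in> ops B \<Longrightarrow> omul B (oid B) A = A"
  by (rule ops_eqI; simp add: oapp_omul)+

lemma omul_osc: "omul B A (osc c C) = osc c (omul B A C)" "omul B (osc c A) C = osc c (omul B A C)"
  by (auto simp: omul_def osc_def sum_distrib_left mult_ac intro!: ext)

text \<open>The grading automorphism \<open>A \<mapsto> PAP\<close> records the sign picked up when an odd generator is moved
  past \<open>A\<close>; it is trivial on even elements.\<close>

lemma graded_commute:
  assumes P: "P \<in> ops B" "omul B P P = oid B" and G: "G \<subseteq> ops B" and g: "g \<in> ops B"
    and odd: "\<And>h. h \<in> G \<Longrightarrow> omul B P h = osc (-1) (omul B h P)"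
    and anti: "\<And>h. h \<in> G \<Longrightarrow> omul B g h = osc (-1) (omul B h g)"
    and "A \<in> gen_alg B G"
  shows "omul B g A = omul B (omul B (omul B P A) P) g"
  using \<open>A \<in> gen_alg B G\<close>
proof induction
  case one
  then show ?case using P g by simp
next
  case (gen h)
  then have "h \<in> ops B" using G by auto
  then show ?case
    using odd[OF gen] anti[OF gen] P(2) by (simp add: omul_osc omul_assoc)
next
  case (add A C)
  then show ?case by (simp add: omul_oadd_left omul_oadd_right)
next
  case (mul A C)
  have ops: "A \<in> ops B" "C \<in> ops B" using mul gen_alg_ops[OF G] by auto
  have "omul B (omul B (omul B P A) P) (omul B (omul B P C) P)
      = omul B (omul B P A) (omul B (omul B P P) (omul B C P))"
    by (simp only: omul_assoc)
  also have "\<dots> = omul B (omul B P (omul B A C)) P"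
    unfolding P(2) using ops P by (simp add: omul_assoc)
  finally have PP: "omul B (omul B (omul B P A) P) (omul B (omul B P C) P) = omul B (omul B P (omul B A C)) P" .
  have "omul B g (omul B A C) = omul B (omul B (omul B P A) P) (omul B g C)"
    unfolding omul_assoc[symmetric] mul.IH(1) by simp
  also have "\<dots> = omul B (omul B (omul B (omul B P A) P) (omul B (omul B P C) P)) g"
    unfolding mul.IH(2) by (simp only: omul_assoc)
  finally show ?case unfolding PP .
next
  case (smul A c)
  then show ?case by (simp add: omul_osc)
qed

lemma commute_gen_alg:
  assumes "A \<in> ops B" "\<And>g. g \<in> G \<Longrightarrow> omul B g A = omul B A g" "C \<in> gen_alg B G"
  shows "omul B C A = omul B A C"
  using assms(3)
proof induction
  case (mul C D)
  then show ?case by (metis omul_assoc)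
qed (use assms in \<open>auto simp: omul_oadd_left omul_oadd_right omul_osc\<close>)

text \<open>Conjugation by \<open>P\<close> fixes the even element \<open>A\<close>, so no sign
  remains when an odd generator is moved past it; commuting with the generators extends to the
  algebra they generate.\<close>

lemma even_commute:
  assumes P: "P \<in> ops B" "omul B P P = oid B" and G: "G \<subseteq> ops B" "G' \<subseteq> ops B"
    and odd: "\<And>h. h \<in> G \<Longrightarrow> omul B P h = osc (-1) (omul B h P)"
    and anti: "\<And>g h. g \<in> G' \<Longrightarrow> h \<in> G \<Longrightarrow> omul B g h = osc (-1) (omul B h g)"
    and A: "A \<in> gen_alg B G" "omul B A P = omul B P A" and C: "C \<in> gen_alg B G'"
  shows "omul B A C = omul B C A"
proof (rule commute_gen_alg[symmetric, OF gen_alg_ops[OF G(1) A(1)] _ C])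
  fix g assume g: "g \<in> G'"
  have "omul B (omul B P A) P = A"
    using P gen_alg_ops[OF G(1) A(1)] A(2) by (metis omul_assoc omul_oid(1))
  then show "omul B g A = omul B A g"
    using graded_commute[OF P G(1) _ odd anti[OF g] A(1)] g G(2) by auto
qed

end

definition fermi_gens :: "nat \<Rightarrow> nat \<Rightarrow> nat \<Rightarrow> int list set \<Rightarrow> op set" where
  "fermi_gens d n L X = (\<Union>m\<in>{(x, s). x \<in> X \<inter> lattice d L \<and> s < n}. {annih d n L m, oadj (annih d n L m)})"

lemma fermi_alg_iff:
  "A \<in> fermi_alg d n L X \<longleftrightarrow> A \<in> gen_alg (fermi_basis d n L) (fermi_gens d n L X) \<and>
     omul (fermi_basis d n L) A (parity d n L) = omul (fermi_basis d n L) (parity d n L) A"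
  by (simp add: fermi_alg_def fermi_gens_def)

lemma fermi_gensE:
  assumes "g \<in> fermi_gens d n L X"
  obtains m where "m \<in> modes d n L" "fst m \<in> X" "g = annih d n L m \<or> g = oadj (annih d n L m)"
  using assms by (auto simp: fermi_gens_def modes_def)

lemma fermi_gens_ops: "fermi_gens d n L X \<subseteq> ops (fermi_basis d n L)"
  using annih_in_ops by (auto elim!: fermi_gensE)

lemma fin_basis_fermi: "fin_basis (fermi_basis d n L)"
  by unfold_locales (rule finite_fermi_basis)

lemma parity_props:
  shows parity_ops: "parity d n L \<in> ops (fermi_basis d n L)"
    and parity_parity: "omul (fermi_basis d n L) (parity d n L) (parity d n L) = oid (fermi_basis d n L)"
    and oadj_parity: "oadj (parity d n L) = parity d n L"
proof -
  let ?B = "fermi_basis d n L"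
  show "parity d n L \<in> ops ?B" by (auto simp: ops_def parity_def)
  show "oadj (parity d n L) = parity d n L" by (auto simp: oadj_def parity_def intro!: ext)
  show "omul ?B (parity d n L) (parity d n L) = oid ?B"
  proof (intro ext)
    fix i j
    show "omul ?B (parity d n L) (parity d n L) i j = oid ?B i j"
    proof (cases "i \<in> ?B")
      case True
      have "omul ?B (parity d n L) (parity d n L) i j = parity d n L i i * parity d n L i j"
        unfolding omul_def by (rule sum_single) (auto simp: finite_fermi_basis True parity_def)
      then show ?thesis using True by (auto simp: parity_def oid_def simp flip: power_mult_distrib)
    qed (simp add: omul_def parity_def oid_def)
  qed
qed

lemma omul_parity_left: "i \<in> fermi_basis d n L \<Longrightarrow>
    omul (fermi_basis d n L) (parity d n L) A i j = (-1) ^ (\<Sum>m\<in>modes d n L. i m) * A i j"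
  unfolding omul_def by (subst sum_single[of _ i]) (auto simp: finite_fermi_basis parity_def)

lemma omul_parity_right: "j \<in> fermi_basis d n L \<Longrightarrow>
    omul (fermi_basis d n L) A (parity d n L) i j = A i j * (-1) ^ (\<Sum>m\<in>modes d n L. j m)"
  unfolding omul_def by (subst sum_single[of _ j]) (auto simp: finite_fermi_basis parity_def)

text \<open>The particle number drops by one, which reverses the parity sign.\<close>

lemma annih_odd:
  assumes m: "m \<in> modes d n L"
  shows "omul (fermi_basis d n L) (parity d n L) (annih d n L m)
    = osc (-1) (omul (fermi_basis d n L) (annih d n L m) (parity d n L))"
proof (intro ext)
  fix i j
  let ?B = "fermi_basis d n L"
  show "omul ?B (parity d n L) (annih d n L m) i j = osc (-1) (omul ?B (annih d n L m) (parity d n L)) i j"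
  proof (cases "j \<in> ?B \<and> i \<in> ?B")
    case False
    then show ?thesis
      using annih_in_ops[of d n L m] parity_ops[of d n L] by (auto simp: omul_def osc_def ops_def)
  next
    case True
    show ?thesis
    proof (cases "j m = 1 \<and> i = j(m := 0)")
      case False
      then have "annih d n L m i j = 0" by (auto simp: annih_jw)
      then show ?thesis using True by (simp add: osc_def omul_parity_left omul_parity_right)
    next
      case i: True
      have "(\<Sum>k\<in>modes d n L. j k) = 1 + (\<Sum>k\<in>modes d n L. i k)"
      proof -
        have "(\<Sum>k\<in>modes d n L - {m}. j k) = (\<Sum>k\<in>modes d n L - {m}. i k)"
          by (rule sum.cong) (use i in auto)
        then show ?thesis using i by (simp add: sum.remove[OF finite_modes m])
      qed
      then show ?thesis using True by (simp add: osc_def omul_parity_left omul_parity_right)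
    qed
  qed
qed

lemma fermi_gens_odd:
  assumes "h \<in> fermi_gens d n L X"
  shows "omul (fermi_basis d n L) (parity d n L) h
    = osc (-1) (omul (fermi_basis d n L) h (parity d n L))"
proof -
  interpret fin_basis "fermi_basis d n L" by (rule fin_basis_fermi)
  obtain m where m: "m \<in> modes d n L" "h = annih d n L m \<or> h = oadj (annih d n L m)"
    using assms by (rule fermi_gensE)
  have neg: "osc (-1) (osc (-1) A) = A" for A by (simp add: osc_def)
  have "omul (fermi_basis d n L) (oadj (annih d n L m)) (parity d n L)
      = osc (-1) (omul (fermi_basis d n L) (parity d n L) (oadj (annih d n L m)))"
    using arg_cong[OF annih_odd[OF m(1)], of oadj] unfolding oadj_simps oadj_parity by simp
  then show ?thesis using m(2) annih_odd[OF m(1)] by (auto simp: neg)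
qed

text \<open>The pairs not covered directly follow by taking adjoints or by exchanging the two
  modes.\<close>

lemma fermi_gens_anticommute:
  assumes "g \<in> fermi_gens d n L X" "h \<in> fermi_gens d n L Y" "X \<inter> Y = {}"
  shows "omul (fermi_basis d n L) g h = osc (-1) (omul (fermi_basis d n L) h g)"
proof -
  interpret fin_basis "fermi_basis d n L" by (rule fin_basis_fermi)
  obtain m where m: "m \<in> modes d n L" "fst m \<in> X" "g = annih d n L m \<or> g = oadj (annih d n L m)"
    using assms(1) by (rule fermi_gensE)
  obtain m' where m': "m' \<in> modes d n L" "fst m' \<in> Y" "h = annih d n L m' \<or> h = oadj (annih d n L m')"
    using assms(2) by (rule fermi_gensE)
  have ne: "m \<noteq> m'" "m' \<noteq> m" using m m' assms(3) by auto
  have neg: "osc (-1) (osc (-1) A) = A" for A by (simp add: osc_def)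
  have "omul (fermi_basis d n L) (oadj (annih d n L m)) (oadj (annih d n L m'))
      = osc (-1) (omul (fermi_basis d n L) (oadj (annih d n L m')) (oadj (annih d n L m)))"
    using arg_cong[OF annih_annih_anticommute[OF ne(2) m'(1) m(1)], of oadj]
    unfolding oadj_simps by simp
  then show ?thesis
    using m(3) m'(3) annih_annih_anticommute[OF ne(1) m(1) m'(1)]
      annih_creat_anticommute[OF ne(1) m(1) m'(1)] annih_creat_anticommute[OF ne(2) m'(1) m(1)]
    by (elim disjE) (simp_all add: oadj_simps neg)
qed

lemma fermi_alg_mono: "X \<subseteq> Y \<Longrightarrow> fermi_alg d n L X \<subseteq> fermi_alg d n L Y"
proof -
  assume "X \<subseteq> Y"
  then have "fermi_gens d n L X \<subseteq> fermi_gens d n L Y" by (auto simp: fermi_gens_def)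
  from gen_alg_mono[OF this, of "fermi_basis d n L"] show ?thesis by (auto simp: fermi_alg_iff)
qed

lemma fermi_alg_oadj:
  assumes "A \<in> fermi_alg d n L X"
  shows "oadj A \<in> fermi_alg d n L X"
proof -
  interpret fin_basis "fermi_basis d n L" by (rule fin_basis_fermi)
  have "oadj g \<in> fermi_gens d n L X" if "g \<in> fermi_gens d n L X" for g
    using that by (force simp: fermi_gens_def)
  then have "oadj A \<in> gen_alg (fermi_basis d n L) (fermi_gens d n L X)"
    using assms gen_alg_oadj[of "fermi_gens d n L X" A] by (simp add: fermi_alg_iff)
  moreover have "oadj (omul (fermi_basis d n L) A (parity d n L))
      = oadj (omul (fermi_basis d n L) (parity d n L) A)"
    using assms by (simp add: fermi_alg_iff)
  ultimately show ?thesis by (simp add: fermi_alg_iff oadj_simps oadj_parity)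
qed

lemma oalgebra_fermi_alg: "oalgebra (fermi_basis d n L) (fermi_alg d n L X)"
proof -
  interpret fin_basis "fermi_basis d n L" by (rule fin_basis_fermi)
  let ?B = "fermi_basis d n L"
  have "fermi_alg d n L X \<subseteq> ops ?B"
    using gen_alg_ops[OF fermi_gens_ops] by (auto simp: fermi_alg_iff)
  moreover have "oid ?B \<in> fermi_alg d n L X"
    by (simp add: fermi_alg_iff gen_alg.one parity_ops)
  moreover have "osc c A \<in> fermi_alg d n L X" if "A \<in> fermi_alg d n L X" for A c
    using that by (simp add: fermi_alg_iff gen_alg.smul omul_osc)
  moreover have "oadd A C \<in> fermi_alg d n L X" if "A \<in> fermi_alg d n L X" "C \<in> fermi_alg d n L X" for A C
    using that by (simp add: fermi_alg_iff gen_alg.add omul_oadd_left omul_oadd_right)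
  moreover have "omul ?B A C \<in> fermi_alg d n L X" if "A \<in> fermi_alg d n L X" "C \<in> fermi_alg d n L X" for A C
  proof -
    have "omul ?B (omul ?B A C) (parity d n L) = omul ?B A (omul ?B (parity d n L) C)"
      using that by (simp add: fermi_alg_iff omul_assoc)
    also have "\<dots> = omul ?B (parity d n L) (omul ?B A C)"
      using that unfolding fermi_alg_iff by (metis omul_assoc)
    finally show ?thesis using that by (simp add: fermi_alg_iff gen_alg.mul)
  qed
  ultimately show ?thesis by (auto simp: oalgebra_def)
qed

lemma fermi_alg_commute:
  assumes "A \<in> fermi_alg d n L X" "C \<in> fermi_alg d n L Y" "X \<inter> Y = {}"
  shows "omul (fermi_basis d n L) A C = omul (fermi_basis d n L) C A"
proof -
  interpret fin_basis "fermi_basis d n L" by (rule fin_basis_fermi)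
  have YX: "Y \<inter> X = {}" using assms(3) by auto
  show ?thesis
    by (rule even_commute[OF parity_ops parity_parity fermi_gens_ops fermi_gens_ops
          fermi_gens_odd fermi_gens_anticommute[OF _ _ YX]])
      (use assms in \<open>auto simp: fermi_alg_iff\<close>)
qed

section \<open>Lattice geometry and rapid decay\<close>

text \<open>Together with \<open>cdist_witness\<close> this identifies \<open>cdist\<close> as the
  minimum of |a - b - kL| over integers k, the form in which the triangle inequality becomes linear
  arithmetic.\<close>

lemma cdist_le: "L > 0 \<Longrightarrow> cdist L a b \<le> \<bar>a - b - k * int L\<bar>"
proof -
  assume L: "L > 0"
  define x where "x = a - b - k * int L"
  have "(a - b) mod int L = x mod int L" "(b - a) mod int L = (- x) mod int L"
    using mod_mult_self1[of x k "int L"] mod_mult_self1[of "- x" "- k" "int L"]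
    by (simp_all add: x_def algebra_simps)
  moreover have "x mod int L \<le> x" if "0 \<le> x" using that L by (intro zmod_le_nonneg_dividend) auto
  moreover have "(- x) mod int L \<le> - x" if "x \<le> 0" using that L by (intro zmod_le_nonneg_dividend) auto
  ultimately show ?thesis unfolding cdist_def x_def[symmetric] by (cases "0 \<le> x") auto
qed

lemma cdist_witness: "\<exists>k. cdist L a b = \<bar>a - b - k * int L\<bar>" if "L > 0"
proof (cases "(a - b) mod int L \<le> (b - a) mod int L")
  case True
  then have "cdist L a b = a - b - ((a - b) div int L) * int L"
    by (simp add: cdist_def minus_div_mult_eq_mod)
  moreover have "0 \<le> cdist L a b" using that by (simp add: cdist_def)
  ultimately show ?thesis by (metis abs_of_nonneg)
next
  case False
  then have "cdist L a b = - (a - b - (- ((b - a) div int L)) * int L)"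
    using minus_div_mult_eq_mod[of "b - a" "int L"] by (simp add: cdist_def algebra_simps)
  moreover have "0 \<le> cdist L a b" using that by (simp add: cdist_def)
  ultimately show ?thesis by (metis abs_of_nonneg abs_minus_cancel)
qed

lemma cdist_triangle:
  assumes "L > 0"
  shows "cdist L a c \<le> cdist L a b + cdist L b c"
proof -
  obtain k l where "cdist L a b = \<bar>a - b - k * int L\<bar>" "cdist L b c = \<bar>b - c - l * int L\<bar>"
    using cdist_witness[OF assms] by metis
  moreover have "a - c - (k + l) * int L = (a - b - k * int L) + (b - c - l * int L)"
    by (simp add: algebra_simps)
  ultimately show ?thesis
    using cdist_le[OF assms, of a c "k + l"] by linarith
qed

lemma cdist_commute: "cdist L a b = cdist L b a"
  by (simp add: cdist_def min.commute)

lemma cdist_nonneg: "L > 0 \<Longrightarrow> 0 \<le> cdist L a b"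
  by (simp add: cdist_def)

lemma cdist_half: "even L \<Longrightarrow> L > 0 \<Longrightarrow> cdist L 0 (half L) = half L"
proof -
  assume "even L" "L > 0"
  then obtain h where h: "L = 2 * h" "h > 0" by auto
  have "(- int h) mod (2 * int h) = int h"
    using h mod_add_self2[of "- int h" "2 * int h"] by simp
  then show ?thesis using h by (simp add: cdist_def half_def)
qed

lemma nbhd_cdist:
  assumes "x \<in> nbhd d L X r" "d \<ge> 1" "L > 0"
  shows "\<exists>y\<in>X. real_of_int (cdist L (x ! 0) (y ! 0)) \<le> r"
proof -
  obtain y where y: "y \<in> X" "real_of_int (ldist L x y) \<le> r" and x: "x \<in> lattice d L"
    using assms(1) by (auto simp: nbhd_def)
  have "cdist L (x ! 0) (y ! 0) \<le> ldist L x y"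
    unfolding ldist_def using x assms(2)
    by (intro member_le_sum) (auto simp: lattice_def cdist_nonneg[OF assms(3)])
  then have "real_of_int (cdist L (x ! 0) (y ! 0)) \<le> r" using y(2) by linarith
  then show ?thesis using y(1) by blast
qed

text \<open>The centres are L/2 apart and each strip has half-width L/8, so L/4 remains.\<close>

lemma S_minus_S_plus_far:
  assumes "even L" "L > 0" "x \<in> S_minus d L" "y \<in> S_plus d L"
  shows "real L / 4 \<le> real_of_int (cdist L (x ! 0) (y ! 0))"
proof -
  have "half L \<le> cdist L 0 (x ! 0) + (cdist L (x ! 0) (y ! 0) + cdist L (y ! 0) (half L))"
    using cdist_triangle[OF assms(2), of 0 "half L" "x ! 0"]
      cdist_triangle[OF assms(2), of "x ! 0" "half L" "y ! 0"] cdist_half[OF assms(1,2)] by linarith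
  moreover have "real_of_int (half L) = real L / 2"
    using assms(1) by (auto simp: half_def elim!: evenE)
  moreover have "real_of_int (cdist L 0 (x ! 0)) \<le> real L / 8"
    "real_of_int (cdist L (y ! 0) (half L)) \<le> real L / 8"
    using assms(3,4) by (auto simp: S_minus_def S_plus_def cdist_commute)
  ultimately show ?thesis by linarith
qed

lemma S_minus_S_plus_disjoint: "even L \<Longrightarrow> L > 0 \<Longrightarrow> S_minus d L \<inter> S_plus d L = {}"
  using S_minus_S_plus_far[of L _ d] by (fastforce simp: cdist_def)

lemma d1_S_minus_S_plus:
  assumes "even L" "L > 0" "d \<ge> 1"
  shows "real L / 4 \<le> real (d1 L (S_minus d L) (S_plus d L))"
proof -
  let ?D = "{nat (cdist L (x ! 0) (y ! 0)) | x y. x \<in> S_minus d L \<and> y \<in> S_plus d L}"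
  have h: "half L \<ge> 1" using assms by (auto simp: half_def elim!: evenE)
  \<comment> \<open>An infimum of naturals is attained only on a nonempty set, so each strip needs
    an explicit point.\<close>
  have z: "replicate d 0 \<in> S_minus d L" "replicate d (half L) \<in> S_plus d L"
    using assms h by (auto simp: S_minus_def S_plus_def lattice_def cdist_def)
  then have "?D \<noteq> {}" by blast
  then have "d1 L (S_minus d L) (S_plus d L) \<in> ?D"
    unfolding d1_def by (rule Inf_nat_def1)
  then obtain x y where "d1 L (S_minus d L) (S_plus d L) = nat (cdist L (x ! 0) (y ! 0))"
    "x \<in> S_minus d L" "y \<in> S_plus d L" by blast
  then show ?thesis using S_minus_S_plus_far[OF assms(1,2), of x d y] by simp
qed

lemma nbhd_bdry_minus:
  assumes "d \<ge> 1" "L > 0" "0 \<le> r" "r \<le> real L / 16"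
  shows "nbhd d L (nbhd d L (bdry_minus d L) (real L / 16)) r \<subseteq> S_minus d L"
    and "nbhd d L (bdry_minus d L) (real L / 16) \<subseteq> S_minus d L"
proof -
  have 1: "real_of_int (cdist L (x ! 0) 0) \<le> real L / 16" if "x \<in> nbhd d L (bdry_minus d L) (real L / 16)" for x
    using nbhd_cdist[OF that assms(1,2)] by (auto simp: bdry_minus_def)
  then show "nbhd d L (bdry_minus d L) (real L / 16) \<subseteq> S_minus d L"
    by (fastforce simp: S_minus_def nbhd_def)
  show "nbhd d L (nbhd d L (bdry_minus d L) (real L / 16)) r \<subseteq> S_minus d L"
  proof
    fix x assume x: "x \<in> nbhd d L (nbhd d L (bdry_minus d L) (real L / 16)) r"
    then obtain y where "y \<in> nbhd d L (bdry_minus d L) (real L / 16)" "real_of_int (cdist L (x ! 0) (y ! 0)) \<le> r"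
      using nbhd_cdist[OF x assms(1,2)] by blast
    then have "real_of_int (cdist L (x ! 0) 0) \<le> real L / 8"
      using cdist_triangle[OF assms(2), of "x ! 0" 0 "y ! 0"] 1[of y] assms(4) by linarith
    then show "x \<in> S_minus d L" using x by (simp add: S_minus_def nbhd_def)
  qed
qed

text \<open>The upper boundary lies one site off the centre of \<open>S_plus\<close>. The resulting
  L/16 + 1 + L/32 fits into L/8 exactly when L is at least 32, which is the origin of this
  threshold.\<close>

lemma nbhd_bdry_plus:
  assumes "d \<ge> 1" "L \<ge> 32" "0 \<le> r" "r \<le> real L / 32"
  shows "nbhd d L (nbhd d L (bdry_plus d L) (real L / 16)) r \<subseteq> S_plus d L"
    and "nbhd d L (bdry_plus d L) (real L / 16) \<subseteq> S_plus d L"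
proof -
  have L: "L > 0" using assms(2) by simp
  have c: "cdist L (half L - 1) (half L) \<le> 1" using cdist_le[OF L, of "half L - 1" "half L" 0] by simp
  have 1: "real_of_int (cdist L (x ! 0) (half L)) \<le> real L / 16 + 1" if "x \<in> nbhd d L (bdry_plus d L) (real L / 16)" for x
  proof -
    have "real_of_int (cdist L (x ! 0) (half L - 1)) \<le> real L / 16"
      using nbhd_cdist[OF that assms(1) L] by (auto simp: bdry_plus_def)
    then show ?thesis using cdist_triangle[OF L, of "x ! 0" "half L" "half L - 1"] c by linarith
  qed
  show "nbhd d L (bdry_plus d L) (real L / 16) \<subseteq> S_plus d L"
  proof
    fix x assume x: "x \<in> nbhd d L (bdry_plus d L) (real L / 16)"
    then show "x \<in> S_plus d L" using 1[OF x] assms(2) by (simp add: S_plus_def nbhd_def)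
  qed
  show "nbhd d L (nbhd d L (bdry_plus d L) (real L / 16)) r \<subseteq> S_plus d L"
  proof
    fix x assume x: "x \<in> nbhd d L (nbhd d L (bdry_plus d L) (real L / 16)) r"
    then obtain y where "y \<in> nbhd d L (bdry_plus d L) (real L / 16)" "real_of_int (cdist L (x ! 0) (y ! 0)) \<le> r"
      using nbhd_cdist[OF x assms(1) L] by blast
    then have "real_of_int (cdist L (x ! 0) (half L)) \<le> real L / 8"
      using cdist_triangle[OF L, of "x ! 0" "half L" "y ! 0"] 1[of y] assms(2,4) by linarith
    then show "x \<in> S_plus d L" using x by (simp add: S_plus_def nbhd_def)
  qed
qed

section \<open>Rapidly decaying sequences\<close>

lemma rapidD: "rapid f \<Longrightarrow> \<exists>C. \<forall>L. even L \<and> L > 0 \<longrightarrow> \<bar>f L\<bar> \<le> C / real L ^ k"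
  by (simp add: rapid_def)

text \<open>The finitely many sizes below \<open>L0\<close> only enlarge the constant, by the sum
  \<open>?M\<close>.\<close>

lemma rapid_eventually_le:
  assumes "rapid g" "\<And>L. even L \<Longrightarrow> L \<ge> L0 \<Longrightarrow> \<bar>f L\<bar> \<le> \<bar>g L\<bar>"
  shows "rapid f"
  unfolding rapid_def
proof
  fix k
  obtain C where C: "\<And>L. even L \<Longrightarrow> L > 0 \<Longrightarrow> \<bar>g L\<bar> \<le> C / real L ^ k" using rapidD[OF assms(1)] by metis
  let ?M = "\<Sum>L<L0. \<bar>f L\<bar> * real L ^ k"
  have "\<bar>f L\<bar> \<le> (\<bar>C\<bar> + ?M) / real L ^ k" if "even L" "L > 0" for L
  proof (cases "L < L0")
    case True
    have "\<bar>f L\<bar> * real L ^ k \<le> ?M" using True by (intro member_le_sum) auto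
    then have "\<bar>f L\<bar> * real L ^ k \<le> \<bar>C\<bar> + ?M" by linarith
    then show ?thesis using that by (simp add: pos_le_divide_eq)
  next
    case False
    have "\<bar>f L\<bar> \<le> C / real L ^ k" using assms(2)[of L] C[OF that] False that by force
    also have "\<dots> \<le> (\<bar>C\<bar> + ?M) / real L ^ k"
    proof (rule divide_right_mono)
      have "0 \<le> ?M" by (intro sum_nonneg) auto
      then show "C \<le> \<bar>C\<bar> + ?M" by linarith
    qed simp
    finally show ?thesis .
  qed
  then show "\<exists>C. \<forall>L. even L \<and> 0 < L \<longrightarrow> \<bar>f L\<bar> \<le> C / real L ^ k" by blast
qed

lemma rapid_add: "rapid f \<Longrightarrow> rapid g \<Longrightarrow> rapid (\<lambda>L. f L + g L)"
  unfolding rapid_def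
proof
  fix k
  assume f: "\<forall>k. \<exists>C. \<forall>L. even L \<and> 0 < L \<longrightarrow> \<bar>f L\<bar> \<le> C / real L ^ k"
    and g: "\<forall>k. \<exists>C. \<forall>L. even L \<and> 0 < L \<longrightarrow> \<bar>g L\<bar> \<le> C / real L ^ k"
  obtain C where C: "\<And>L. even L \<Longrightarrow> 0 < L \<Longrightarrow> \<bar>f L\<bar> \<le> C / real L ^ k" using f by meson
  obtain D where D: "\<And>L. even L \<Longrightarrow> 0 < L \<Longrightarrow> \<bar>g L\<bar> \<le> D / real L ^ k" using g by meson
  have "\<bar>f L + g L\<bar> \<le> (C + D) / real L ^ k" if "even L" "0 < L" for L
    using C[OF that] D[OF that] abs_triangle_ineq[of "f L" "g L"] by (simp add: add_divide_distrib)
  then show "\<exists>C. \<forall>L. even L \<and> 0 < L \<longrightarrow> \<bar>f L + g L\<bar> \<le> C / real L ^ k" by blast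
qed

text \<open>Volume factors are paid for by requesting a decay exponent larger by their degree
  \<open>p\<close>.\<close>

lemma rapid_mult_poly:
  assumes "rapid f" "\<And>L. even L \<Longrightarrow> L > 0 \<Longrightarrow> \<bar>g L\<bar> \<le> c * real L ^ p"
  shows "rapid (\<lambda>L. g L * f L)"
  unfolding rapid_def
proof
  fix k
  obtain C where C: "\<And>L. even L \<Longrightarrow> L > 0 \<Longrightarrow> \<bar>f L\<bar> \<le> C / real L ^ (p + k)" using rapidD[OF assms(1)] by metis
  have "\<bar>g L * f L\<bar> \<le> (c * C) / real L ^ k" if "even L" "L > 0" for L
  proof -
    have "\<bar>g L * f L\<bar> \<le> (c * real L ^ p) * (C / real L ^ (p + k))"
      unfolding abs_mult using assms(2)[OF that] C[OF that]
      by (intro mult_mono) (auto intro: order_trans[OF abs_ge_zero])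
    also have "\<dots> = (c * C) / real L ^ k" using that by (simp add: power_add)
    finally show ?thesis .
  qed
  then show "\<exists>C. \<forall>L. even L \<and> 0 < L \<longrightarrow> \<bar>g L * f L\<bar> \<le> C / real L ^ k" by blast
qed

lemma rapid_sqrt: "rapid f \<Longrightarrow> rapid (\<lambda>L. sqrt (f L))"
  unfolding rapid_def
proof
  fix k
  assume f: "\<forall>k. \<exists>C. \<forall>L. even L \<and> 0 < L \<longrightarrow> \<bar>f L\<bar> \<le> C / real L ^ k"
  obtain C where C: "\<And>L. even L \<Longrightarrow> 0 < L \<Longrightarrow> \<bar>f L\<bar> \<le> C / real L ^ (2 * k)" using f by meson
  have "\<bar>sqrt (f L)\<bar> \<le> sqrt C / real L ^ k" if "even L" "0 < L" for L
  proof -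
    \<comment> \<open>The real square root is an odd function, so negative values of
      \<open>f\<close> cause no exception.\<close>
    have "\<bar>sqrt (f L)\<bar> = sqrt \<bar>f L\<bar>" by (simp add: real_sqrt_abs2 abs_if real_sqrt_minus)
    also have "\<dots> \<le> sqrt (C / (real L ^ k)\<^sup>2)"
      using C[OF that] by (intro real_sqrt_le_mono) (simp add: power_even_eq)
    also have "\<dots> = sqrt C / real L ^ k" by (simp add: real_sqrt_divide)
    finally show ?thesis .
  qed
  then show "\<exists>C. \<forall>L. even L \<and> 0 < L \<longrightarrow> \<bar>sqrt (f L)\<bar> \<le> C / real L ^ k" by blast
qed

lemma rapid_exp:
  assumes "c > 0"
  shows "rapid (\<lambda>L. exp (- c * real L))"
  unfolding rapid_def
proof
  fix k
  \<comment> \<open>The bound comes from exp(x) = exp(x/K)^K, at least (x/K)^K. Taking K = k + 1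
    keeps the division legitimate for k = 0; the surplus power of L is dropped.\<close>
  let ?K = "real (Suc k)"
  have "\<bar>exp (- c * real L)\<bar> \<le> (?K / c) ^ Suc k / real L ^ k" if "L > 0" for L
  proof -
    have "(c * real L / ?K) ^ Suc k \<le> exp (c * real L / ?K) ^ Suc k"
      using assms by (intro power_mono order_trans[OF _ exp_ge_add_one_self]) auto
    also have "\<dots> = exp (c * real L)"
      using exp_of_nat_mult[of "Suc k" "c * real L / ?K"] by (simp del: of_nat_Suc power_Suc)
    finally have 1: "(c * real L / ?K) ^ Suc k \<le> exp (c * real L)" .
    have pos: "0 < (c * real L / ?K) ^ Suc k" using assms that by (intro zero_less_power) simp
    have "exp (- c * real L) = inverse (exp (c * real L))" by (simp add: exp_minus)
    also have "\<dots> \<le> inverse ((c * real L / ?K) ^ Suc k)"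
      by (rule le_imp_inverse_le[OF 1 pos])
    also have "\<dots> = (?K / c) ^ Suc k / real L ^ Suc k"
      by (simp only: power_mult_distrib power_divide inverse_eq_divide) (simp add: field_simps)
    also have "\<dots> \<le> (?K / c) ^ Suc k / real L ^ k"
      using assms that by (intro divide_left_mono) (auto intro!: power_increasing zero_le_power)
    finally show ?thesis by simp
  qed
  then show "\<exists>C. \<forall>L. even L \<and> 0 < L \<longrightarrow> \<bar>exp (- c * real L)\<bar> \<le> C / real L ^ k" by blast
qed

lemma card_lattice_poly: "L > 0 \<Longrightarrow> real (card (lattice d L)) \<le> 2 ^ d * real L ^ d"
proof -
  assume "L > 0"
  then have "real (L + 1) ^ d \<le> (2 * real L) ^ d" by (intro power_mono) auto
  moreover have "real (card (lattice d L)) \<le> real ((L + 1) ^ d)"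
    using card_lattice_le by (rule of_nat_mono)
  ultimately show ?thesis unfolding of_nat_power power_mult_distrib by (rule order_trans[rotated])
qed

text \<open>The approximants supplied for different decay exponents may differ; picking almost minimisers
  of the error gives one sequence that works for all of them.\<close>

lemma rapid_uniform_choice:
  fixes f :: "nat \<Rightarrow> 'a \<Rightarrow> real"
  assumes nonneg: "\<And>L R. 0 \<le> f L R"
    and ex: "\<And>k. \<exists>C. \<forall>L. even L \<and> L \<ge> L0 \<longrightarrow> (\<exists>R. P L R \<and> f L R \<le> C / real L ^ k)"
  shows "\<exists>R. (\<forall>L. even L \<and> L \<ge> L0 \<longrightarrow> P L (R L)) \<and> rapid (\<lambda>L. if L \<ge> L0 then f L (R L) else 0)"
proof -
  have "\<exists>R. P L R \<and> f L R \<le> Inf (f L ` {R. P L R}) + exp (- 1 * real L)" if "even L" "L \<ge> L0" for L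
  proof -
    have "f L ` {R. P L R} \<noteq> {}" using ex[of 0] that by blast
    moreover have "Inf (f L ` {R. P L R}) < Inf (f L ` {R. P L R}) + exp (- 1 * real L)" by simp
    ultimately have "\<exists>x\<in>f L ` {R. P L R}. x < Inf (f L ` {R. P L R}) + exp (- 1 * real L)"
      by (rule cInf_lessD)
    then show ?thesis by (blast intro: less_imp_le)
  qed
  note ex' = someI_ex[OF this]
  define R where "R L = (SOME R. P L R \<and> f L R \<le> Inf (f L ` {R. P L R}) + exp (- 1 * real L))" for L
  have R: "P L (R L)" "f L (R L) \<le> Inf (f L ` {R. P L R}) + exp (- 1 * real L)" if "even L" "L \<ge> L0" for L
    using ex'[OF that] unfolding R_def by blast+
  have "rapid (\<lambda>L. if even L \<and> L \<ge> L0 then Inf (f L ` {R. P L R}) else 0)" (is "rapid ?g")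
    unfolding rapid_def
  proof
    fix k
    obtain C where C: "\<And>L. even L \<Longrightarrow> L \<ge> L0 \<Longrightarrow> \<exists>R. P L R \<and> f L R \<le> C / real L ^ k"
      using ex[of k] by blast
    have "\<bar>?g L\<bar> \<le> \<bar>C\<bar> / real L ^ k" if L: "even L" "L > 0" for L
    proof (cases "L \<ge> L0")
      case True
      obtain R where "P L R" "f L R \<le> C / real L ^ k" using C[OF L(1) True] by blast
      then have "Inf (f L ` {R. P L R}) \<le> C / real L ^ k"
        using nonneg by (intro cInf_lower2[of "f L R"]) (auto intro!: bdd_belowI[of _ 0])
      moreover have "0 \<le> Inf (f L ` {R. P L R})"
        using nonneg \<open>P L R\<close> by (intro cInf_greatest) auto
      moreover have "C / real L ^ k \<le> \<bar>C\<bar> / real L ^ k" by (intro divide_right_mono) auto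
      ultimately show ?thesis using True L by simp
    qed simp
    then show "\<exists>C. \<forall>L. even L \<and> 0 < L \<longrightarrow> \<bar>?g L\<bar> \<le> C / real L ^ k" by blast
  qed
  then have "rapid (\<lambda>L. ?g L + exp (- 1 * real L))" by (intro rapid_add rapid_exp zero_less_one)
  then have "rapid (\<lambda>L. if L \<ge> L0 then f L (R L) else 0)"
  proof (rule rapid_eventually_le)
    fix L assume "even L" "L0 \<le> L"
    then show "\<bar>if L0 \<le> L then f L (R L) else 0\<bar> \<le> \<bar>?g L + exp (- 1 * real L)\<bar>"
      using R(2)[of L] nonneg[of L "R L"] by simp
  qed
  then show ?thesis using R(1) by (intro exI[of _ R]) simp
qed

text \<open>With r the offset from the nearest integer, |exp(2\<pi>it) - 1| = 2 |sin(\<pi>r)|, which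
  dominates |r|. The second bound serves the case of a large error.\<close>

lemma infdist_Ints_le:
  "infdist (complex_of_real t) \<int> \<le> cmod (cis (2 * pi * t) - 1)"
  "infdist (complex_of_real t) \<int> \<le> 1"
proof -
  define r where "r = t - of_int (round t)"
  have r: "\<bar>r\<bar> \<le> 1 / 2" using of_int_round_abs_le[of t] by (simp add: r_def abs_minus_commute)
  have "infdist (complex_of_real t) \<int> \<le> dist (complex_of_real t) (of_int (round t))"
    by (rule infdist_le) simp
  also have "\<dots> = \<bar>r\<bar>"
  proof -
    have "complex_of_real t - of_int (round t) = of_real r" by (simp add: r_def)
    then show ?thesis by (simp only: dist_norm norm_of_real)
  qed
  finally have d: "infdist (complex_of_real t) \<int> \<le> \<bar>r\<bar>" .
  then show "infdist (complex_of_real t) \<int> \<le> 1" using r by simp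
  define x where "x = pi * \<bar>r\<bar>"
  have "pi * \<bar>r\<bar> \<le> pi * (1 / 2)" by (intro mult_left_mono r) simp
  also have "\<dots> \<le> 8 / 5" using pi_approx by simp
  finally have "x \<le> 8 / 5" unfolding x_def .
  moreover have "0 \<le> x" by (simp add: x_def)
  ultimately have x: "0 \<le> x" "x \<le> 8 / 5" by auto
  have "cis (2 * pi * t) = cis (2 * pi * r)"
  proof -
    have "2 * pi * t = 2 * pi * r + 2 * pi * of_int (round t)" by (simp add: r_def algebra_simps)
    then show ?thesis by (simp add: cis_multiple_2pi flip: cis_mult)
  qed
  then have "(cmod (cis (2 * pi * t) - 1))\<^sup>2 = (cos (2 * pi * r) - 1)\<^sup>2 + (sin (2 * pi * r))\<^sup>2"
    by (simp add: cmod_power2)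
  also have "\<dots> = 2 - 2 * cos (2 * (pi * r))"
    using sin_cos_squared_add[of "2 * pi * r"] by (simp add: power2_diff mult.assoc)
  also have "\<dots> = (2 * sin (pi * r))\<^sup>2"
    by (simp add: cos_double_sin power_mult_distrib)
  also have "\<dots> = (2 * sin x)\<^sup>2" by (auto simp: x_def abs_if)
  finally have c: "(cmod (cis (2 * pi * t) - 1))\<^sup>2 = (2 * sin x)\<^sup>2" .
  have "\<bar>sin x - (\<Sum>m<3. sin_coeff m * x ^ m)\<bar> \<le> inverse (fact 3) * \<bar>x\<bar> ^ 3"
    by (rule Maclaurin_sin_bound)
  then have "\<bar>sin x - x\<bar> \<le> x ^ 3 / 6"
    using x by (simp add: eval_nat_numeral sin_coeff_def lessThan_Suc fact_numeral)
  then have "x - x ^ 3 / 6 \<le> sin x" by (simp only: abs_le_iff) simp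
  \<comment> \<open>On [0, 8/5] the cubic term is at most (64/150) x, less than x/2, so sin x is at
    least x/2; the cutoff 8/5 exceeds \<pi>/2.\<close>
  moreover have "x ^ 3 \<le> (64 / 25) * x"
    using mult_right_mono[OF mult_mono[OF x(2) x(2)] x(1)] x by (simp add: power3_eq_cube)
  ultimately have "x \<le> 2 * sin x" using x by linarith
  moreover have "\<bar>r\<bar> \<le> x" using mult_right_mono[of 1 pi "\<bar>r\<bar>"] pi_approx by (simp add: x_def)
  ultimately have "\<bar>r\<bar>\<^sup>2 \<le> (cmod (cis (2 * pi * t) - 1))\<^sup>2"
    unfolding c using x by (intro power_mono) auto
  then have "\<bar>r\<bar> \<le> cmod (cis (2 * pi * t) - 1)" by (rule power2_le_imp_le) simp
  then show "infdist (complex_of_real t) \<int> \<le> cmod (cis (2 * pi * t) - 1)" using d by simp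
qed

section \<open>Assembling the theorem\<close>

text \<open>The common interface of spins and fermions; beyond this point the two systems are not
  distinguished.\<close>

locale local_algebra = fin_basis +
  fixes Alg :: "int list set \<Rightarrow> op set"
  assumes alg: "oalgebra B (Alg X)"
    and alg_mono: "X \<subseteq> Y \<Longrightarrow> Alg X \<subseteq> Alg Y"
    and alg_commute: "A \<in> Alg X \<Longrightarrow> C \<in> Alg Y \<Longrightarrow> X \<inter> Y = {} \<Longrightarrow> omul B A C = omul B C A"
    and alg_oadj: "A \<in> Alg X \<Longrightarrow> oadj A \<in> Alg X"
begin

lemma alg_ops: "A \<in> Alg X \<Longrightarrow> A \<in> ops B"
  using alg[of X] by (auto simp: oalgebra_def)

lemma charge_sum_empty: "charge_sum Qx {} = osc 0 (oid B)"
  by (simp add: charge_sum_def osc_def)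

lemma charge_sum_insert:
  "finite Y \<Longrightarrow> x \<notin> Y \<Longrightarrow> charge_sum Qx (insert x Y) = oadd (Qx x) (charge_sum Qx Y)"
  by (simp add: charge_sum_def oadd_def)

lemma charge_sum_in_alg:
  assumes "finite Y" "\<And>x. x \<in> Y \<Longrightarrow> Qx x \<in> Alg {x}"
  shows "charge_sum Qx Y \<in> Alg Y"
proof -
  have "charge_sum Qx Z \<in> Alg Y" if "Z \<subseteq> Y" for Z
    using finite_subset[OF that assms(1)] that
  proof (induction Z rule: finite_induct)
    case empty
    then show ?case using alg[of Y] by (simp add: charge_sum_empty oalgebra_def)
  next
    case (insert x Z)
    then have "Qx x \<in> Alg Y" using assms(2)[of x] alg_mono[of "{x}" Y] by auto
    then show ?case using insert alg[of Y] by (simp add: charge_sum_insert oalgebra_def)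
  qed
  then show ?thesis by simp
qed

lemma charge_sum_self_adjoint:
  assumes "finite Y" "\<And>x. x \<in> Y \<Longrightarrow> self_adjoint B (Qx x)"
  shows "self_adjoint B (charge_sum Qx Y)"
  using assms
proof (induction Y rule: finite_induct)
  case empty
  then show ?case
    using self_adjoint_closed(4)[OF self_adjoint_closed(1), of 0] by (simp add: charge_sum_empty)
next
  case (insert x Y)
  then show ?case by (simp add: charge_sum_insert self_adjoint_closed)
qed

text \<open>Charges at distinct sites commute, so the exponentials multiply, and each is trivial;
  the spectrum of the sum is never computed.\<close>

lemma charge_sum_expi_2pi:
  assumes "finite Y" "\<And>x. x \<in> Y \<Longrightarrow> Qx x \<in> Alg {x} \<and> self_adjoint B (Qx x) \<and> spectrum B (Qx x) \<subseteq> \<int>"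
    and "v \<in> vecs B"
  shows "evol (charge_sum Qx Y) (2 * pi) v = v"
  using assms
proof (induction Y rule: finite_induct)
  case empty
  have "osc (complex_of_real 0) (oid B) = osc 0 (oid B)" by simp
  then show ?case
    using expi_scalar[OF empty(2), of 0 "2 * pi"] by (simp add: charge_sum_empty)
next
  case (insert x Y)
  have "evol (oadd (Qx x) (charge_sum Qx Y)) (2 * pi) v
      = evol (Qx x) (2 * pi) (evol (charge_sum Qx Y) (2 * pi) v)"
  proof (rule expi_oadd)
    show "self_adjoint B (Qx x)" using insert by auto
    show "self_adjoint B (charge_sum Qx Y)" using insert by (intro charge_sum_self_adjoint) auto
    have "charge_sum Qx Y \<in> Alg Y" using insert by (intro charge_sum_in_alg) auto
    then show "omul B (Qx x) (charge_sum Qx Y) = omul B (charge_sum Qx Y) (Qx x)"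
      using insert by (intro alg_commute[of _ "{x}" _ Y]) auto
  qed (rule insert.prems)
  also have "\<dots> = v"
    using insert expi_2pi_integer_spectrum[of "Qx x" v] by auto
  finally show ?case using insert by (simp add: charge_sum_insert)
qed

text \<open>Almost locality supplies approximants that need not be self-adjoint, whereas
  \<open>km\<close> and \<open>kp\<close> must generate unitary groups. Averaging with the adjoint
  repairs this without loss because the target is self-adjoint.\<close>

lemma symmetrize:
  assumes R: "R \<in> Alg X" and K: "self_adjoint B K" and b: "obounded B (osub K R) c" "0 \<le> c"
  defines "S \<equiv> osc (of_real (1 / 2)) (oadd R (oadj R))"
  shows "S \<in> Alg X" "self_adjoint B S" "obounded B (osub K S) c"
proof -
  have ops: "R \<in> ops B" "K \<in> ops B" using R K alg_ops by (auto simp: self_adjoint_ops)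
  show "S \<in> Alg X"
    unfolding S_def using alg[of X] R alg_oadj[OF R] by (simp add: oalgebra_def)
  have "self_adjoint B (oadd R (oadj R))"
    using ops by (simp add: self_adjoint_def oadj_simps) (simp add: oadd_def add.commute)
  then show "self_adjoint B S" unfolding S_def by (rule self_adjoint_closed(4))
  have Ka: "oadj K = K" using K by (simp add: self_adjoint_def)
  have "obounded B (oadj (osub K R)) c"
    by (rule obounded_oadj) (use ops b in auto)
  then have "obounded B (osc (of_real (1 / 2)) (oadd (osub K R) (oadj (osub K R))))
      (cmod (of_real (1 / 2)) * (c + c))"
    by (intro obounded_osc obounded_oadd b)
  moreover have "osc (of_real (1 / 2)) (oadd (osub K R) (oadj (osub K R))) = osub K S"
    unfolding oadj_simps Ka S_def by (simp add: osc_def oadd_def osub_def fun_eq_iff field_simps)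
  ultimately show "obounded B (osub K S) c" by simp
qed

end

lemma local_algebra_spin: "local_algebra (spin_basis d n L) (spin_alg d n L)"
  by (intro local_algebra.intro fin_basis.intro local_algebra_axioms.intro
      finite_spin_basis oalgebra_spin_alg spin_alg_mono spin_alg_commute spin_alg_oadj)

lemma local_algebra_fermi: "local_algebra (fermi_basis d n L) (fermi_alg d n L)"
  by (intro local_algebra.intro fin_basis.intro local_algebra_axioms.intro
      finite_fermi_basis oalgebra_fermi_alg fermi_alg_mono fermi_alg_commute fermi_alg_oadj)

lemma charge_sum_split:
  assumes "finite Y" "Z \<inter> W = {}"
  shows "charge_sum Q Y
    = oadd (oadd (charge_sum Q (Y \<inter> Z)) (charge_sum Q (Y - Z - W))) (charge_sum Q (Y \<inter> W))"
proof -
  have e: "Y = (Y \<inter> Z \<union> (Y - Z - W)) \<union> (Y \<inter> W)" by auto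
  have "sum f Y = sum f (Y \<inter> Z) + sum f (Y - Z - W) + sum f (Y \<inter> W)" for f :: "int list \<Rightarrow> complex"
  proof -
    have "sum f Y = sum f ((Y \<inter> Z \<union> (Y - Z - W)) \<union> (Y \<inter> W))" by (rule arg_cong[OF e])
    also have "\<dots> = sum f (Y \<inter> Z \<union> (Y - Z - W)) + sum f (Y \<inter> W)"
      by (rule sum.union_disjoint) (use assms in auto)
    also have "sum f (Y \<inter> Z \<union> (Y - Z - W)) = sum f (Y \<inter> Z) + sum f (Y - Z - W)"
      by (rule sum.union_disjoint) (use assms in auto)
    finally show ?thesis .
  qed
  then show ?thesis unfolding charge_sum_def oadd_def by (intro ext)
qed

lemma var_eq: "var B \<psi> A = (vnorm B (oapp B A \<psi> - vsc (inprod B \<psi> (oapp B A \<psi>)) \<psi>))\<^sup>2"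
proof -
  have "(\<lambda>i. oapp B A \<psi> i - inprod B \<psi> (oapp B A \<psi>) * \<psi> i)
      = oapp B A \<psi> - vsc (inprod B \<psi> (oapp B A \<psi>)) \<psi>"
    by (rule ext) simp
  then show ?thesis by (simp only: var_def)
qed

lemma (in local_algebra) infdist_expectation_le:
  fixes U Tm Tp Km Kp km kp :: op and \<psi> :: vec and Qx :: "int list \<Rightarrow> op" and \<epsilon> N :: real
    and Y M P :: "int list set"
  assumes charges: "finite Y" "\<And>x. x \<in> Y \<Longrightarrow> Qx x \<in> Alg {x} \<and> self_adjoint B (Qx x) \<and> spectrum B (Qx x) \<subseteq> \<int>"
    and U: "unitary B U" and psi: "\<psi> \<in> vecs B" "vnorm B \<psi> = 1" and disj: "M \<inter> P = {}"
    and inM: "Tm \<in> Alg M" "Km \<in> Alg M" "km \<in> Alg M" and inP: "Tp \<in> Alg P" "Kp \<in> Alg P" "kp \<in> Alg P"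
    and sa: "self_adjoint B Tm" "self_adjoint B Km" "self_adjoint B km"
      "self_adjoint B Tp" "self_adjoint B Kp" "self_adjoint B kp"
    and eT: "opnorm B (osub (osub (osub (oconj B U (charge_sum Qx Y))
        (charge_sum Qx Y)) Tm) Tp) \<le> \<epsilon>"
    and eU: "sqrt (var B \<psi> U) \<le> \<epsilon>" and eQ: "sqrt (var B \<psi> (osub (osub (charge_sum Qx Y) Km) Kp)) \<le> \<epsilon>"
    and eKm: "opnorm B (osub (oconj B U Km) km) \<le> \<epsilon>"
    and eKp: "opnorm B (osub (oconj B U Kp) kp) \<le> \<epsilon>"
    and eE: "opnorm B (osub (oexp B (osc (2 * of_real pi * \<i>) (oadd (charge_sum Qx Y) Tm))) (oid B)) \<le> \<epsilon>"
    and cl: "\<And>A C. A \<in> Alg M \<Longrightarrow> C \<in> Alg P \<Longrightarrow> opnorm B A \<le> 2 \<Longrightarrow> opnorm B C \<le> 2 \<Longrightarrow>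
      cmod (inprod B \<psi> (oapp B (omul B A C) \<psi>)
        - inprod B \<psi> (oapp B A \<psi>) * inprod B \<psi> (oapp B C \<psi>)) \<le> \<epsilon>"
    and N: "opnorm B Tm \<le> N" "opnorm B Km \<le> N"
  shows "infdist (inprod B \<psi> (oapp B Tm \<psi>)) \<int> \<le> 500 * (N + 1) * sqrt \<epsilon>"
proof -
  have N0: "0 \<le> N" using opnorm_nonneg[of Tm] N(1) by simp
  have e0: "0 \<le> \<epsilon>" using opnorm_nonneg eE order_trans by blast
  define t where "t = Re (inprod B \<psi> (oapp B Tm \<psi>))"
  have t: "inprod B \<psi> (oapp B Tm \<psi>) = of_real t"
    unfolding t_def by (rule inprod_self_adjoint_real[OF sa(1)])
  show ?thesis
  proof (cases "\<epsilon> \<le> 1")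
    \<comment> \<open>The claimed bound is then above 1, while any real number is within 1 of an
      integer.\<close>
    case False
    then have "1 * 1 \<le> (500 * (N + 1)) * sqrt \<epsilon>" using N0 by (intro mult_mono) auto
    then show ?thesis unfolding t using infdist_Ints_le(2)[of t] by linarith
  next
    case True
    let ?qm = "charge_sum Qx (Y \<inter> M)" and ?q0 = "charge_sum Qx (Y - M - P)" and ?qp = "charge_sum Qx (Y \<inter> P)"
    have bnd: "obounded B A c" if "opnorm B A \<le> c" for A c
      by (rule obounded_mono[OF obounded_opnorm that])
    have Q: "charge_sum Qx Y = oadd (oadd ?qm ?q0) ?qp"
      by (rule charge_sum_split[OF charges(1) disj])
    have fin: "finite (Y \<inter> M)" "finite (Y - M - P)" "finite (Y \<inter> P)" using charges(1) by auto
    have q_alg: "?qm \<in> Alg (Y \<inter> M)" "?q0 \<in> Alg (Y - M - P)" "?qp \<in> Alg (Y \<inter> P)"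
      by (rule charge_sum_in_alg; use fin charges(2) in blast)+
    have q_sa: "self_adjoint B ?qm" "self_adjoint B ?q0" "self_adjoint B ?qp"
      by (rule charge_sum_self_adjoint; use fin charges(2) in blast)+
    have q_int: "evol ?qm (2 * pi) v = v" "evol ?q0 (2 * pi) v = v"
      "evol ?qp (2 * pi) v = v" if "v \<in> vecs B" for v
      by (rule charge_sum_expi_2pi; use fin charges(2) that in blast)+
    have var: "vnorm B (oapp B A \<psi> - vsc (inprod B \<psi> (oapp B A \<psi>)) \<psi>) = sqrt (var B \<psi> A)" for A
      by (simp add: var_eq)
    have "osc (2 * of_real pi * \<i>) A = osc (\<i> * of_real (2 * pi)) A" for A
      by (simp add: mult.commute)
    then have E: "oexp B (osc (2 * of_real pi * \<i>) (oadd (charge_sum Qx Y) Tm))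
        = expi (oadd (oadd (oadd ?qm ?q0) ?qp) Tm) (2 * pi)"
      unfolding expi_def Q by (simp only:)
    interpret ct: charge_transport B U \<psi> ?qm ?q0 ?qp Tm Tp Km Kp km kp "Alg M" "Alg P" \<epsilon> N
    proof
      show "oalgebra B (Alg M)" "oalgebra B (Alg P)" by (rule alg)+
      show "omul B A C = omul B C A" if "A \<in> Alg M" "C \<in> Alg P" for A C
        using that disj by (rule alg_commute)
      show "omul B A ?q0 = omul B ?q0 A" if "A \<in> Alg M" for A
        using that q_alg(2) by (rule alg_commute) auto
      show "omul B A ?q0 = omul B ?q0 A" if "A \<in> Alg P" for A
        using that q_alg(2) by (rule alg_commute) auto
      show "?qm \<in> Alg M" "?qp \<in> Alg P"
        using q_alg(1,3) alg_mono[of "Y \<inter> M" M] alg_mono[of "Y \<inter> P" P] by auto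
      show "vnorm B (oapp B U \<psi> - vsc (inprod B \<psi> (oapp B U \<psi>)) \<psi>) \<le> \<epsilon>"
        unfolding var by (rule eU)
      show "vnorm B (oapp B Qb \<psi> - vsc (inprod B \<psi> (oapp B Qb \<psi>)) \<psi>) \<le> \<epsilon>"
        if "Qb = osub (osub (oadd (oadd ?qm ?q0) ?qp) Km) Kp" for Qb
        unfolding var that Q[symmetric] by (rule eQ)
      show "obounded B (osub (osub (osub (oconj B U Q') Q') Tm) Tp) \<epsilon>"
        if "Q' = oadd (oadd ?qm ?q0) ?qp" for Q'
        unfolding that Q[symmetric] by (rule bnd[OF eT])
      show "obounded B (osub (expi (oadd (oadd (oadd ?qm ?q0) ?qp) Tm) (2 * pi)) (oid B)) \<epsilon>"
        using bnd[OF eE] unfolding E .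
      show "cmod (inprod B \<psi> (oapp B (omul B A C) \<psi>)
          - inprod B \<psi> (oapp B A \<psi>) * inprod B \<psi> (oapp B C \<psi>)) \<le> \<epsilon>"
        if "A \<in> Alg M" "C \<in> Alg P" "obounded B A 2" "obounded B C 2" for A C
        by (rule cl[OF that(1,2)]) (rule opnorm_le[OF that(3)] opnorm_le[OF that(4)]; simp)+
    qed (rule fin inM inP sa q_sa q_int U psi bnd[OF eKm] bnd[OF eKp] bnd[OF N(1)] bnd[OF N(2)] N0 e0 True; assumption?)+
    have "cmod (cis (2 * pi * t) - 1) \<le> 500 * (N + 1) * sqrt \<epsilon>"
      using ct.phase_near_one unfolding ct.\<tau>_def t_def .
    then show ?thesis unfolding t using infdist_Ints_le(1)[of t] by linarith
  qed
qed

text \<open>The radius L div 32 grows linearly, so almost locality becomes rapid decay in L, yet it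
  is small enough to stay inside the strip.\<close>

lemma conjugation_approximant:
  fixes X S :: "nat \<Rightarrow> int list set" and K U :: "nat \<Rightarrow> op"
  assumes la: "\<And>L. local_algebra (Bs L) (Alg L)"
    and U: "\<And>L. even L \<Longrightarrow> L > 0 \<Longrightarrow> unitary (Bs L) (U L)"
    and assm_i: "\<forall>k::nat. \<exists>C. \<forall>L X A r. even L \<and> L > 0 \<and> X \<subseteq> lattice d L \<and> A \<in> Alg L X \<and> r \<ge> (1::nat)
        \<longrightarrow> (\<exists>R \<in> Alg L (nbhd d L X (real r)).
              opnorm (Bs L) (osub (oconj (Bs L) (U L) A) R)
                \<le> C * opnorm (Bs L) A * real (card X) / real r ^ k)"
    and X: "\<And>L. X L \<subseteq> lattice d L"
    and S: "\<And>L. even L \<Longrightarrow> L \<ge> 32 \<Longrightarrow> nbhd d L (X L) (real (L div 32)) \<subseteq> S L"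
    and K: "\<And>L. even L \<Longrightarrow> L > 0 \<Longrightarrow> self_adjoint (Bs L) (K L) \<and> K L \<in> Alg L (X L) \<and>
      opnorm (Bs L) (K L) \<le> C * real (card (lattice d L))"
  shows "\<exists>k. (\<forall>L. even L \<and> L \<ge> 32 \<longrightarrow> k L \<in> Alg L (S L) \<and> self_adjoint (Bs L) (k L)) \<and>
    rapid (\<lambda>L. if L \<ge> 32
      then opnorm (Bs L) (osub (oconj (Bs L) (U L) (K L)) (k L)) else 0)"
proof (rule rapid_uniform_choice[where P = "\<lambda>L R. R \<in> Alg L (S L) \<and> self_adjoint (Bs L) R"
      and f = "\<lambda>L R. opnorm (Bs L) (osub (oconj (Bs L) (U L) (K L)) R)"])
  have fb: "fin_basis (Bs L)" for L using la[of L] by (simp add: local_algebra_def)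
  show "0 \<le> opnorm (Bs L) (osub (oconj (Bs L) (U L) (K L)) R)" for L R
    by (rule fin_basis.opnorm_nonneg[OF fb])
  fix k
  \<comment> \<open>The extra 2d powers pay for two volume factors: one from the norm of
    \<open>K L\<close>, one from the size of its support.\<close>
  let ?k = "k + 2 * d"
  obtain Ci where Ci: "\<And>L X A r. even L \<and> L > 0 \<and> X \<subseteq> lattice d L \<and> A \<in> Alg L X \<and> r \<ge> (1::nat)
        \<Longrightarrow> (\<exists>R \<in> Alg L (nbhd d L X (real r)).
              opnorm (Bs L) (osub (oconj (Bs L) (U L) A) R)
                \<le> Ci * opnorm (Bs L) A * real (card X) / real r ^ ?k)"
    using assm_i[rule_format, of ?k] by blast
  define D where "D = \<bar>Ci\<bar> * \<bar>C\<bar> * (2 ^ d * 2 ^ d) * 64 ^ ?k"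
  have "\<exists>R. (R \<in> Alg L (S L) \<and> self_adjoint (Bs L) R) \<and>
      opnorm (Bs L) (osub (oconj (Bs L) (U L) (K L)) R) \<le> D / real L ^ k"
    if L: "even L" "L \<ge> 32" for L
  proof -
    interpret local_algebra "Bs L" "Alg L" by (rule la)
    have L0: "L > 0" using L by simp
    let ?K = "oconj (Bs L) (U L) (K L)"
    let ?r = "L div 32" and ?c = "real (card (lattice d L))"
    have r: "?r \<ge> 1" using L by simp
    obtain R where R: "R \<in> Alg L (nbhd d L (X L) (real ?r))"
      and Rle: "opnorm (Bs L) (osub ?K R) \<le> Ci * opnorm (Bs L) (K L) * real (card (X L)) / real ?r ^ ?k"
      using Ci[of L "X L" "K L" ?r] L(1) L0 X[of L] K[OF L(1) L0] r by blast
    have cX: "real (card (X L)) \<le> ?c" using X finite_lattice by (simp add: card_mono)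
    \<comment> \<open>Rounding down loses at most a factor 2 once L/32 is at least 1; this produces
      the powers of 64 in \<open>D\<close>.\<close>
    have rL: "real L / 64 \<le> real ?r"
    proof -
      have "L \<le> 64 * ?r" using L by presburger
      then have "real L \<le> real (64 * ?r)" by (rule of_nat_mono)
      then show ?thesis by simp
    qed
    have "Ci * opnorm (Bs L) (K L) * real (card (X L)) \<le> \<bar>Ci\<bar> * (\<bar>C\<bar> * ?c) * ?c"
    proof -
      have "Ci * opnorm (Bs L) (K L) \<le> \<bar>Ci\<bar> * opnorm (Bs L) (K L)"
        by (intro mult_right_mono opnorm_nonneg) simp
      moreover have "\<bar>Ci\<bar> * opnorm (Bs L) (K L) \<le> \<bar>Ci\<bar> * (\<bar>C\<bar> * ?c)"
      proof (rule mult_left_mono)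
        have "opnorm (Bs L) (K L) \<le> C * ?c" using K[OF L(1) L0] by simp
        also have "C * ?c \<le> \<bar>C\<bar> * ?c" by (intro mult_right_mono) auto
        finally show "opnorm (Bs L) (K L) \<le> \<bar>C\<bar> * ?c" .
      qed simp
      ultimately have "Ci * opnorm (Bs L) (K L) \<le> \<bar>Ci\<bar> * (\<bar>C\<bar> * ?c)" by (rule order_trans)
      then show ?thesis using cX by (rule mult_mono) auto
    qed
    also have "\<dots> \<le> \<bar>Ci\<bar> * (\<bar>C\<bar> * (2 ^ d * real L ^ d)) * (2 ^ d * real L ^ d)"
      using card_lattice_poly[OF L0, of d] by (intro mult_mono mult_left_mono) auto
    finally have num: "Ci * opnorm (Bs L) (K L) * real (card (X L))
        \<le> \<bar>Ci\<bar> * (\<bar>C\<bar> * (2 ^ d * real L ^ d)) * (2 ^ d * real L ^ d)" .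
    have "opnorm (Bs L) (osub ?K R)
        \<le> (\<bar>Ci\<bar> * (\<bar>C\<bar> * (2 ^ d * real L ^ d)) * (2 ^ d * real L ^ d)) / (real L / 64) ^ ?k"
      using L0 rL by (intro order_trans[OF Rle] frac_le num power_mono) auto
    also have "\<dots> = D / real L ^ k"
    proof -
      have "real L ^ ?k = real L ^ k * (real L ^ d * real L ^ d)"
        by (simp add: power_add mult_2)
      moreover have "real L ^ d \<noteq> 0" "real L ^ k \<noteq> 0" using L0 by auto
      ultimately show ?thesis unfolding D_def power_divide using L0 by (simp add: mult_ac)
    qed
    finally have le: "opnorm (Bs L) (osub ?K R) \<le> D / real L ^ k" .
    have RS: "R \<in> Alg L (S L)" using R alg_mono[OF S[OF L]] by blast
    have "self_adjoint (Bs L) ?K"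
      using K[OF L(1) L0] U[OF L(1) L0] by (intro self_adjoint_conj) (auto simp: unitary_def)
    note sym = symmetrize[OF RS this obounded_opnorm opnorm_nonneg]
    have "opnorm (Bs L) (osub ?K (osc (of_real (1 / 2)) (oadd R (oadj R)))) \<le> D / real L ^ k"
      using opnorm_le[OF sym(3) opnorm_nonneg] le by (rule order_trans)
    then show ?thesis using sym(1,2) by blast
  qed
  then show "\<exists>C. \<forall>L. even L \<and> 32 \<le> L \<longrightarrow> (\<exists>R. (R \<in> Alg L (S L) \<and> self_adjoint (Bs L) R) \<and>
      opnorm (Bs L) (osub (oconj (Bs L) (U L) (K L)) R) \<le> C / real L ^ k)"
    by blast
qed

theorem theorem2p1:
  fixes d n :: nat
    and Bs :: "nat \<Rightarrow> cfg set" and Alg :: "nat \<Rightarrow> int list set \<Rightarrow> op set"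
    and U :: "nat \<Rightarrow> op" and \<Omega> :: "nat \<Rightarrow> vec" and Qx :: "nat \<Rightarrow> int list \<Rightarrow> op"
    and Tm Tp :: "nat \<Rightarrow> op"
  assumes d_pos: "d \<ge> 1" and n_pos: "n \<ge> 1"
    and system: "(Bs = spin_basis d n \<and> Alg = spin_alg d n)
               \<or> (Bs = fermi_basis d n \<and> Alg = fermi_alg d n)"
    and charges: "\<And>L x. even L \<Longrightarrow> L > 0 \<Longrightarrow> x \<in> lattice d L \<Longrightarrow>
        Qx L x \<in> Alg L {x} \<and> self_adjoint (Bs L) (Qx L x) \<and> spectrum (Bs L) (Qx L x) \<subseteq> \<int>"
    and U_unitary: "\<And>L. even L \<Longrightarrow> L > 0 \<Longrightarrow> unitary (Bs L) (U L)"
    and Omega_unit: "\<And>L. even L \<Longrightarrow> L > 0 \<Longrightarrow> \<Omega> L \<in> vecs (Bs L) \<and> vnorm (Bs L) (\<Omega> L) = 1"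
    and assm_i: "\<forall>k::nat. \<exists>C. \<forall>L X A r. even L \<and> L > 0 \<and> X \<subseteq> lattice d L \<and> A \<in> Alg L X \<and> r \<ge> (1::nat)
        \<longrightarrow> (\<exists>R \<in> Alg L (nbhd d L X (real r)).
              opnorm (Bs L) (osub (omul (Bs L) (omul (Bs L) (oadj (U L)) A) (U L)) R)
                \<le> C * opnorm (Bs L) A * real (card X) / real r ^ k)"
    and assm_ii: "\<And>L. even L \<Longrightarrow> L > 0 \<Longrightarrow>
        self_adjoint (Bs L) (Tm L) \<and> Tm L \<in> Alg L (S_minus d L) \<and>
        self_adjoint (Bs L) (Tp L) \<and> Tp L \<in> Alg L (S_plus d L)"
    and assm_ii': "rapid (\<lambda>L. opnorm (Bs L)
        (osub (osub (osub (omul (Bs L) (omul (Bs L) (oadj (U L)) (charge_sum (Qx L) (Gamma d L))) (U L))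
                          (charge_sum (Qx L) (Gamma d L))) (Tm L)) (Tp L)))"
    and assm_iii: "rapid (\<lambda>L. var (Bs L) (\<Omega> L) (U L))"
    and assm_iv: "\<exists>Km Kp :: nat \<Rightarrow> op. \<exists>C.
        (\<forall>L. even L \<and> L > 0 \<longrightarrow>
           self_adjoint (Bs L) (Km L) \<and> Km L \<in> Alg L (nbhd d L (bdry_minus d L) (real L / 16)) \<and>
           self_adjoint (Bs L) (Kp L) \<and> Kp L \<in> Alg L (nbhd d L (bdry_plus d L) (real L / 16)) \<and>
           opnorm (Bs L) (Km L) \<le> C * real (card (lattice d L)) \<and>
           opnorm (Bs L) (Kp L) \<le> C * real (card (lattice d L))) \<and>
        rapid (\<lambda>L. var (Bs L) (\<Omega> L) (osub (osub (charge_sum (Qx L) (Gamma d L)) (Km L)) (Kp L)))"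
    and assm_v: "\<exists>c C. 0 < c \<and> 0 < C \<and>
        (\<forall>L X Y A B. even L \<and> L > 0 \<and> X \<subseteq> lattice d L \<and> Y \<subseteq> lattice d L \<and>
           A \<in> Alg L X \<and> B \<in> Alg L Y \<longrightarrow>
           cmod (inprod (Bs L) (\<Omega> L) (oapp (Bs L) (omul (Bs L) A B) (\<Omega> L))
                 - inprod (Bs L) (\<Omega> L) (oapp (Bs L) A (\<Omega> L)) * inprod (Bs L) (\<Omega> L) (oapp (Bs L) B (\<Omega> L)))
           \<le> C * opnorm (Bs L) A * opnorm (Bs L) B * real (card X) * real (card Y)
                * exp (- c * real (d1 L X Y)))"
    and T_exp: "rapid (\<lambda>L. opnorm (Bs L)
        (osub (oexp (Bs L) (osc (2 * of_real pi * \<i>) (oadd (charge_sum (Qx L) (Gamma d L)) (Tm L))))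
              (oid (Bs L))))"
    and T_bound: "\<exists>C. \<forall>L. even L \<and> L > 0 \<longrightarrow>
        opnorm (Bs L) (Tm L) \<le> C * real (card (lattice d L)) \<and>
        opnorm (Bs L) (Tp L) \<le> C * real (card (lattice d L))"
  shows "rapid (\<lambda>L. infdist (inprod (Bs L) (\<Omega> L) (oapp (Bs L) (Tm L) (\<Omega> L))) \<int>)"
proof -
  have la: "local_algebra (Bs L) (Alg L)" for L
    using system local_algebra_spin local_algebra_fermi by auto
  have fb: "fin_basis (Bs L)" for L using la[of L] by (simp add: local_algebra_def)
  obtain Km Kp CK where K: "\<And>L. even L \<Longrightarrow> L > 0 \<Longrightarrow>
      self_adjoint (Bs L) (Km L) \<and> Km L \<in> Alg L (nbhd d L (bdry_minus d L) (real L / 16)) \<and>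
      self_adjoint (Bs L) (Kp L) \<and> Kp L \<in> Alg L (nbhd d L (bdry_plus d L) (real L / 16)) \<and>
      opnorm (Bs L) (Km L) \<le> CK * real (card (lattice d L)) \<and>
      opnorm (Bs L) (Kp L) \<le> CK * real (card (lattice d L))"
    and varQ: "rapid (\<lambda>L. var (Bs L) (\<Omega> L) (osub (osub (charge_sum (Qx L) (Gamma d L)) (Km L)) (Kp L)))"
    using assm_iv by blast
  obtain c C where c: "0 < c" "0 < C" and clust: "\<And>L X Y A B. even L \<and> L > 0 \<and> X \<subseteq> lattice d L \<and> Y \<subseteq> lattice d L \<and>
           A \<in> Alg L X \<and> B \<in> Alg L Y \<Longrightarrow>
           cmod (inprod (Bs L) (\<Omega> L) (oapp (Bs L) (omul (Bs L) A B) (\<Omega> L))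
                 - inprod (Bs L) (\<Omega> L) (oapp (Bs L) A (\<Omega> L)) * inprod (Bs L) (\<Omega> L) (oapp (Bs L) B (\<Omega> L)))
           \<le> C * opnorm (Bs L) A * opnorm (Bs L) B * real (card X) * real (card Y)
                * exp (- c * real (d1 L X Y))"
    using assm_v by blast
  obtain CT where CT: "\<And>L. even L \<Longrightarrow> L > 0 \<Longrightarrow> opnorm (Bs L) (Tm L) \<le> CT * real (card (lattice d L))"
    using T_bound by blast
  have r32: "real (L div 32) \<le> real L / 32" for L
  proof -
    have "real (32 * (L div 32)) \<le> real L" by (intro of_nat_mono) simp
    then show ?thesis by simp
  qed
  have nminus: "nbhd d L (nbhd d L (bdry_minus d L) (real L / 16)) (real (L div 32)) \<subseteq> S_minus d L" if "even L" "L \<ge> 32" for L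
    by (rule nbhd_bdry_minus(1)[OF d_pos]) (use that r32[of L] in auto)
  have Xminus: "nbhd d L (bdry_minus d L) (real L / 16) \<subseteq> lattice d L" for L
    by (auto simp: nbhd_def)
  have Kminus: "self_adjoint (Bs L) (Km L) \<and> Km L \<in> Alg L (nbhd d L (bdry_minus d L) (real L / 16)) \<and>
      opnorm (Bs L) (Km L) \<le> CK * real (card (lattice d L))" if "even L" "L > 0" for L
    using K[OF that] by blast
  obtain km where km: "\<And>L. even L \<Longrightarrow> L \<ge> 32 \<Longrightarrow> km L \<in> Alg L (S_minus d L) \<and> self_adjoint (Bs L) (km L)"
    and rkm: "rapid (\<lambda>L. if L \<ge> 32
      then opnorm (Bs L) (osub (oconj (Bs L) (U L) (Km L)) (km L)) else 0)"
    using conjugation_approximant[OF la U_unitary assm_i Xminus nminus Kminus] by blast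
  have nplus: "nbhd d L (nbhd d L (bdry_plus d L) (real L / 16)) (real (L div 32)) \<subseteq> S_plus d L" if "even L" "L \<ge> 32" for L
    by (rule nbhd_bdry_plus(1)[OF d_pos]) (use that r32[of L] in auto)
  have Xplus: "nbhd d L (bdry_plus d L) (real L / 16) \<subseteq> lattice d L" for L
    by (auto simp: nbhd_def)
  have Kplus: "self_adjoint (Bs L) (Kp L) \<and> Kp L \<in> Alg L (nbhd d L (bdry_plus d L) (real L / 16)) \<and>
      opnorm (Bs L) (Kp L) \<le> CK * real (card (lattice d L))" if "even L" "L > 0" for L
    using K[OF that] by blast
  obtain kp where kp: "\<And>L. even L \<Longrightarrow> L \<ge> 32 \<Longrightarrow> kp L \<in> Alg L (S_plus d L) \<and> self_adjoint (Bs L) (kp L)"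
    and rkp: "rapid (\<lambda>L. if L \<ge> 32
      then opnorm (Bs L) (osub (oconj (Bs L) (U L) (Kp L)) (kp L)) else 0)"
    using conjugation_approximant[OF la U_unitary assm_i Xplus nplus Kplus] by blast
  define e1 where "e1 L = sqrt (var (Bs L) (\<Omega> L) (U L))" for L
  define e2 where "e2 L = sqrt (var (Bs L) (\<Omega> L) (osub (osub (charge_sum (Qx L) (Gamma d L)) (Km L)) (Kp L)))" for L
  define e3 where "e3 L = opnorm (Bs L)
        (osub (osub (osub (oconj (Bs L) (U L) (charge_sum (Qx L) (Gamma d L)))
                          (charge_sum (Qx L) (Gamma d L))) (Tm L)) (Tp L))" for L
  define e4 where "e4 L = (if L \<ge> 32
      then opnorm (Bs L) (osub (oconj (Bs L) (U L) (Km L)) (km L)) else 0)" for L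
  define e5 where "e5 L = (if L \<ge> 32
      then opnorm (Bs L) (osub (oconj (Bs L) (U L) (Kp L)) (kp L)) else 0)" for L
  define e6 where "e6 L = opnorm (Bs L)
        (osub (oexp (Bs L) (osc (2 * of_real pi * \<i>) (oadd (charge_sum (Qx L) (Gamma d L)) (Tm L))))
              (oid (Bs L)))" for L
  \<comment> \<open>The clustering error for two observables of norm at most 2: their norms give 4,
    both supports are bounded by the volume, and the separation L/4 gives the rate c/4.\<close>
  define e7 where "e7 L = (4 * C * (real (card (lattice d L)) * real (card (lattice d L)))) * exp (- (c / 4) * real L)" for L
  define eps where "eps L = e1 L + e2 L + e3 L + e4 L + e5 L + e6 L + e7 L" for L
  have nonneg: "0 \<le> e1 L" "0 \<le> e2 L" "0 \<le> e3 L" "0 \<le> e4 L" "0 \<le> e5 L" "0 \<le> e6 L" "0 \<le> e7 L" for L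
    using fin_basis.opnorm_nonneg[OF fb] c
    unfolding e1_def e2_def e3_def e4_def e5_def e6_def e7_def by (auto simp: var_def)
  have r7: "rapid e7"
    unfolding e7_def
  proof (rule rapid_mult_poly)
    show "rapid (\<lambda>L. exp (- (c / 4) * real L))" using c by (intro rapid_exp) simp
    fix L :: nat assume "L > 0"
    have "4 * C * (real (card (lattice d L)) * real (card (lattice d L))) \<le> 4 * C * ((2 ^ d * real L ^ d) * (2 ^ d * real L ^ d))"
      using card_lattice_poly[OF \<open>L > 0\<close>, of d] c by (intro mult_left_mono mult_mono) auto
    then show "\<bar>4 * C * (real (card (lattice d L)) * real (card (lattice d L)))\<bar> \<le> (4 * C * (2 ^ d * 2 ^ d)) * real L ^ (d + d)"
      using c by (simp add: power_add mult_ac)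
  qed
  have "rapid eps"
    unfolding eps_def
    by (intro rapid_add r7 assm_ii'[folded e3_def] rkm[folded e4_def] rkp[folded e5_def] T_exp[folded e6_def]
        rapid_sqrt[OF assm_iii, folded e1_def] rapid_sqrt[OF varQ, folded e2_def])
  \<comment> \<open>One common bound for \<open>Tm\<close> and \<open>Km\<close>, polynomial in L
    and therefore harmless.\<close>
  define N where "N L = (\<bar>CT\<bar> + \<bar>CK\<bar>) * real (card (lattice d L))" for L
  have "rapid (\<lambda>L. 500 * (N L + 1) * sqrt (eps L))"
  proof (rule rapid_mult_poly[OF rapid_sqrt[OF \<open>rapid eps\<close>]])
    fix L :: nat assume "L > 0"
    have "N L \<le> (\<bar>CT\<bar> + \<bar>CK\<bar>) * (2 ^ d * real L ^ d)"
      unfolding N_def using card_lattice_poly[OF \<open>L > 0\<close>, of d] by (intro mult_left_mono) auto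
    moreover have "1 \<le> real L ^ d" using \<open>L > 0\<close> by (intro one_le_power) simp
    moreover have "0 \<le> N L" by (simp add: N_def)
    ultimately show "\<bar>500 * (N L + 1)\<bar> \<le> (500 * ((\<bar>CT\<bar> + \<bar>CK\<bar>) * 2 ^ d + 1)) * real L ^ d"
      by (simp add: algebra_simps)
  qed
  then show ?thesis
  \<comment> \<open>Below 32 the approximants \<open>km\<close> and \<open>kp\<close> are
    unspecified; those finitely many sizes are absorbed into the constants.\<close>
  proof (rule rapid_eventually_le[where ?L0.0 = 32])
    fix L :: nat assume L: "even L" "L \<ge> 32"
    then have L0: "L > 0" by simp
    interpret local_algebra "Bs L" "Alg L" by (rule la)
    have sub: "S_minus d L \<subseteq> lattice d L" "S_plus d L \<subseteq> lattice d L" "Gamma d L \<subseteq> lattice d L"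
      by (auto simp: S_minus_def S_plus_def Gamma_def)
    have "infdist (inprod (Bs L) (\<Omega> L) (oapp (Bs L) (Tm L) (\<Omega> L))) \<int> \<le> 500 * (N L + 1) * sqrt (eps L)"
    proof (rule infdist_expectation_le[where Qx = "Qx L" and Y = "Gamma d L" and M = "S_minus d L" and P = "S_plus d L"
          and U = "U L" and Tp = "Tp L" and Km = "Km L" and Kp = "Kp L" and km = "km L" and kp = "kp L"])
      show "finite (Gamma d L)" using finite_subset[OF sub(3) finite_lattice] .
      show "Qx L x \<in> Alg L {x} \<and> self_adjoint (Bs L) (Qx L x) \<and> spectrum (Bs L) (Qx L x) \<subseteq> \<int>"
        if "x \<in> Gamma d L" for x
        using charges[OF L(1) L0] that sub(3) by blast
      show "unitary (Bs L) (U L)" by (rule U_unitary[OF L(1) L0])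
      show "\<Omega> L \<in> vecs (Bs L)" "vnorm (Bs L) (\<Omega> L) = 1" using Omega_unit[OF L(1) L0] by auto
      show "S_minus d L \<inter> S_plus d L = {}" by (rule S_minus_S_plus_disjoint[OF L(1) L0])
      have "nbhd d L (bdry_minus d L) (real L / 16) \<subseteq> S_minus d L"
        using nbhd_bdry_minus(2)[OF d_pos L0, of 0] by simp
      then show "Km L \<in> Alg L (S_minus d L)" using K[OF L(1) L0] alg_mono by blast
      have "nbhd d L (bdry_plus d L) (real L / 16) \<subseteq> S_plus d L"
        using nbhd_bdry_plus(2)[OF d_pos L(2), of 0] by simp
      then show "Kp L \<in> Alg L (S_plus d L)" using K[OF L(1) L0] alg_mono by blast
      show "Tm L \<in> Alg L (S_minus d L)" "Tp L \<in> Alg L (S_plus d L)"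
        "self_adjoint (Bs L) (Tm L)" "self_adjoint (Bs L) (Tp L)"
        using assm_ii[OF L(1) L0] by auto
      show "km L \<in> Alg L (S_minus d L)" "self_adjoint (Bs L) (km L)"
        "kp L \<in> Alg L (S_plus d L)" "self_adjoint (Bs L) (kp L)"
        using km[OF L] kp[OF L] by auto
      show "self_adjoint (Bs L) (Km L)" "self_adjoint (Bs L) (Kp L)" using K[OF L(1) L0] by auto
      note e = nonneg[of L]
      show "opnorm (Bs L) (osub (osub (osub (oconj (Bs L) (U L) (charge_sum (Qx L) (Gamma d L)))
          (charge_sum (Qx L) (Gamma d L))) (Tm L)) (Tp L)) \<le> eps L"
        unfolding e3_def[symmetric] eps_def using e by linarith
      show "sqrt (var (Bs L) (\<Omega> L) (U L)) \<le> eps L"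
        unfolding e1_def[symmetric] eps_def using e by linarith
      show "sqrt (var (Bs L) (\<Omega> L) (osub (osub (charge_sum (Qx L) (Gamma d L)) (Km L)) (Kp L))) \<le> eps L"
        unfolding e2_def[symmetric] eps_def using e by linarith
      have "opnorm (Bs L) (osub (oconj (Bs L) (U L) (Km L)) (km L)) = e4 L"
        "opnorm (Bs L) (osub (oconj (Bs L) (U L) (Kp L)) (kp L)) = e5 L"
        using L by (simp_all add: e4_def e5_def)
      then show "opnorm (Bs L) (osub (oconj (Bs L) (U L) (Km L)) (km L)) \<le> eps L"
        "opnorm (Bs L) (osub (oconj (Bs L) (U L) (Kp L)) (kp L)) \<le> eps L"
        unfolding eps_def using e by linarith+
      show "opnorm (Bs L) (osub (oexp (Bs L) (osc (2 * of_real pi * \<i>) (oadd (charge_sum (Qx L) (Gamma d L)) (Tm L))))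
          (oid (Bs L))) \<le> eps L"
        unfolding e6_def[symmetric] eps_def using e by linarith
      let ?n = "real (card (lattice d L))"
      have cardS: "real (card (S_minus d L)) \<le> ?n" "real (card (S_plus d L)) \<le> ?n"
        using sub(1,2) finite_lattice[of d L] by (simp_all add: card_mono)
      show "cmod (inprod (Bs L) (\<Omega> L) (oapp (Bs L) (omul (Bs L) A D) (\<Omega> L))
          - inprod (Bs L) (\<Omega> L) (oapp (Bs L) A (\<Omega> L)) * inprod (Bs L) (\<Omega> L) (oapp (Bs L) D (\<Omega> L))) \<le> eps L"
        if AD: "A \<in> Alg L (S_minus d L)" "D \<in> Alg L (S_plus d L)" "opnorm (Bs L) A \<le> 2" "opnorm (Bs L) D \<le> 2" for A D
      proof -
        let ?d = "real (d1 L (S_minus d L) (S_plus d L))"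
        have "C * opnorm (Bs L) A * opnorm (Bs L) D * real (card (S_minus d L)) * real (card (S_plus d L)) * exp (- c * ?d)
            \<le> C * 2 * 2 * ?n * ?n * exp (- (c / 4) * real L)"
        proof (intro mult_mono cardS AD(3,4))
          have "c * (real L / 4) \<le> c * ?d"
            using d1_S_minus_S_plus[OF L(1) L0 d_pos] c by (intro mult_left_mono) auto
          then show "exp (- c * ?d) \<le> exp (- (c / 4) * real L)" by simp
        qed (use c opnorm_nonneg in auto)
        also have "\<dots> = e7 L" by (simp add: e7_def)
        also have "\<dots> \<le> eps L" unfolding eps_def using e by linarith
        finally have le: "C * opnorm (Bs L) A * opnorm (Bs L) D * real (card (S_minus d L)) * real (card (S_plus d L))
            * exp (- c * ?d) \<le> eps L" .
        show ?thesis
          by (rule order_trans[OF clust le]) (intro conjI L(1) L0 sub(1,2) AD(1,2))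
      qed
      let ?a = "real (card (lattice d L))"
      have "CT * ?a \<le> N L" "CK * ?a \<le> N L"
        unfolding N_def by (intro mult_right_mono; simp)+
      then show "opnorm (Bs L) (Tm L) \<le> N L" "opnorm (Bs L) (Km L) \<le> N L"
        using CT[OF L(1) L0] K[OF L(1) L0] by linarith+
    qed
    moreover have "0 \<le> infdist (inprod (Bs L) (\<Omega> L) (oapp (Bs L) (Tm L) (\<Omega> L))) \<int>"
      by (rule infdist_nonneg)
    ultimately show "\<bar>infdist (inprod (Bs L) (\<Omega> L) (oapp (Bs L) (Tm L) (\<Omega> L))) \<int>\<bar> \<le> \<bar>500 * (N L + 1) * sqrt (eps L)\<bar>"
      by linarith
  qed
qed

end
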